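(* Let $p>2$, $\alpha>2$, $\beta>2$, $\lambda>0$, $\lambda_0>0$, $\lambda_1>0$, let $\widetilde{\lambda}\in\mathbb{R}$ satisfy $|\widetilde{\lambda}|<\sqrt{\lambda_0\lambda_1}$, and let $\widetilde{h}\in\mathbb{R}$ be a constant satisfying $|\widetilde{h}|<\frac{q-2}{4(q+2)}$, where $q=\min\{p,\alpha,\beta\}$. Then for any $(u_0,u_1)\in H^1\times L^2$ such that $$H(0)=-\frac12\|u_1\|^2-\frac12\|u_0\|_1^2+\frac1p\|u_0\|_{L^p}^p+\frac1\alpha|u_0(0)|^\alpha+\frac1\beta|u_0(1)|^\beta-\widetilde{h}\,u_0(0)u_0(1)>0,$$ the weak solution $u$ of the problem $$u_{tt}-u_{xx}+u+\lambda u_t=|u|^{p-2}u,\quad 0<x<1,\ t>0,$$ $$u_x(0,t)=-|u(0,t)|^{\alpha-2}u(0,t)+\lambda_0u_t(0,t)+\widetilde{h}\,u(1,t)+\widetilde{\lambda}\,u_t(1,t),$$ $$-u_x(1,t)=-|u(1,t)|^{\beta-2}u(1,t)+\lambda_1u_t(1,t)+\widetilde{h}\,u(0,t)+\widetilde{\lambda}\,u_t(0,t),$$ $$u(x,0)=u_0(x),\quad u_t(x,0)=u_1(x),$$ blows up in finite time.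
   Context: $L^p=L^p(0,1)$, $H^1=W^{1,2}(0,1)$ (real-valued); $\|\cdot\|$ is the $L^2$ norm, $\langle\cdot,\cdot\rangle$ the $L^2$ inner product, and $\|v\|_1=(\|v\|^2+\|v_x\|^2)^{1/2}$. We write $u(t)=u(\cdot,t)$ and $u'=u_t$. A weak solution on $[0,T_*]$ is a function $u\in C([0,T_*];H^1)\cap C^1([0,T_*];L^2)$ with $u(0,\cdot),u(1,\cdot)\in H^1(0,T_* )$, $u(0)=u_0$, $u'(0)=u_1$, such that for every $v\in H^1$, in the sense of distributions in $t$, $$\frac{d}{dt}\langle u'(t),v\rangle+\langle u_x(t),v_x\rangle+\langle u(t),v\rangle+\lambda\langle u'(t),v\rangle+\left(\lambda_0u'(0,t)+\widetilde{h}u(1,t)+\widetilde{\lambda}u'(1,t)\right)v(0)+\left(\lambda_1u'(1,t)+\widetilde{h}u(0,t)+\widetilde{\lambda}u'(0,t)\right)v(1)$$ $$=\langle|u|^{p-2}u,v\rangle+|u(0,t)|^{\alpha-2}u(0,t)v(0)+|u(1,t)|^{\beta-2}u(1,t)v(1).$$ For every $(u_0,u_1)\in H^1\times L^2$ a unique weak solution exists locally in time; $u$ denotes its maximal extension, defined on $[0,T_{\max})$. "Blows up in finite time" means: $T_{\max}<\infty$ and $\|u'(t)\|+\|u(t)\|_1$ is unbounded on $[0,T_{\max})$. *)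

theory Defs
  imports "HOL-Analysis.Analysis"
begin

definition L2 :: "real \<Rightarrow> real \<Rightarrow> (real \<Rightarrow> real) set" where
  "L2 a b = {f \<in> borel_measurable (lebesgue_on {a<..<b}).
               integrable (lebesgue_on {a<..<b}) (\<lambda>x. (f x)\<^sup>2)}"

definition L2_inner :: "real \<Rightarrow> real \<Rightarrow> (real \<Rightarrow> real) \<Rightarrow> (real \<Rightarrow> real) \<Rightarrow> real" where
  "L2_inner a b f g = (LINT x|lebesgue_on {a<..<b}. f x * g x)"

definition L2_norm :: "real \<Rightarrow> real \<Rightarrow> (real \<Rightarrow> real) \<Rightarrow> real" where
  "L2_norm a b f = sqrt (L2_inner a b f f)"

text \<open>Test functions: infinitely differentiable with compact support in \<open>(a, b)\<close>.\<close>

definition test_function :: "real \<Rightarrow> real \<Rightarrow> (real \<Rightarrow> real) \<Rightarrow> bool" where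
  "test_function a b \<phi> \<longleftrightarrow>
     (\<forall>n x. ((deriv ^^ n) \<phi>) field_differentiable (at x)) \<and>
     closure {x. \<phi> x \<noteq> 0} \<subseteq> {a<..<b}"

definition has_weak_derivative ::
  "real \<Rightarrow> real \<Rightarrow> (real \<Rightarrow> real) \<Rightarrow> (real \<Rightarrow> real) \<Rightarrow> bool" where
  "has_weak_derivative a b f g \<longleftrightarrow>
     (\<forall>\<phi>. test_function a b \<phi> \<longrightarrow>
        L2_inner a b f (deriv \<phi>) = - L2_inner a b g \<phi>)"

text \<open>
  \<open>W\<^sup>1\<^sup>,\<^sup>2(a, b)\<close>. Each class in this space has exactly one representative that is
  continuous on \<open>[a, b]\<close>; we require functions to be this representative, so that the boundary
  traces are the plain values at \<open>a\<close> and \<open>b\<close>. Values outside \<open>[a, b]\<close> are irrelevant.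
\<close>

definition H1 :: "real \<Rightarrow> real \<Rightarrow> (real \<Rightarrow> real) set" where
  "H1 a b = {v \<in> L2 a b. continuous_on {a..b} v \<and> (\<exists>g \<in> L2 a b. has_weak_derivative a b v g)}"

text \<open>The weak derivative is unique almost everywhere, so it does not matter which one is chosen.\<close>

definition weak_deriv :: "real \<Rightarrow> real \<Rightarrow> (real \<Rightarrow> real) \<Rightarrow> real \<Rightarrow> real" where
  "weak_deriv a b v = (SOME g. g \<in> L2 a b \<and> has_weak_derivative a b v g)"

definition H1_norm :: "real \<Rightarrow> real \<Rightarrow> (real \<Rightarrow> real) \<Rightarrow> real" where
  "H1_norm a b v = sqrt ((L2_norm a b v)\<^sup>2 + (L2_norm a b (weak_deriv a b v))\<^sup>2)"

text \<open>
  Functions of time and space are curried, time first: \<open>u t\<close> is the function \<open>u(\<cdot>, t)\<close>.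
\<close>

definition continuous_in_H1 :: "real \<Rightarrow> (real \<Rightarrow> real \<Rightarrow> real) \<Rightarrow> bool" where
  "continuous_in_H1 T u \<longleftrightarrow>
     (\<forall>t\<in>{0..T}. u t \<in> H1 0 1) \<and>
     (\<forall>t\<in>{0..T}. ((\<lambda>s. H1_norm 0 1 (\<lambda>x. u s x - u t x)) \<longlongrightarrow> 0) (at t within {0..T}))"

text \<open>
  \<open>u \<in> C\<^sup>1([0, T]; L\<^sup>2)\<close> with derivative \<open>u'\<close>. The value \<open>u' t\<close> is only determined as an element
  of \<open>L\<^sup>2\<close>, that is, almost everywhere in space.
\<close>

definition C1_in_L2 :: "real \<Rightarrow> (real \<Rightarrow> real \<Rightarrow> real) \<Rightarrow> (real \<Rightarrow> real \<Rightarrow> real) \<Rightarrow> bool" where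
  "C1_in_L2 T u u' \<longleftrightarrow>
     (\<forall>t\<in>{0..T}. u t \<in> L2 0 1 \<and> u' t \<in> L2 0 1) \<and>
     (\<forall>t\<in>{0..T}. ((\<lambda>s. L2_norm 0 1 (\<lambda>x. (u s x - u t x) / (s - t) - u' t x)) \<longlongrightarrow> 0)
                  (at t within {0..T})) \<and>
     (\<forall>t\<in>{0..T}. ((\<lambda>s. L2_norm 0 1 (\<lambda>x. u' s x - u' t x)) \<longlongrightarrow> 0) (at t within {0..T}))"

text \<open>
  Weak solution on \<open>[0, T]\<close>, with \<open>u'\<close> the derivative of \<open>u\<close> as an \<open>L\<^sup>2\<close>-valued function. Since
  \<open>u'(t)\<close> has no traces, \<open>u'(0,t)\<close> and \<open>u'(1,t)\<close> in the equation are the weak time derivatives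
  \<open>d0\<close>, \<open>d1\<close> of \<open>u(0,\<cdot>), u(1,\<cdot>) \<in> H\<^sup>1(0, T)\<close>. The equation is tested with \<open>\<phi> \<in> C\<^sub>c\<^sup>\<infinity>(0, T)\<close> in time.
\<close>

definition weak_solution ::
  "real \<Rightarrow> real \<Rightarrow> real \<Rightarrow> real \<Rightarrow> real \<Rightarrow> real \<Rightarrow> real \<Rightarrow> real \<Rightarrow>
   (real \<Rightarrow> real) \<Rightarrow> (real \<Rightarrow> real) \<Rightarrow> real \<Rightarrow>
   (real \<Rightarrow> real \<Rightarrow> real) \<Rightarrow> (real \<Rightarrow> real \<Rightarrow> real) \<Rightarrow> bool" where
  "weak_solution p \<alpha> \<beta> lam lam0 lam1 lamt ht u0 u1 T u u' \<longleftrightarrow>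
     0 < T \<and>
     continuous_in_H1 T u \<and> C1_in_L2 T u u' \<and>
     (\<lambda>t. u t 0) \<in> H1 0 T \<and> (\<lambda>t. u t 1) \<in> H1 0 T \<and>
     (\<forall>x\<in>{0..1}. u 0 x = u0 x) \<and>
     (AE x in lebesgue_on {0<..<1}. u' 0 x = u1 x) \<and>
     (let d0 = weak_deriv 0 T (\<lambda>t. u t 0);
          d1 = weak_deriv 0 T (\<lambda>t. u t 1)
      in \<forall>v\<in>H1 0 1. \<forall>\<phi>. test_function 0 T \<phi> \<longrightarrow>
           - (LINT t|lebesgue_on {0<..<T}. L2_inner 0 1 (u' t) v * deriv \<phi> t)
           + (LINT t|lebesgue_on {0<..<T}.
                (L2_inner 0 1 (weak_deriv 0 1 (u t)) (weak_deriv 0 1 v)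
                 + L2_inner 0 1 (u t) v
                 + lam * L2_inner 0 1 (u' t) v
                 + (lam0 * d0 t + ht * u t 1 + lamt * d1 t) * v 0
                 + (lam1 * d1 t + ht * u t 0 + lamt * d0 t) * v 1) * \<phi> t)
           = (LINT t|lebesgue_on {0<..<T}.
                (L2_inner 0 1 (\<lambda>x. \<bar>u t x\<bar> powr (p - 2) * u t x) v
                 + \<bar>u t 0\<bar> powr (\<alpha> - 2) * u t 0 * v 0
                 + \<bar>u t 1\<bar> powr (\<beta> - 2) * u t 1 * v 1) * \<phi> t))"

text \<open>
  \<open>u\<close> is a weak solution on \<open>[0, Tmax)\<close>, where \<open>Tmax\<close> may be infinite, and no weak solution on
  an interval \<open>[0, T]\<close> with \<open>T \<ge> Tmax\<close> extends it.
\<close>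

definition maximal_weak_solution ::
  "real \<Rightarrow> real \<Rightarrow> real \<Rightarrow> real \<Rightarrow> real \<Rightarrow> real \<Rightarrow> real \<Rightarrow> real \<Rightarrow>
   (real \<Rightarrow> real) \<Rightarrow> (real \<Rightarrow> real) \<Rightarrow> ereal \<Rightarrow>
   (real \<Rightarrow> real \<Rightarrow> real) \<Rightarrow> (real \<Rightarrow> real \<Rightarrow> real) \<Rightarrow> bool" where
  "maximal_weak_solution p \<alpha> \<beta> lam lam0 lam1 lamt ht u0 u1 Tmax u u' \<longleftrightarrow>
     0 < Tmax \<and>
     (\<forall>T. 0 < T \<and> ereal T < Tmax \<longrightarrow>
        weak_solution p \<alpha> \<beta> lam lam0 lam1 lamt ht u0 u1 T u u') \<and>
     \<not> (\<exists>T v v'. Tmax \<le> ereal T \<and>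
          weak_solution p \<alpha> \<beta> lam lam0 lam1 lamt ht u0 u1 T v v' \<and>
          (\<forall>t. 0 \<le> t \<and> ereal t < Tmax \<longrightarrow> (\<forall>x\<in>{0..1}. v t x = u t x)))"

definition blows_up_in_finite_time ::
  "ereal \<Rightarrow> (real \<Rightarrow> real \<Rightarrow> real) \<Rightarrow> (real \<Rightarrow> real \<Rightarrow> real) \<Rightarrow> bool" where
  "blows_up_in_finite_time Tmax u u' \<longleftrightarrow>
     Tmax < \<infinity> \<and>
     \<not> bdd_above ((\<lambda>t. L2_norm 0 1 (u' t) + H1_norm 0 1 (u t)) ` {t. 0 \<le> t \<and> ereal t < Tmax})"

definition H_initial ::
  "real \<Rightarrow> real \<Rightarrow> real \<Rightarrow> real \<Rightarrow> (real \<Rightarrow> real) \<Rightarrow> (real \<Rightarrow> real) \<Rightarrow> real" where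
  "H_initial p \<alpha> \<beta> ht u0 u1 =
     - (1 / 2) * (L2_norm 0 1 u1)\<^sup>2 - (1 / 2) * (H1_norm 0 1 u0)\<^sup>2
     + (1 / p) * (LINT x|lebesgue_on {0<..<1}. \<bar>u0 x\<bar> powr p)
     + (1 / \<alpha>) * \<bar>u0 0\<bar> powr \<alpha> + (1 / \<beta>) * \<bar>u0 1\<bar> powr \<beta>
     - ht * u0 0 * u0 1"

end

theory Submission
  imports Defs
begin

text \<open>
  Regard \<open>u\<close> as a curve in Hilbert space: the classes of \<open>u(t)\<close>, \<open>u'(t)\<close> in \<open>L\<^sup>2\<close>, the pair \<open>(u, u\<^sub>x)\<close> in
  \<open>L\<^sup>2 \<times> L\<^sup>2\<close>, whose norm is the \<open>H\<^sup>1\<close> norm, and the two traces, which are primitives of \<open>L\<^sup>2\<close> functions of time.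
  Testing the equation with increments of \<open>u\<close> and with \<open>u\<close> itself yields the energy balance
  \<open>H(t) = H(0) + dissipated energy\<close> and the derivative of \<open>\<langle>u', u\<rangle> + (damping form of u) / 2\<close>. If the solution
  were global, Levine's concavity method would contradict \<open>H(0) > 0\<close>, so the maximal time is finite.
  If the norm stayed bounded up to the maximal time, the energy estimate for the difference
  \<open>u(\<cdot> + \<delta>) - u\<close> together with Gronwall's inequality would make \<open>(u', u)\<close> uniformly continuous in time; the
  limit at the maximal time would then extend the solution to the closed interval.
\<close>

text \<open>Two obstacles shape the proof. The velocity lies only in L^2, so it is no admissible
  test function and has no boundary values, although the boundary damping is quadratic in the
  boundary velocities. Increments of \<open>u\<close> are in H^1, which is why the equation is
  rewritten as a relation between increments of time primitives. For the same reason the concavity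
  functional contains the time integral of the whole damping form, interior and boundary: its
  derivative then involves no boundary velocity. The added parabola b (t + \<tau>)^2 makes the
  initial slope positive whatever the sign of <u_1, u_0>; it costs a term that is paid for by b
  \<le> 2 H(0), and this is where H(0) > 0 enters. At a finite maximal time no local existence
  theorem is invoked. Maximality forbids a solution on the closed interval, so it suffices to
  construct the final state and to show that the traces keep square integrable derivatives up to
  that time. The energy balance gives the latter, since a bounded norm leaves only a bounded amount
  of energy to dissipate.\<close>

lemmas hk_integral_add = Henstock_Kurzweil_Integration.integral_add
  and hk_integral_diff = Henstock_Kurzweil_Integration.integral_diff
  and hk_integrable_add = Henstock_Kurzweil_Integration.integrable_add
  and hk_integrable_diff = Henstock_Kurzweil_Integration.integrable_diff
  and hk_integral_cong = Henstock_Kurzweil_Integration.integral_cong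
  and hk_integral_combine = Henstock_Kurzweil_Integration.integral_combine
  and hk_integral_restrict_Int = Henstock_Kurzweil_Integration.integral_restrict_Int

section \<open>Square integrable functions on an interval\<close>

lemma L2_measurable: "f \<in> L2 a b \<Longrightarrow> f \<in> borel_measurable (lebesgue_on {a<..<b})"
  and L2_square_integrable: "f \<in> L2 a b \<Longrightarrow> integrable (lebesgue_on {a<..<b}) (\<lambda>x. (f x)\<^sup>2)"
  by (auto simp: L2_def)

lemma L2_mult_integrable:
  assumes "f \<in> L2 a b" "g \<in> L2 a b"
  shows "integrable (lebesgue_on {a<..<b}) (\<lambda>x. f x * g x)"
proof (rule Bochner_Integration.integrable_bound)
  show "integrable (lebesgue_on {a<..<b}) (\<lambda>x. (f x)\<^sup>2 + (g x)\<^sup>2)"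
    using assms by (auto intro: L2_square_integrable)
  show "(\<lambda>x. f x * g x) \<in> borel_measurable (lebesgue_on {a<..<b})"
    using assms by (intro borel_measurable_times L2_measurable)
  have "\<bar>x * y\<bar> \<le> x\<^sup>2 + y\<^sup>2" for x y :: real
  proof -
    have "2 * (\<bar>x\<bar> * \<bar>y\<bar>) \<le> x\<^sup>2 + y\<^sup>2"
      using zero_le_power2[of "\<bar>x\<bar> - \<bar>y\<bar>"] by (simp add: power2_diff)
    moreover have "0 \<le> \<bar>x\<bar> * \<bar>y\<bar>" by simp
    ultimately show ?thesis unfolding abs_mult by linarith
  qed
  then show "AE x in lebesgue_on {a<..<b}. norm (f x * g x) \<le> norm ((f x)\<^sup>2 + (g x)\<^sup>2)"
    by simp
qed

lemma L2_add: assumes "f \<in> L2 a b" "g \<in> L2 a b" shows "(\<lambda>x. f x + g x) \<in> L2 a b"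
proof -
  have "(\<lambda>x. (f x + g x)\<^sup>2) = (\<lambda>x. (f x)\<^sup>2 + (g x)\<^sup>2 + 2 * (f x * g x))"
    by (simp add: power2_sum algebra_simps fun_eq_iff)
  with assms L2_mult_integrable[OF assms] show ?thesis
    unfolding L2_def by auto
qed

lemma L2_scale: assumes "f \<in> L2 a b" shows "(\<lambda>x. c * f x) \<in> L2 a b"
  using assms unfolding L2_def by (auto simp: power_mult_distrib)

lemma L2_uminus: "f \<in> L2 a b \<Longrightarrow> (\<lambda>x. - f x) \<in> L2 a b"
  using L2_scale[of f a b "-1"] by simp

lemma L2_diff: "f \<in> L2 a b \<Longrightarrow> g \<in> L2 a b \<Longrightarrow> (\<lambda>x. f x - g x) \<in> L2 a b"
  using L2_add[OF _ L2_uminus, of f a b g] by simp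

lemma continuous_on_Icc_bounded:
  fixes f :: "real \<Rightarrow> 'a::real_normed_vector"
  assumes "continuous_on {a..b} f"
  shows "\<exists>M\<ge>0. \<forall>x\<in>{a..b}. norm (f x) \<le> M"
proof -
  have "bounded (f ` {a..b})"
    by (intro compact_imp_bounded compact_continuous_image assms) simp
  then obtain M where "\<forall>x\<in>{a..b}. norm (f x) \<le> M" by (auto simp: bounded_iff)
  then have "\<forall>x\<in>{a..b}. norm (f x) \<le> max M 0" by (auto simp: le_max_iff_disj)
  then show ?thesis by (intro exI[of _ "max M 0"]) simp
qed

lemma L2_bounded:
  assumes "f \<in> borel_measurable (lebesgue_on {a<..<b})" "\<And>x. x \<in> {a<..<b} \<Longrightarrow> \<bar>f x\<bar> \<le> M"
  shows "f \<in> L2 a b"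
proof -
  have "(f x)\<^sup>2 \<le> M\<^sup>2" if "x \<in> {a<..<b}" for x
    using power_mono[OF assms(2)[OF that], of 2] by simp
  then have "AE x in lebesgue_on {a<..<b}. norm ((f x)\<^sup>2) \<le> M\<^sup>2"
    by (intro AE_I2) simp
  moreover have "emeasure (lebesgue_on {a<..<b}) (space (lebesgue_on {a<..<b})) < \<infinity>"
    by (cases "a \<le> b") (simp_all add: emeasure_restrict_space emeasure_lborel_Ioo)
  then have "finite_measure (lebesgue_on {a<..<b})"
    by (intro finite_measureI) auto
  ultimately have "integrable (lebesgue_on {a<..<b}) (\<lambda>x. (f x)\<^sup>2)"
    using assms(1) finite_measure.integrable_const_bound by (metis (mono_tags) borel_measurable_power)
  with assms(1) show ?thesis by (auto simp: L2_def)
qed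

lemma L2_continuous:
  assumes "continuous_on {a..b} f" shows "f \<in> L2 a b"
proof -
  obtain M where "\<And>x. x \<in> {a..b} \<Longrightarrow> \<bar>f x\<bar> \<le> M"
    using continuous_on_Icc_bounded[OF assms] by (metis real_norm_def)
  moreover have "f \<in> borel_measurable (lebesgue_on {a<..<b})"
    by (rule continuous_imp_measurable_on_sets_lebesgue)
      (auto intro: continuous_on_subset[OF assms])
  ultimately show ?thesis by (intro L2_bounded[of f a b M]) auto
qed

lemma L2_const: "(\<lambda>x. c) \<in> L2 a b"
  by (rule L2_continuous) simp

lemma L2_integrable: "f \<in> L2 a b \<Longrightarrow> integrable (lebesgue_on {a<..<b}) f"
  using L2_mult_integrable[OF _ L2_const[of 1]] by fastforce

lemma L2_mult_bounded:
  assumes "f \<in> L2 a b" "continuous_on {a..b} g"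
  shows "(\<lambda>x. g x * f x) \<in> L2 a b"
proof -
  obtain M where M: "\<And>x. x \<in> {a..b} \<Longrightarrow> \<bar>g x\<bar> \<le> M"
    using continuous_on_Icc_bounded[OF assms(2)] by (metis real_norm_def)
  have meas: "(\<lambda>x. g x * f x) \<in> borel_measurable (lebesgue_on {a<..<b})"
    using L2_measurable[OF assms(1)] L2_measurable[OF L2_continuous[OF assms(2)]]
    by (auto intro!: borel_measurable_times)
  have "integrable (lebesgue_on {a<..<b}) (\<lambda>x. (g x * f x)\<^sup>2)"
  proof (rule Bochner_Integration.integrable_bound)
    show "integrable (lebesgue_on {a<..<b}) (\<lambda>x. M\<^sup>2 * (f x)\<^sup>2)"
      using L2_square_integrable[OF assms(1)] by auto
    have "(g x)\<^sup>2 \<le> M\<^sup>2" if "x \<in> {a<..<b}" for x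
      using power_mono[OF M, of x 2] that by simp
    then show "AE x in lebesgue_on {a<..<b}. norm ((g x * f x)\<^sup>2) \<le> norm (M\<^sup>2 * (f x)\<^sup>2)"
      by (intro AE_I2) (auto simp: power_mult_distrib intro!: mult_right_mono)
  qed (use meas in auto)
  with meas show ?thesis by (auto simp: L2_def)
qed

lemma L2_mult_integrable_on:
  assumes "f \<in> L2 a b" "g \<in> L2 a b"
  shows "(\<lambda>x. f x * g x) integrable_on {a..b}"
proof -
  have "(\<lambda>x. f x * g x) integrable_on {a<..<b}"
    using has_integral_integral_lebesgue_on[OF L2_mult_integrable[OF assms]]
    by (auto simp: integrable_on_def)
  then show ?thesis by (simp add: integrable_on_open_interval_real)
qed

lemma L2_integrable_on: "f \<in> L2 a b \<Longrightarrow> f integrable_on {a..b}"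
  using L2_mult_integrable_on[OF _ L2_const[of 1]] by simp

text \<open>The bridge between the two integrals in use: the definitions speak of the Lebesgue
  integral over the open interval, while splitting of intervals and the fundamental theorem are
  applied to the gauge integral over closed ones.\<close>

lemma L2_inner_integral:
  assumes "f \<in> L2 a b" "g \<in> L2 a b"
  shows "L2_inner a b f g = integral {a..b} (\<lambda>x. f x * g x)"
  unfolding L2_inner_def
  using lebesgue_integral_eq_integral[OF L2_mult_integrable[OF assms]]
  by (simp add: integral_open_interval_real)

lemma L2_subinterval:
  assumes "f \<in> L2 a b" "a \<le> c" "d \<le> b"
  shows "f \<in> L2 c d"
proof -
  have sub: "{c<..<d} \<subseteq> {a<..<b}" using assms by auto
  have m: "f \<in> borel_measurable (lebesgue_on {c<..<d})"
    using measurable_restrict_mono[OF L2_measurable[OF assms(1)] sub] .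
  have "integrable (lebesgue_on {c<..<d}) (\<lambda>x. (f x)\<^sup>2)"
    using set_integrable_subset[OF _ _ sub, of lebesgue "\<lambda>x. (f x)\<^sup>2"] L2_square_integrable[OF assms(1)]
    by (simp add: integrable_restrict_space set_integrable_def)
  with m show ?thesis by (auto simp: L2_def)
qed

lemma L2_inner_commute: "L2_inner a b f g = L2_inner a b g f"
  by (simp add: L2_inner_def mult.commute)

lemma L2_inner_add_left:
  "f \<in> L2 a b \<Longrightarrow> g \<in> L2 a b \<Longrightarrow> h \<in> L2 a b \<Longrightarrow>
    L2_inner a b (\<lambda>x. f x + g x) h = L2_inner a b f h + L2_inner a b g h"
  unfolding L2_inner_def by (simp add: distrib_right Bochner_Integration.integral_add L2_mult_integrable)

lemma L2_inner_diff_left: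
  "f \<in> L2 a b \<Longrightarrow> g \<in> L2 a b \<Longrightarrow> h \<in> L2 a b \<Longrightarrow>
    L2_inner a b (\<lambda>x. f x - g x) h = L2_inner a b f h - L2_inner a b g h"
  unfolding L2_inner_def by (simp add: left_diff_distrib Bochner_Integration.integral_diff L2_mult_integrable)

lemma L2_inner_scale_left: "L2_inner a b (\<lambda>x. c * f x) g = c * L2_inner a b f g"
  unfolding L2_inner_def by (simp add: mult.assoc)

lemma L2_inner_self_nonneg: "0 \<le> L2_inner a b f f"
  unfolding L2_inner_def by (intro Bochner_Integration.integral_nonneg) simp

lemma L2_norm_nonneg: "0 \<le> L2_norm a b f"
  unfolding L2_norm_def by (simp add: L2_inner_self_nonneg)

lemma L2_norm_square: "(L2_norm a b f)\<^sup>2 = L2_inner a b f f"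
  unfolding L2_norm_def by (simp add: L2_inner_self_nonneg)

lemma L2_inner_cong_AE:
  assumes "AE x in lebesgue_on {a<..<b}. f x = f' x" "AE x in lebesgue_on {a<..<b}. g x = g' x"
    and "f \<in> L2 a b" "f' \<in> L2 a b" "g \<in> L2 a b" "g' \<in> L2 a b"
  shows "L2_inner a b f g = L2_inner a b f' g'"
  unfolding L2_inner_def
proof (rule integral_cong_AE)
  show "AE x in lebesgue_on {a<..<b}. f x * g x = f' x * g' x"
    using assms(1,2) by eventually_elim simp
qed (intro borel_measurable_times L2_measurable assms)+

text \<open>Besides the Cauchy-Schwarz inequality in L^2, this serves the concavity argument, where
  one quadratic in \<theta> collects several nonnegative contributions.\<close>

lemma quadratic_nonneg_discriminant:
  fixes A B C :: real
  assumes "\<And>\<theta>. 0 \<le> A + 2 * B * \<theta> + C * \<theta>\<^sup>2" "0 \<le> C"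
  shows "B\<^sup>2 \<le> A * C"
proof (cases "C = 0")
  case True
  have "B = 0"
  proof (rule ccontr)
    assume "B \<noteq> 0"
    \<comment> \<open>At this \<theta> the affine function takes the value -1.\<close>
    then show False using assms(1)[of "- (A + 1) / (2 * B)"] True by simp
  qed
  with True show ?thesis by simp
next
  case False
  have "C > 0" using False assms(2) by simp
  \<comment> \<open>The minimiser of the quadratic is \<open>- B / C\<close>.\<close>
  have "0 \<le> A + 2 * B * (- B / C) + C * (- B / C)\<^sup>2" by (rule assms(1))
  also have "\<dots> = A - B\<^sup>2 / C" using \<open>C > 0\<close> by (simp add: power2_eq_square field_simps)
  finally show ?thesis using \<open>C > 0\<close> by (simp add: field_simps)
qed

lemma L2_Cauchy_Schwarz:
  assumes "f \<in> L2 a b" "g \<in> L2 a b"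
  shows "\<bar>L2_inner a b f g\<bar> \<le> L2_norm a b f * L2_norm a b g"
proof -
  have "0 \<le> L2_inner a b f f + 2 * L2_inner a b f g * \<theta> + L2_inner a b g g * \<theta>\<^sup>2" for \<theta>
  proof -
    have s: "(\<lambda>x. \<theta> * g x) \<in> L2 a b" using assms by (intro L2_scale)
    have "0 \<le> L2_inner a b (\<lambda>x. f x + \<theta> * g x) (\<lambda>x. f x + \<theta> * g x)"
      by (rule L2_inner_self_nonneg)
    also have "\<dots> = L2_inner a b f f + 2 * L2_inner a b f g * \<theta> + L2_inner a b g g * \<theta>\<^sup>2"
      using L2_inner_add_left[OF assms(1) s L2_add[OF assms(1) s]]
        L2_inner_add_left[OF assms(1) s assms(1)] L2_inner_add_left[OF assms(1) s s]
        L2_inner_commute[of a b f "\<lambda>x. f x + \<theta> * g x"] L2_inner_scale_left[of a b \<theta> g f]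
        L2_inner_commute[of a b "\<lambda>x. \<theta> * g x" "\<lambda>x. f x + \<theta> * g x"]
        L2_inner_commute[of a b g f] L2_inner_scale_left[of a b \<theta> g "\<lambda>x. \<theta> * g x"]
        L2_inner_commute[of a b "\<lambda>x. \<theta> * g x" g] L2_inner_scale_left[of a b \<theta> g g]
        L2_inner_commute[of a b f "\<lambda>x. \<theta> * g x"]
      by (simp add: power2_eq_square algebra_simps)
    finally show ?thesis .
  qed
  from quadratic_nonneg_discriminant[OF this L2_inner_self_nonneg]
  have "(L2_inner a b f g)\<^sup>2 \<le> (L2_norm a b f * L2_norm a b g)\<^sup>2"
    by (simp add: power_mult_distrib L2_norm_square)
  then show ?thesis
    by (rule abs_le_square_iff[THEN iffD2, THEN order_trans]) (simp add: L2_norm_nonneg)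
qed


lemma L2_norm_triangle:
  assumes f: "f \<in> L2 a b" and g: "g \<in> L2 a b"
  shows "L2_norm a b (\<lambda>x. f x + g x) \<le> L2_norm a b f + L2_norm a b g"
proof (rule power2_le_imp_le)
  have "(L2_norm a b (\<lambda>x. f x + g x))\<^sup>2
      = (L2_norm a b f)\<^sup>2 + 2 * L2_inner a b f g + (L2_norm a b g)\<^sup>2"
    using L2_inner_add_left[OF f g L2_add[OF f g]] L2_inner_add_left[OF f g f] L2_inner_add_left[OF f g g]
      L2_inner_commute[of a b f "\<lambda>x. f x + g x"] L2_inner_commute[of a b g "\<lambda>x. f x + g x"]
      L2_inner_commute[of a b f g]
    by (simp add: L2_norm_square)
  also have "\<dots> \<le> (L2_norm a b f)\<^sup>2 + 2 * (L2_norm a b f * L2_norm a b g) + (L2_norm a b g)\<^sup>2"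
    using L2_Cauchy_Schwarz[OF f g] by simp
  also have "\<dots> = (L2_norm a b f + L2_norm a b g)\<^sup>2" by (simp add: power2_sum)
  finally show "(L2_norm a b (\<lambda>x. f x + g x))\<^sup>2 \<le> (L2_norm a b f + L2_norm a b g)\<^sup>2" .
qed (simp add: L2_norm_nonneg)

lemma L2_norm_le_iff: "0 \<le> e \<Longrightarrow> L2_norm a b f \<le> e \<longleftrightarrow> L2_inner a b f f \<le> e\<^sup>2"
  by (metis L2_norm_def L2_norm_square L2_norm_nonneg power_mono real_le_lsqrt)

lemma L2_norm_scale: "L2_norm a b (\<lambda>x. c * f x) = \<bar>c\<bar> * L2_norm a b f"
proof -
  have "L2_inner a b (\<lambda>x. c * f x) (\<lambda>x. c * f x) = c\<^sup>2 * L2_inner a b f f"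
    using L2_inner_scale_left[of a b c f "\<lambda>x. c * f x"] L2_inner_commute[of a b f "\<lambda>x. c * f x"]
      L2_inner_scale_left[of a b c f f] by (simp add: power2_eq_square)
  then show ?thesis by (simp add: L2_norm_def real_sqrt_mult)
qed

lemma L2_norm_minus_commute: "L2_norm a b (\<lambda>x. f x - g x) = L2_norm a b (\<lambda>x. g x - f x)"
  using L2_norm_scale[of a b "-1" "\<lambda>x. f x - g x"] by simp

lemma L2_norm_triangle_diff:
  assumes "f \<in> L2 a b" "g \<in> L2 a b" "h \<in> L2 a b"
  shows "L2_norm a b (\<lambda>x. f x - h x) \<le> L2_norm a b (\<lambda>x. f x - g x) + L2_norm a b (\<lambda>x. g x - h x)"
  using L2_norm_triangle[OF L2_diff[OF assms(1,2)] L2_diff[OF assms(2,3)]] by simp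

section \<open>Completeness of L^2 and density of the continuous functions\<close>

lemma L2_norm_nn_integral:
  assumes "f \<in> L2 a b"
  shows "(\<integral>\<^sup>+x. ennreal ((f x)\<^sup>2) \<partial>lebesgue_on {a<..<b}) = ennreal ((L2_norm a b f)\<^sup>2)"
  unfolding L2_norm_square L2_inner_def
  using nn_integral_eq_integral[OF L2_square_integrable[OF assms]] by (simp add: power2_eq_square)

lemma L2_norm_leI:
  assumes "f \<in> borel_measurable (lebesgue_on {a<..<b})" "0 \<le> e"
    and "(\<integral>\<^sup>+x. ennreal ((f x)\<^sup>2) \<partial>lebesgue_on {a<..<b}) \<le> ennreal (e\<^sup>2)"
  shows "f \<in> L2 a b" "L2_norm a b f \<le> e"
proof -
  have "integrable (lebesgue_on {a<..<b}) (\<lambda>x. (f x)\<^sup>2)"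
    using assms by (intro integrableI_nonneg) (auto simp: top_unique le_less_trans)
  with assms(1) show f: "f \<in> L2 a b" by (simp add: L2_def)
  then show "L2_norm a b f \<le> e"
    using assms(2,3) unfolding L2_norm_nn_integral[OF f] by (auto intro: power2_le_imp_le)
qed

text \<open>Riesz-Fischer. Along a fast subsequence the increments are summable in L^1, hence
  absolutely summable at almost every point, which yields a pointwise limit. Fatou's lemma then
  bounds the distance of every late member of the full sequence to that limit.\<close>

lemma L2_complete:
  assumes L2: "\<And>n. f n \<in> L2 a b"
    and Cauchy: "\<And>e. 0 < e \<Longrightarrow> \<exists>N. \<forall>m\<ge>N. \<forall>n\<ge>N. L2_norm a b (\<lambda>x. f m x - f n x) < e"
  shows "\<exists>g\<in>L2 a b. (\<lambda>n. L2_norm a b (\<lambda>x. f n x - g x)) \<longlonglongrightarrow> 0"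
proof -
  let ?M = "lebesgue_on {a<..<b}"
  \<comment> \<open>The interval is bounded, so Cauchy-Schwarz against the constant 1 controls the
    L^1 norm.\<close>
  have L1: "(\<integral>\<^sup>+x. ennreal \<bar>h x\<bar> \<partial>?M) \<le> ennreal (L2_norm a b h * L2_norm a b (\<lambda>x. 1))" if "h \<in> L2 a b" for h
  proof -
    have ab: "(\<lambda>x. \<bar>h x\<bar>) \<in> L2 a b" using that by (auto simp: L2_def)
    have "(\<integral>\<^sup>+x. ennreal \<bar>h x\<bar> \<partial>?M) = ennreal (L2_inner a b (\<lambda>x. \<bar>h x\<bar>) (\<lambda>x. 1))"
      using nn_integral_eq_integral[OF L2_integrable[OF ab]] by (simp add: L2_inner_def)
    also have "\<dots> \<le> ennreal (L2_norm a b h * L2_norm a b (\<lambda>x. 1))"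
      using L2_Cauchy_Schwarz[OF ab L2_const[of 1]]
      by (intro ennreal_leI) (simp add: L2_norm_def L2_inner_def)
    finally show ?thesis .
  qed
  obtain N where N: "\<And>k m n. m \<ge> N k \<Longrightarrow> n \<ge> N k \<Longrightarrow> L2_norm a b (\<lambda>x. f m x - f n x) < (1/2)^k"
    using Cauchy[of "(1/2)^k" for k] by (auto simp: all_conj_distrib) metis
  \<comment> \<open>\<open>Suc n\<close> makes the subsequence strictly increasing,
    \<open>N (Suc k)\<close> makes it fast enough.\<close>
  define r where "r = rec_nat (N 0) (\<lambda>k n. max (Suc n) (N (Suc k)))"
  have rN: "N k \<le> r k" for k by (cases k) (auto simp: r_def)
  have mono: "strict_mono r" by (auto simp: strict_mono_Suc_iff r_def)
  let ?d = "\<lambda>k x. f (r (Suc k)) x - f (r k) x"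
  have dL2: "?d k \<in> L2 a b" for k by (intro L2_diff L2)
  have d: "L2_norm a b (?d k) \<le> (1/2)^k" for k
    using N[of k "r (Suc k)" "r k"] rN[of k] mono by (simp add: strict_mono_def less_imp_le order_trans)
  have "(\<integral>\<^sup>+x. (\<Sum>k. ennreal \<bar>?d k x\<bar>) \<partial>?M) = (\<Sum>k. \<integral>\<^sup>+x. ennreal \<bar>?d k x\<bar> \<partial>?M)"
  proof (intro nn_integral_suminf)
    fix k
    have [measurable]: "?d k \<in> borel_measurable ?M" by (rule L2_measurable[OF dL2])
    show "(\<lambda>x. ennreal \<bar>?d k x\<bar>) \<in> borel_measurable ?M" by measurable
  qed
  also have "\<dots> \<le> (\<Sum>k. ennreal ((1/2)^k * L2_norm a b (\<lambda>x. 1)))"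
    by (intro suminf_le order_trans[OF L1[OF dL2]] ennreal_leI mult_right_mono d L2_norm_nonneg) auto
  also have "\<dots> < \<infinity>"
  proof -
    have "summable (\<lambda>k. (1/2::real)^k * L2_norm a b (\<lambda>x. 1))"
      by (intro summable_mult2 summable_geometric) simp
    then show ?thesis
      by (subst suminf_ennreal2) (auto simp: L2_norm_nonneg)
  qed
  finally have fin: "(\<integral>\<^sup>+x. (\<Sum>k. ennreal \<bar>?d k x\<bar>) \<partial>?M) \<noteq> \<infinity>" by simp
  have "AE x in ?M. (\<Sum>k. ennreal \<bar>?d k x\<bar>) \<noteq> \<infinity>"
  proof (rule nn_integral_noteq_infinite[OF _ fin])
    have [measurable]: "?d k \<in> borel_measurable ?M" for k by (rule L2_measurable[OF dL2])
    show "(\<lambda>x. \<Sum>k. ennreal \<bar>?d k x\<bar>) \<in> borel_measurable ?M" by measurable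
  qed
  then have AEconv: "AE x in ?M. convergent (\<lambda>k. f (r k) x)"
  proof eventually_elim
    case (elim x)
    then have "summable (\<lambda>k. \<bar>?d k x\<bar>)"
      by (intro summable_suminf_not_top) (auto simp: )
    then have "summable (\<lambda>k. ?d k x)" by (rule summable_rabs_cancel)
    then have "convergent (\<lambda>n. \<Sum>k<n. ?d k x)" by (simp add: summable_iff_convergent)
    then have "convergent (\<lambda>n. f (r n) x - f (r 0) x)"
      by (simp only: sum_lessThan_telescope[of "\<lambda>k. f (r k) x"])
    then show ?case
      using convergent_add[OF _ convergent_const[of "f (r 0) x"]] by fastforce
  qed
  define g where "g x = lim (\<lambda>k. f (r k) x)" for x
  have fm[measurable]: "f n \<in> borel_measurable ?M" for n by (rule L2_measurable[OF L2])
  have gm[measurable]: "g \<in> borel_measurable ?M"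
    unfolding g_def by (rule borel_measurable_lim_metric) (rule fm)
  have AElim: "AE x in ?M. (\<lambda>k. f (r k) x) \<longlonglongrightarrow> g x"
    using AEconv by eventually_elim (simp add: g_def convergent_LIMSEQ_iff)
  have close: "(\<integral>\<^sup>+x. ennreal ((f n x - g x)\<^sup>2) \<partial>?M) \<le> ennreal (e\<^sup>2)"
    if e: "\<And>m. m \<ge> N \<Longrightarrow> L2_norm a b (\<lambda>x. f n x - f m x) \<le> e" for n N e
  proof -
    have "(\<integral>\<^sup>+x. ennreal ((f n x - g x)\<^sup>2) \<partial>?M) = (\<integral>\<^sup>+x. liminf (\<lambda>k. ennreal ((f n x - f (r k) x)\<^sup>2)) \<partial>?M)"
    proof (rule nn_integral_cong_AE)
      show "AE x in ?M. ennreal ((f n x - g x)\<^sup>2) = liminf (\<lambda>k. ennreal ((f n x - f (r k) x)\<^sup>2))"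
        using AElim
      proof eventually_elim
        case (elim x)
        have "(\<lambda>k. ennreal ((f n x - f (r k) x)\<^sup>2)) \<longlonglongrightarrow> ennreal ((f n x - g x)\<^sup>2)"
          by (intro tendsto_ennrealI tendsto_power tendsto_diff tendsto_const elim)
        then show ?case by (intro lim_imp_Liminf[symmetric]) auto
      qed
    qed
    also have "\<dots> \<le> liminf (\<lambda>k. \<integral>\<^sup>+x. ennreal ((f n x - f (r k) x)\<^sup>2) \<partial>?M)"
      by (intro nn_integral_liminf) measurable
    also have "\<dots> \<le> ennreal (e\<^sup>2)"
    proof (rule Liminf_le)
      have "\<forall>\<^sub>F k in sequentially. N \<le> r k"
        using filterlim_subseq[OF mono] by (simp add: filterlim_at_top)
      then show "\<forall>\<^sub>F k in sequentially. (\<integral>\<^sup>+x. ennreal ((f n x - f (r k) x)\<^sup>2) \<partial>?M) \<le> ennreal (e\<^sup>2)"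
      proof eventually_elim
        case (elim k)
        show ?case unfolding L2_norm_nn_integral[OF L2_diff[OF L2 L2]]
          using e[OF elim] by (intro ennreal_leI power_mono) (auto simp: L2_norm_nonneg)
      qed
    qed simp
    finally show ?thesis .
  qed
  have diffL2: "(\<lambda>x. f (N 0) x - g x) \<in> L2 a b"
  proof (rule L2_norm_leI(1))
    show "(\<lambda>x. f (N 0) x - g x) \<in> borel_measurable ?M" by measurable
    show "(\<integral>\<^sup>+x. ennreal ((f (N 0) x - g x)\<^sup>2) \<partial>?M) \<le> ennreal (1\<^sup>2)"
      using N[of 0 "N 0"] by (intro close[of "N 0"]) (force intro: less_imp_le)
  qed simp
  \<comment> \<open>Fatou only reaches differences, so \<open>g\<close> is recovered as f - (f - g)
    with one fixed member f of the sequence.\<close>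
  have gL2: "g \<in> L2 a b" using L2_diff[OF L2[of "N 0"] diffL2] by simp
  moreover have "(\<lambda>n. L2_norm a b (\<lambda>x. f n x - g x)) \<longlonglongrightarrow> 0"
  proof (rule LIMSEQ_I)
    fix e :: real assume "0 < e"
    then obtain K where K: "\<And>m n. m \<ge> K \<Longrightarrow> n \<ge> K \<Longrightarrow> L2_norm a b (\<lambda>x. f m x - f n x) < e/2"
      using Cauchy[of "e/2"] by auto
    have "norm (L2_norm a b (\<lambda>x. f n x - g x) - 0) < e" if "n \<ge> K" for n
    proof -
      have "L2_norm a b (\<lambda>x. f n x - g x) \<le> e/2"
      proof (rule L2_norm_leI(2))
        show "(\<lambda>x. f n x - g x) \<in> borel_measurable ?M" by measurable
        show "(\<integral>\<^sup>+x. ennreal ((f n x - g x)\<^sup>2) \<partial>?M) \<le> ennreal ((e/2)\<^sup>2)"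
          using K[OF that] by (intro close[of K]) (auto intro: less_imp_le)
      qed (use \<open>0 < e\<close> in simp)
      then show ?thesis using \<open>0 < e\<close> L2_norm_nonneg[of a b "\<lambda>x. f n x - g x"] by simp
    qed
    then show "\<exists>no. \<forall>n\<ge>no. norm (L2_norm a b (\<lambda>x. f n x - g x) - 0) < e" by blast
  qed
  ultimately show ?thesis by blast
qed

text \<open>Truncation reduces to bounded functions. A bounded measurable function is an almost
  everywhere limit of continuous functions; truncating these as well keeps them continuous and
  provides the constant dominating function.\<close>

lemma L2_dense_continuous:
  assumes f: "f \<in> L2 a b" and "0 < e"
  shows "\<exists>c. continuous_on UNIV c \<and> L2_norm a b (\<lambda>x. f x - c x) < e"
proof -
  let ?M = "lebesgue_on {a<..<b}"
  have [measurable]: "f \<in> borel_measurable ?M" by (rule L2_measurable[OF f])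
  define clip :: "nat \<Rightarrow> real \<Rightarrow> real" where "clip k y = max (- real k) (min (real k) y)" for k y
  have clip_cont: "continuous_on UNIV (clip k)" for k
    unfolding clip_def by (intro continuous_intros)
  have [measurable]: "clip k \<in> borel_measurable borel" for k
    by (rule borel_measurable_continuous_onI[OF clip_cont])
  have clip_le: "\<bar>clip k y\<bar> \<le> real k" for k y unfolding clip_def by linarith
  have clip_abs: "\<bar>y - clip k y\<bar> \<le> \<bar>y\<bar>" for k y unfolding clip_def by linarith
  have sq: "(\<lambda>k. \<integral>x. (h k x)\<^sup>2 \<partial>?M) \<longlonglongrightarrow> 0 \<Longrightarrow> \<forall>\<^sub>F k in sequentially. L2_norm a b (h k) < \<epsilon>"
    if "0 < \<epsilon>" for h :: "nat \<Rightarrow> real \<Rightarrow> real" and \<epsilon>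
  proof -
    assume h: "(\<lambda>k. \<integral>x. (h k x)\<^sup>2 \<partial>?M) \<longlonglongrightarrow> 0"
    have "0 < \<epsilon>\<^sup>2" using that by simp
    from order_tendstoD(2)[OF h this] have "\<forall>\<^sub>F k in sequentially. (\<integral>x. (h k x)\<^sup>2 \<partial>?M) < \<epsilon>\<^sup>2"
      .
    then show ?thesis
    proof eventually_elim
      case (elim k)
      then have "sqrt (\<integral>x. (h k x)\<^sup>2 \<partial>?M) < sqrt (\<epsilon>\<^sup>2)" by (rule real_sqrt_less_mono)
      then show ?case using that by (simp add: L2_norm_def L2_inner_def power2_eq_square)
    qed
  qed
  have "(\<lambda>k. \<integral>x. (f x - clip k (f x))\<^sup>2 \<partial>?M) \<longlonglongrightarrow> (\<integral>x. 0 \<partial>?M)"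
  proof (rule integral_dominated_convergence[where w = "\<lambda>x. (f x)\<^sup>2"])
    show "AE x in ?M. (\<lambda>k. (f x - clip k (f x))\<^sup>2) \<longlonglongrightarrow> 0"
    proof (intro AE_I2)
      fix x
      have "\<forall>\<^sub>F k in sequentially. real k \<ge> \<bar>f x\<bar>"
        by (rule eventually_sequentiallyI[of "nat \<lceil>\<bar>f x\<bar>\<rceil>"]) linarith
      then have "\<forall>\<^sub>F k in sequentially. (f x - clip k (f x))\<^sup>2 = 0"
        by eventually_elim (auto simp: clip_def)
      then show "(\<lambda>k. (f x - clip k (f x))\<^sup>2) \<longlonglongrightarrow> 0" by (rule tendsto_eventually)
    qed
    show "AE x in ?M. norm ((f x - clip k (f x))\<^sup>2) \<le> (f x)\<^sup>2" for k
      using clip_abs by (intro AE_I2) (simp add: abs_le_square_iff)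
  qed (use L2_square_integrable[OF f] in auto)
  then have "\<forall>\<^sub>F k in sequentially. L2_norm a b (\<lambda>x. f x - clip k (f x)) < e/2"
    using \<open>0 < e\<close> by (intro sq) auto
  then obtain k where k: "L2_norm a b (\<lambda>x. f x - clip k (f x)) < e/2"
    using eventually_happens trivial_limit_sequentially by blast
  have clipL2: "(\<lambda>x. clip k (f x)) \<in> L2 a b"
    by (rule L2_bounded[where M = k]) (auto simp: clip_le)
  have "f measurable_on {a<..<b}"
    by (simp add: measurable_on_iff_borel_measurable)
  then obtain N g where N: "negligible N" and g: "\<And>n. continuous_on UNIV (g n)"
    and lim: "\<And>x. x \<notin> N \<Longrightarrow> (\<lambda>n. g n x) \<longlonglongrightarrow> (if x \<in> {a<..<b} then f x else 0)"
    unfolding measurable_on_def by blast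
  have gc: "continuous_on UNIV (\<lambda>x. clip k (g n x))" for n
    by (rule continuous_on_compose2[OF clip_cont g]) auto
  have gL2: "(\<lambda>x. clip k (g n x)) \<in> L2 a b" for n
    by (rule L2_continuous) (rule continuous_on_subset[OF gc], simp)
  have "(\<lambda>n. \<integral>x. (clip k (f x) - clip k (g n x))\<^sup>2 \<partial>?M) \<longlonglongrightarrow> (\<integral>x. 0 \<partial>?M)"
  proof (rule integral_dominated_convergence[where w = "\<lambda>x. (2 * real k)\<^sup>2"])
    have [measurable]: "(\<lambda>x. clip k (g n x)) \<in> borel_measurable ?M" for n by (rule L2_measurable[OF gL2])
    show "(\<lambda>x. (clip k (f x) - clip k (g n x))\<^sup>2) \<in> borel_measurable ?M" for n by measurable
    show "integrable ?M (\<lambda>x. (2 * real k)\<^sup>2)" by (rule L2_integrable[OF L2_const])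
    have "N \<in> null_sets lebesgue" using N by (simp add: negligible_iff_null_sets)
    then have "AE x in lebesgue. x \<notin> N" by (rule AE_not_in)
    then have "AE x in ?M. x \<notin> N \<and> x \<in> {a<..<b}"
      by (subst AE_restrict_space_iff) auto
    then show "AE x in ?M. (\<lambda>n. (clip k (f x) - clip k (g n x))\<^sup>2) \<longlonglongrightarrow> 0"
    proof eventually_elim
      case (elim x)
      then have "(\<lambda>n. g n x) \<longlonglongrightarrow> f x" using lim[of x] by simp
      then have "(\<lambda>n. clip k (g n x)) \<longlonglongrightarrow> clip k (f x)"
        using clip_cont[of k] by (intro isCont_tendsto_compose[of "f x" "clip k"])
          (auto simp: continuous_on_eq_continuous_at)
      then have "(\<lambda>n. (clip k (f x) - clip k (g n x))\<^sup>2) \<longlonglongrightarrow> (clip k (f x) - clip k (f x))\<^sup>2"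
        by (intro tendsto_intros)
      then show ?case by simp
    qed
    show "AE x in ?M. norm ((clip k (f x) - clip k (g n x))\<^sup>2) \<le> (2 * real k)\<^sup>2" for n
    proof (intro AE_I2)
      fix x
      have "\<bar>clip k (f x) - clip k (g n x)\<bar> \<le> 2 * real k"
        using clip_le[of k "f x"] clip_le[of k "g n x"] by linarith
      then show "norm ((clip k (f x) - clip k (g n x))\<^sup>2) \<le> (2 * real k)\<^sup>2"
        using power_mono[of "\<bar>clip k (f x) - clip k (g n x)\<bar>" "2 * real k" 2] by simp
    qed
  qed auto
  then have "\<forall>\<^sub>F n in sequentially. L2_norm a b (\<lambda>x. clip k (f x) - clip k (g n x)) < e/2"
    using \<open>0 < e\<close> by (intro sq) auto
  then obtain n where n: "L2_norm a b (\<lambda>x. clip k (f x) - clip k (g n x)) < e/2"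
    using eventually_happens trivial_limit_sequentially by blast
  have "L2_norm a b (\<lambda>x. f x - clip k (g n x)) < e"
    using L2_norm_triangle_diff[OF f clipL2 gL2[of n]] k n by linarith
  with gc show ?thesis by blast
qed

section \<open>Primitives of square integrable functions\<close>

text \<open>These are the absolutely continuous functions with square integrable derivative, that is
  H^1 in integral form. The density is carried as an argument: it is fixed only almost everywhere,
  and naming it keeps choices of representatives explicit.\<close>

definition L2_primitive :: "real \<Rightarrow> real \<Rightarrow> (real \<Rightarrow> real) \<Rightarrow> (real \<Rightarrow> real) \<Rightarrow> bool" where
  "L2_primitive a b f g \<longleftrightarrow>
     g \<in> L2 a b \<and> (\<forall>s t. a \<le> s \<and> s \<le> t \<and> t \<le> b \<longrightarrow> f t - f s = integral {s..t} g)"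

lemma L2_primitiveD:
  assumes "L2_primitive a b f g"
  shows "g \<in> L2 a b" "\<And>s t. a \<le> s \<Longrightarrow> s \<le> t \<Longrightarrow> t \<le> b \<Longrightarrow> f t - f s = integral {s..t} g"
  using assms by (auto simp: L2_primitive_def)

lemma L2_primitive_sub:
  "L2_primitive a b f g \<Longrightarrow> a \<le> c \<Longrightarrow> d \<le> b \<Longrightarrow> L2_primitive c d f g"
  unfolding L2_primitive_def by (auto intro: L2_subinterval)

lemma L2_integrable_sub:
  assumes "f \<in> L2 a b" "a \<le> s" "t \<le> b"
  shows "f integrable_on {s..t}"
  by (rule L2_integrable_on[OF L2_subinterval[OF assms]])

lemma L2_mult_integrable_sub:
  assumes "f \<in> L2 a b" "g \<in> L2 a b" "a \<le> s" "t \<le> b"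
  shows "(\<lambda>x. f x * g x) integrable_on {s..t}"
  by (intro L2_mult_integrable_on L2_subinterval[OF assms(1)] L2_subinterval[OF assms(2)] assms)

lemma integral_sub_diff:
  fixes f :: "real \<Rightarrow> 'a::banach"
  assumes "f integrable_on {a..b}" "a \<le> s" "s \<le> t" "t \<le> b"
  shows "integral {a..t} f - integral {a..s} f = integral {s..t} f"
  using hk_integral_combine[of a s t f] integrable_subinterval_real[OF assms(1), of a t] assms
  by (simp add: algebra_simps)

lemma L2_primitive_integral:
  assumes "g \<in> L2 a b"
  shows "L2_primitive a b (\<lambda>t. integral {a..t} g) g"
  unfolding L2_primitive_def using assms integral_sub_diff[OF L2_integrable_on[OF assms]] by auto

lemma L2_primitive_continuous:
  assumes "L2_primitive a b f g"
  shows "continuous_on {a..b} f"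
proof -
  have "continuous_on {a..b} (\<lambda>t. f a + integral {a..t} g)"
    by (intro continuous_intros indefinite_integral_continuous_1 L2_integrable_on L2_primitiveD[OF assms])
  then show ?thesis
    by (rule continuous_on_eq) (use L2_primitiveD(2)[OF assms, of a] in fastforce)
qed

lemma L2_primitive_C1:
  assumes "\<And>t. t \<in> {a..b} \<Longrightarrow> (f has_vector_derivative g t) (at t within {a..b})" "continuous_on {a..b} g"
  shows "L2_primitive a b f g"
  unfolding L2_primitive_def
proof (intro conjI allI impI)
  show "g \<in> L2 a b" by (rule L2_continuous[OF assms(2)])
  fix s t assume st: "a \<le> s \<and> s \<le> t \<and> t \<le> b"
  then have "(g has_integral (f t - f s)) {s..t}"
    by (intro fundamental_theorem_of_calculus has_vector_derivative_within_subset[OF assms(1)]) auto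
  then show "f t - f s = integral {s..t} g" by (simp add: integral_unique)
qed

lemma L2_integral_Cauchy_Schwarz:
  assumes "g \<in> L2 a b" "a \<le> s" "s \<le> t" "t \<le> b"
  shows "(integral {s..t} g)\<^sup>2 \<le> (t - s) * integral {s..t} (\<lambda>x. (g x)\<^sup>2)"
proof -
  have g: "g \<in> L2 s t" by (rule L2_subinterval[OF assms(1,2,4)])
  have "\<bar>L2_inner s t g (\<lambda>x. 1)\<bar>\<^sup>2 \<le> (L2_norm s t g * L2_norm s t (\<lambda>x. 1))\<^sup>2"
    by (intro power_mono L2_Cauchy_Schwarz g L2_const) auto
  then have "(L2_inner s t g (\<lambda>x. 1))\<^sup>2 \<le> L2_inner s t g g * L2_inner s t (\<lambda>x. 1) (\<lambda>x. 1)"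
    by (simp only: power_mult_distrib L2_norm_square power2_abs)
  then show ?thesis
    using assms(3) by (simp add: L2_inner_integral g L2_const power2_eq_square mult.commute)
qed

lemma L2_primitive_diff_square:
  assumes "L2_primitive a b f g" "a \<le> s" "s \<le> t" "t \<le> b"
  shows "(f t - f s)\<^sup>2 \<le> (t - s) * integral {s..t} (\<lambda>x. (g x)\<^sup>2)"
  using L2_integral_Cauchy_Schwarz[of g a b s t] L2_primitiveD[OF assms(1)] assms by simp

text \<open>Summing over a fine partition, the increments of \<open>K\<close> telescope, so |Z b - Z
  a| is at most e (K b - K a) for every e. This replaces differentiation for functions that need not
  be differentiable at every point.\<close>

lemma small_increments_imp_eq:
  fixes Z K :: "real \<Rightarrow> real"
  assumes "a \<le> b"
    and small: "\<And>e. 0 < e \<Longrightarrow> \<exists>\<delta>>0. \<forall>s t. a \<le> s \<and> s \<le> t \<and> t \<le> b \<and> t - s < \<delta> \<longrightarrow> \<bar>Z t - Z s\<bar> \<le> e * (K t - K s)"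
  shows "Z b = Z a"
proof (rule ccontr)
  assume ne: "Z b \<noteq> Z a"
  have bound: "\<bar>Z b - Z a\<bar> \<le> e * (K b - K a)" if e: "0 < e" for e
  proof -
    obtain \<delta> where "\<delta> > 0" and d: "\<And>s t. a \<le> s \<Longrightarrow> s \<le> t \<Longrightarrow> t \<le> b \<Longrightarrow> t - s < \<delta> \<Longrightarrow> \<bar>Z t - Z s\<bar> \<le> e * (K t - K s)"
      using small[OF e] by blast
    \<comment> \<open>With n equal pieces the mesh is below \<delta>.\<close>
    obtain n :: nat where n: "(b - a) / \<delta> < real n" using reals_Archimedean2 by blast
    have n0: "0 < real n" using n \<open>\<delta> > 0\<close> \<open>a \<le> b\<close> by (smt (verit) divide_nonneg_pos)
    define x where "x i = a + (b - a) * real i / real n" for i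
    have mono: "x i \<le> x (Suc i)" for i
      unfolding x_def using n0 \<open>a \<le> b\<close> by (auto simp: divide_right_mono mult_left_mono)
    have x0: "x 0 = a" and xn: "x n = b" using n0 by (auto simp: x_def)
    have rng: "a \<le> x i" "i \<le> n \<Longrightarrow> x i \<le> b" for i
    proof -
      show "a \<le> x i" unfolding x_def using n0 \<open>a \<le> b\<close> by simp
      assume "i \<le> n"
      then have "real i / real n \<le> 1" using n0 by simp
      then have "(b - a) * (real i / real n) \<le> (b - a) * 1" using \<open>a \<le> b\<close> by (intro mult_left_mono) auto
      then show "x i \<le> b" by (simp add: x_def)
    qed
    have step: "x (Suc i) - x i < \<delta>" for i
    proof -
      have "x (Suc i) - x i = (b - a) / real n" by (simp add: x_def add_divide_distrib diff_divide_distrib ring_distribs)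
      also have "\<dots> < \<delta>" using n n0 \<open>\<delta> > 0\<close> by (simp add: field_simps)
      finally show ?thesis .
    qed
    have "\<bar>Z b - Z a\<bar> = \<bar>\<Sum>i<n. Z (x (Suc i)) - Z (x i)\<bar>"
      using sum_lessThan_telescope[of "\<lambda>i. Z (x i)" n] x0 xn by simp
    also have "\<dots> \<le> (\<Sum>i<n. \<bar>Z (x (Suc i)) - Z (x i)\<bar>)" by (rule sum_abs)
    also have "\<dots> \<le> (\<Sum>i<n. e * (K (x (Suc i)) - K (x i)))"
      by (intro sum_mono d rng mono step) auto
    also have "\<dots> = e * (K b - K a)"
      using sum_lessThan_telescope[of "\<lambda>i. K (x i)" n] x0 xn by (simp add: sum_distrib_left[symmetric])
    finally show ?thesis .
  qed
  have "K b - K a > 0" using bound[of 1] ne by simp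
  \<comment> \<open>This factor as \<open>e\<close> would force |Z b - Z a| to be at most half of
    itself.\<close>
  then have "\<bar>Z b - Z a\<bar> / (2 * (K b - K a)) * (K b - K a) = \<bar>Z b - Z a\<bar> / 2" by (simp add: field_simps)
  with \<open>K b - K a > 0\<close> bound[of "\<bar>Z b - Z a\<bar> / (2 * (K b - K a))"] ne show False by simp
qed

lemma uniform_modulus:
  fixes g :: "real \<Rightarrow> 'a::real_normed_vector"
  assumes "continuous_on {a..b} g" "0 < e"
  shows "\<exists>\<delta>>0. \<forall>s t. s \<in> {a..b} \<and> t \<in> {a..b} \<and> \<bar>t - s\<bar> < \<delta> \<longrightarrow> norm (g t - g s) < e"
proof -
  have "uniformly_continuous_on {a..b} g"
    by (intro compact_uniformly_continuous assms) simp
  then obtain \<delta> where "\<delta> > 0" "\<And>x x'. x \<in> {a..b} \<Longrightarrow> x' \<in> {a..b} \<Longrightarrow> dist x' x < \<delta> \<Longrightarrow> dist (g x') (g x) < e"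
    unfolding uniformly_continuous_on_def using \<open>0 < e\<close> by meson
  then show ?thesis by (intro exI[of _ \<delta>]) (auto simp: dist_norm)
qed

text \<open>The hypothesis on \<open>Y\<close> is a first order Taylor expansion of \<open>Y\<close> as a function of \<open>W0\<close>
  and \<open>W1\<close>; this covers products and compositions with functions that are only \<open>C\<^sup>1\<^sup>,\<^sup>1\<close>.\<close>

lemma L2_primitive_chain:
  assumes W0: "L2_primitive a b W0 d0" and W1: "L2_primitive a b W1 d1"
    and g0: "continuous_on {a..b} g0" and g1: "continuous_on {a..b} g1"
    and Y: "\<And>s t. a \<le> s \<Longrightarrow> s \<le> t \<Longrightarrow> t \<le> b \<Longrightarrow>
      \<bar>Y t - Y s - g0 s * (W0 t - W0 s) - g1 s * (W1 t - W1 s)\<bar> \<le> C * ((W0 t - W0 s)\<^sup>2 + (W1 t - W1 s)\<^sup>2)"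
  shows "L2_primitive a b Y (\<lambda>t. g0 t * d0 t + g1 t * d1 t)"
  unfolding L2_primitive_def
proof (intro conjI allI impI)
  let ?D = "\<lambda>t. g0 t * d0 t + g1 t * d1 t"
  \<comment> \<open>Since |d| \<le> 1 + d^2, the integral of \<open>?K\<close> dominates both the
    terms linear in the densities and the quadratic remainder.\<close>
  let ?K = "\<lambda>t. 2 + (d0 t)\<^sup>2 + (d1 t)\<^sup>2"
  note d = L2_primitiveD(1)[OF W0] L2_primitiveD(1)[OF W1]
  show D: "?D \<in> L2 a b"
    by (intro L2_add L2_mult_bounded d g0 g1)
  fix l r assume "a \<le> l \<and> l \<le> r \<and> r \<le> b"
  then have lr: "a \<le> l" "l \<le> r" "r \<le> b" by auto
  note di = d[THEN L2_subinterval, OF lr(1,3)]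
  have D': "?D \<in> L2 l r" by (rule L2_subinterval[OF D lr(1,3)])
  have sqi: "(\<lambda>t. (d t)\<^sup>2) integrable_on {s..t}" if "d \<in> L2 l r" "l \<le> s" "t \<le> r" for d s t
    using L2_mult_integrable_sub[OF that(1,1) that(2,3)] by (simp add: power2_eq_square)
  have Ki: "?K integrable_on {s..t}" if "l \<le> s" "t \<le> r" for s t
    by (intro hk_integrable_add sqi di that) auto
  have abs_le: "\<bar>x\<bar> \<le> 1 + x\<^sup>2" for x :: real
    using zero_le_power2[of "\<bar>x\<bar> - 1"] unfolding power2_diff by simp
  have "(Y r - integral {l..r} ?D) = (Y l - integral {l..l} ?D)"
  proof (rule small_increments_imp_eq[OF lr(2), where K = "\<lambda>t. integral {l..t} ?K"])
    fix e :: real assume "0 < e"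
    obtain \<delta>0 where d0: "\<delta>0 > 0" "\<And>s t. s \<in> {a..b} \<Longrightarrow> t \<in> {a..b} \<Longrightarrow> \<bar>t - s\<bar> < \<delta>0 \<Longrightarrow> norm (g0 t - g0 s) < e/2"
      using uniform_modulus[OF g0, of "e/2"] \<open>0 < e\<close> by auto
    obtain \<delta>1 where d1: "\<delta>1 > 0" "\<And>s t. s \<in> {a..b} \<Longrightarrow> t \<in> {a..b} \<Longrightarrow> \<bar>t - s\<bar> < \<delta>1 \<Longrightarrow> norm (g1 t - g1 s) < e/2"
      using uniform_modulus[OF g1, of "e/2"] \<open>0 < e\<close> by auto
    \<comment> \<open>The error is split evenly: the oscillation of the coefficients takes e/2. The
      remainder is at most |C| (t - s) times the integral of \<open>?K\<close>, and the last entry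
      of the minimum keeps |C| (t - s) below e/2.\<close>
    define \<delta> where "\<delta> = min (min \<delta>0 \<delta>1) (e / (2 * (\<bar>C\<bar> + 1)))"
    have "\<delta> > 0" unfolding \<delta>_def using d0 d1 \<open>0 < e\<close> by simp
    moreover have "\<bar>(Y t - integral {l..t} ?D) - (Y s - integral {l..s} ?D)\<bar> \<le> e * (integral {l..t} ?K - integral {l..s} ?K)"
      if st: "l \<le> s" "s \<le> t" "t \<le> r" "t - s < \<delta>" for s t
    proof -
      have st': "a \<le> s" "t \<le> b" using st lr by auto
      have int_d: "d0 integrable_on {s..t}" "d1 integrable_on {s..t}"
        using L2_integrable_sub[OF d(1) st'] L2_integrable_sub[OF d(2) st'] by auto
      have Dint: "?D integrable_on {s..t}" by (rule L2_integrable_sub[OF D st'])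
      \<comment> \<open>The coefficients are frozen at the left end point; its integral is exactly
        the linear part of the Taylor expansion.\<close>
      let ?S = "\<lambda>x. g0 s * d0 x + g1 s * d1 x"
      have Sint: "?S integrable_on {s..t}"
        by (intro hk_integrable_add integrable_on_mult_right int_d)
      have S: "integral {s..t} ?S = g0 s * (W0 t - W0 s) + g1 s * (W1 t - W1 s)"
        using int_d L2_primitiveD(2)[OF W0 st'(1) st(2) st'(2)] L2_primitiveD(2)[OF W1 st'(1) st(2) st'(2)]
        by (subst hk_integral_add) (auto intro: integrable_on_mult_right)
      have "norm (integral {s..t} (\<lambda>x. ?D x - ?S x)) \<le> integral {s..t} (\<lambda>x. e/2 * ?K x)"
      proof (rule integral_norm_bound_integral)
        show "(\<lambda>x. ?D x - ?S x) integrable_on {s..t}"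
          by (rule hk_integrable_diff[OF Dint Sint])
        show "(\<lambda>x. e/2 * ?K x) integrable_on {s..t}"
          by (rule integrable_on_mult_right[OF Ki[OF st(1,3)]])
        fix x assume x: "x \<in> {s..t}"
        have "\<bar>g0 x - g0 s\<bar> \<le> e/2" "\<bar>g1 x - g1 s\<bar> \<le> e/2"
          using d0(2)[of s x] d1(2)[of s x] x st st' by (auto simp: \<delta>_def)
        then have "\<bar>(g0 x - g0 s) * d0 x\<bar> \<le> e/2 * (1 + (d0 x)\<^sup>2)" "\<bar>(g1 x - g1 s) * d1 x\<bar> \<le> e/2 * (1 + (d1 x)\<^sup>2)"
          unfolding abs_mult using \<open>0 < e\<close> by (intro mult_mono abs_le; simp)+
        then have "\<bar>(g0 x - g0 s) * d0 x + (g1 x - g1 s) * d1 x\<bar> \<le> e/2 * (1 + (d0 x)\<^sup>2) + e/2 * (1 + (d1 x)\<^sup>2)"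
          by linarith
        then show "norm (?D x - ?S x) \<le> e/2 * ?K x"
          by (simp add: algebra_simps)
      qed
      then have 1: "\<bar>integral {s..t} ?D - integral {s..t} ?S\<bar> \<le> e/2 * integral {s..t} ?K"
        by (simp only: hk_integral_diff[OF Dint Sint] integral_mult_right real_norm_def)
      have K2: "integral {s..t} (\<lambda>x. (d0 x)\<^sup>2) + integral {s..t} (\<lambda>x. (d1 x)\<^sup>2) \<le> integral {s..t} ?K"
        unfolding hk_integral_add[OF sqi[OF di(1) st(1,3)] sqi[OF di(2) st(1,3)], symmetric]
        by (rule integral_le) (auto intro!: hk_integrable_add sqi di st Ki[OF st(1,3)])
      have K0: "0 \<le> integral {s..t} ?K" by (rule integral_nonneg[OF Ki[OF st(1,3)]]) simp
      have "\<bar>C * ((W0 t - W0 s)\<^sup>2 + (W1 t - W1 s)\<^sup>2)\<bar> \<le> \<bar>C\<bar> * ((t - s) * integral {s..t} ?K)"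
        unfolding abs_mult
      proof (intro mult_left_mono)
        have "(W0 t - W0 s)\<^sup>2 + (W1 t - W1 s)\<^sup>2
          \<le> (t - s) * (integral {s..t} (\<lambda>x. (d0 x)\<^sup>2) + integral {s..t} (\<lambda>x. (d1 x)\<^sup>2))"
          using L2_primitive_diff_square[OF W0 st'(1) st(2) st'(2)] L2_primitive_diff_square[OF W1 st'(1) st(2) st'(2)]
          by (simp add: algebra_simps)
        also have "\<dots> \<le> (t - s) * integral {s..t} ?K" using K2 st by (intro mult_left_mono) auto
        finally show "\<bar>(W0 t - W0 s)\<^sup>2 + (W1 t - W1 s)\<^sup>2\<bar> \<le> (t - s) * integral {s..t} ?K" by simp
      qed simp
      also have "\<dots> \<le> e/2 * integral {s..t} ?K"
      proof -
        have "\<bar>C\<bar> * (t - s) \<le> (\<bar>C\<bar> + 1) * (e / (2 * (\<bar>C\<bar> + 1)))"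
          using st \<open>0 < e\<close> by (intro mult_mono) (auto simp: \<delta>_def)
        also have "\<dots> = e/2" using abs_ge_zero[of C] by (simp add: divide_simps)
        finally show ?thesis using mult_right_mono[OF _ K0] by (simp only: mult.assoc[symmetric])
      qed
      finally have 2: "\<bar>Y t - Y s - integral {s..t} ?S\<bar> \<le> e/2 * integral {s..t} ?K"
        using Y[OF st'(1) st(2) st'(2)] unfolding S by linarith
      have 3: "(Y t - integral {l..t} ?D) - (Y s - integral {l..s} ?D) = (Y t - Y s - integral {s..t} ?S) - (integral {s..t} ?D - integral {s..t} ?S)"
        using integral_sub_diff[OF L2_integrable_on[OF D'] st(1,2,3)] by simp
      have 4: "integral {l..t} ?K - integral {l..s} ?K = integral {s..t} ?K"
        by (rule integral_sub_diff[OF Ki st(1,2,3)]) auto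
      have "\<bar>x - y\<bar> \<le> e * k" if "\<bar>x\<bar> \<le> e/2 * k" "\<bar>y\<bar> \<le> e/2 * k" for x y k :: real
      proof -
        have "e/2 * k + e/2 * k = e * k" by simp
        then show ?thesis using that by linarith
      qed
      from this[OF 2 1] show ?thesis unfolding 3 4 .
    qed
    ultimately show "\<exists>\<delta>>0. \<forall>s t. l \<le> s \<and> s \<le> t \<and> t \<le> r \<and> t - s < \<delta> \<longrightarrow>
       \<bar>(Y t - integral {l..t} ?D) - (Y s - integral {l..s} ?D)\<bar> \<le> e * (integral {l..t} ?K - integral {l..s} ?K)"
      by blast
  qed
  then show "Y r - Y l = integral {l..r} ?D" by simp
qed

text \<open>The Taylor remainder of a product is the product of the two increments, which half the
  sum of their squares dominates.\<close>

lemma L2_primitive_mult: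
  assumes W0: "L2_primitive a b W0 d0" and W1: "L2_primitive a b W1 d1"
  shows "L2_primitive a b (\<lambda>t. W0 t * W1 t) (\<lambda>t. W1 t * d0 t + W0 t * d1 t)"
proof (rule L2_primitive_chain[OF W0 W1, where C = 1])
  fix s t
  have eq: "W0 t * W1 t - W0 s * W1 s - W1 s * (W0 t - W0 s) - W0 s * (W1 t - W1 s) = (W0 t - W0 s) * (W1 t - W1 s)"
    by (simp add: algebra_simps)
  have "2 * \<bar>x * y\<bar> \<le> x\<^sup>2 + y\<^sup>2" for x y :: real
    using zero_le_power2[of "\<bar>x\<bar> - \<bar>y\<bar>"] by (simp add: power2_diff abs_mult)
  then show "\<bar>W0 t * W1 t - W0 s * W1 s - W1 s * (W0 t - W0 s) - W0 s * (W1 t - W1 s)\<bar>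
      \<le> 1 * ((W0 t - W0 s)\<^sup>2 + (W1 t - W1 s)\<^sup>2)"
    unfolding eq by (smt (verit) abs_ge_zero)
qed (use L2_primitive_continuous[OF W0] L2_primitive_continuous[OF W1] in auto)


lemma L2_primitive_square: "L2_primitive a b W d \<Longrightarrow> L2_primitive a b (\<lambda>t. (W t)\<^sup>2) (\<lambda>t. 2 * (W t * d t))"
  using L2_primitive_mult[of a b W d W d] by (simp add: power2_eq_square)

lemma L2_primitive_diff:
  assumes "L2_primitive a b f g" "L2_primitive a b f' g'"
  shows "L2_primitive a b (\<lambda>t. f t - f' t) (\<lambda>t. g t - g' t)"
  unfolding L2_primitive_def
proof (intro conjI allI impI)
  note g = L2_primitiveD(1)[OF assms(1)] L2_primitiveD(1)[OF assms(2)]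
  show "(\<lambda>t. g t - g' t) \<in> L2 a b" by (intro L2_diff g)
  fix s t assume st: "a \<le> s \<and> s \<le> t \<and> t \<le> b"
  then have "f t - f s = integral {s..t} g" "f' t - f' s = integral {s..t} g'" "integral {s..t} (\<lambda>t. g t - g' t) = integral {s..t} g - integral {s..t} g'"
    using L2_primitiveD(2)[OF assms(1)] L2_primitiveD(2)[OF assms(2)]
      hk_integral_diff[OF L2_integrable_sub[OF g(1)] L2_integrable_sub[OF g(2)], of s t]
    by auto
  then show "f t - f' t - (f s - f' s) = integral {s..t} (\<lambda>t. g t - g' t)" by linarith
qed

section \<open>Limits of averaged products of time increments\<close>

lemma increment_bound:
  fixes A a :: "real \<Rightarrow> 'h::banach"
  assumes A: "\<And>x. x \<in> {s..t} \<Longrightarrow> (A has_vector_derivative a x) (at x within {s..t})"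
    and "s \<le> t" "\<And>x. x \<in> {s..t} \<Longrightarrow> norm (a x - c) \<le> e"
  shows "norm (A t - A s - (t - s) *\<^sub>R c) \<le> e * (t - s)"
proof -
  have "((\<lambda>x. a x - c) has_integral (A t - A s - (t - s) *\<^sub>R c)) {s..t}"
    using has_integral_diff[OF fundamental_theorem_of_calculus[OF \<open>s \<le> t\<close> A] has_integral_const_real[of c s t]] \<open>s \<le> t\<close>
    by simp
  moreover have "0 \<le> e" using order_trans[OF norm_ge_zero assms(3)[of s]] \<open>s \<le> t\<close> by simp
  ultimately have e: "0 \<le> e" and *: "((\<lambda>x. a x - c) has_integral (A t - A s - (t - s) *\<^sub>R c)) {s..t}" by auto
  have "norm (A t - A s - (t - s) *\<^sub>R c) \<le> e * Henstock_Kurzweil_Integration.content {s..t}"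
    by (rule has_integral_bound_real[OF e finite.emptyI *]) (use assms(3) in auto)
  then show ?thesis using \<open>s \<le> t\<close> by simp
qed

text \<open>The difference quotients converge uniformly to the continuous derivatives, one factor h
  of the denominator belonging to each increment. The integral stops at T - h so that t + h stays in
  the domain; the omitted end piece is of order h.\<close>

lemma steklov_C1:
  fixes A B a b :: "real \<Rightarrow> 'h::{real_inner,banach}"
  assumes "0 < T"
    and A: "\<And>t. t \<in> {0..T} \<Longrightarrow> (A has_vector_derivative a t) (at t within {0..T})"
    and B: "\<And>t. t \<in> {0..T} \<Longrightarrow> (B has_vector_derivative b t) (at t within {0..T})"
    and a: "continuous_on {0..T} a" and b: "continuous_on {0..T} b"
  shows "((\<lambda>h. integral {0..T-h} (\<lambda>t. inner (A (t+h) - A t) (B (t+h) - B t)) / h\<^sup>2)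
           \<longlongrightarrow> integral {0..T} (\<lambda>t. inner (a t) (b t))) (at_right 0)"
proof (rule tendstoI)
  fix e :: real assume "0 < e"
  obtain Ma where Ma: "0 \<le> Ma" "\<And>t. t \<in> {0..T} \<Longrightarrow> norm (a t) \<le> Ma" using continuous_on_Icc_bounded[OF a] by blast
  obtain Mb where Mb: "0 \<le> Mb" "\<And>t. t \<in> {0..T} \<Longrightarrow> norm (b t) \<le> Mb" using continuous_on_Icc_bounded[OF b] by blast
  \<comment> \<open>The total error will be \<open>\<epsilon> * L\<close>: the bracket is the
    pointwise error integrated over the interval, the final 1 pays for the end piece.\<close>
  define L where "L = (Ma + Mb + 1) * T + 1"
  have L: "L > 0" unfolding L_def using Ma Mb \<open>0 < T\<close> by (simp add: add_nonneg_pos)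
  define \<epsilon> where "\<epsilon> = min 1 (e / (2 * L))"
  have \<epsilon>: "0 < \<epsilon>" "\<epsilon> \<le> 1" "\<epsilon> * L \<le> e / 2"
  proof -
    show "0 < \<epsilon>" "\<epsilon> \<le> 1" using \<open>0 < e\<close> L by (auto simp: \<epsilon>_def)
    have "\<epsilon> * L \<le> e / (2 * L) * L" using L by (intro mult_right_mono) (auto simp: \<epsilon>_def)
    then show "\<epsilon> * L \<le> e / 2" using L by simp
  qed
  obtain \<delta>a where da: "\<delta>a > 0" "\<And>s t. s \<in> {0..T} \<Longrightarrow> t \<in> {0..T} \<Longrightarrow> \<bar>t - s\<bar> < \<delta>a \<Longrightarrow> norm (a t - a s) < \<epsilon>"
    using uniform_modulus[OF a \<epsilon>(1)] by auto
  obtain \<delta>b where db: "\<delta>b > 0" "\<And>s t. s \<in> {0..T} \<Longrightarrow> t \<in> {0..T} \<Longrightarrow> \<bar>t - s\<bar> < \<delta>b \<Longrightarrow> norm (b t - b s) < \<epsilon>"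
    using uniform_modulus[OF b \<epsilon>(1)] by auto
  define \<delta> where "\<delta> = min (min \<delta>a \<delta>b) (min T (\<epsilon> / (Ma * Mb + 1)))"
  have "\<delta> > 0" unfolding \<delta>_def using da db \<epsilon> \<open>0 < T\<close> Ma Mb by (simp add: add_nonneg_pos)
  have "dist (integral {0..T-h} (\<lambda>t. inner (A (t+h) - A t) (B (t+h) - B t)) / h\<^sup>2) (integral {0..T} (\<lambda>t. inner (a t) (b t))) < e"
    if h: "0 < h" "h < \<delta>" for h
  proof -
    have hT: "h < T" and h\<epsilon>: "h * (Ma * Mb + 1) \<le> \<epsilon>"
    proof -
      show "h < T" using h by (simp add: \<delta>_def)
      have "h \<le> \<epsilon> / (Ma * Mb + 1)" using h by (simp add: \<delta>_def)
      then show "h * (Ma * Mb + 1) \<le> \<epsilon>"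
        using Ma Mb by (subst (asm) pos_le_divide_eq) (auto intro: add_nonneg_pos)
    qed
    have contA: "continuous_on {0..T} A" and contB: "continuous_on {0..T} B"
      unfolding continuous_on_eq_continuous_within
      by (auto intro!: has_vector_derivative_continuous[OF A] has_vector_derivative_continuous[OF B])
    let ?F = "\<lambda>t. inner (A (t+h) - A t) (B (t+h) - B t) / h\<^sup>2" and ?G = "\<lambda>t. inner (a t) (b t)"
    have F: "?F integrable_on {0..T-h}"
      by (intro integrable_continuous_real continuous_intros continuous_on_compose2[OF contA] continuous_on_compose2[OF contB])
        (use h hT in auto)
    have G: "?G integrable_on {0..T}"
      by (intro integrable_continuous_real continuous_intros a b)
    have G1: "?G integrable_on {0..T-h}" "?G integrable_on {T-h..T}"
      using h hT by (auto intro: integrable_subinterval_real[OF G])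
    have pt: "\<bar>?F t - ?G t\<bar> \<le> \<epsilon> * (Ma + Mb + 1)" if t: "t \<in> {0..T-h}" for t
    proof -
      have "norm (A (t+h) - A t - (t + h - t) *\<^sub>R a t) \<le> \<epsilon> * (t + h - t)"
        by (rule increment_bound[OF has_vector_derivative_within_subset[OF A]])
          (use t h da(2)[of t] in \<open>auto simp: \<delta>_def intro!: less_imp_le\<close>)
      moreover have "norm (B (t+h) - B t - (t + h - t) *\<^sub>R b t) \<le> \<epsilon> * (t + h - t)"
        by (rule increment_bound[OF has_vector_derivative_within_subset[OF B]])
          (use t h db(2)[of t] in \<open>auto simp: \<delta>_def intro!: less_imp_le\<close>)
      moreover define x where "x = (A (t+h) - A t) /\<^sub>R h - a t"
      moreover define y where "y = (B (t+h) - B t) /\<^sub>R h - b t"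
      moreover have "h *\<^sub>R x = A (t+h) - A t - h *\<^sub>R a t" "h *\<^sub>R y = B (t+h) - B t - h *\<^sub>R b t"
        using h by (simp_all add: x_def y_def scaleR_diff_right)
      ultimately have "norm (h *\<^sub>R x) \<le> \<epsilon> * h" "norm (h *\<^sub>R y) \<le> \<epsilon> * h" by (auto simp only: add_diff_cancel_left')
      then have x: "norm x \<le> \<epsilon>" and y: "norm y \<le> \<epsilon>" using h by simp_all
      have "?F t = inner (a t + x) (b t + y)"
        by (simp add: x_def y_def power2_eq_square divide_inverse mult.assoc)
      then have "?F t - ?G t = inner (a t) y + inner x (b t) + inner x y"
        by (simp add: inner_add_left inner_add_right)
      also have "\<bar>\<dots>\<bar> \<le> \<bar>inner (a t) y\<bar> + \<bar>inner x (b t)\<bar> + \<bar>inner x y\<bar>" by linarith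
      also have "\<dots> \<le> Ma * \<epsilon> + \<epsilon> * Mb + \<epsilon> * 1"
        using t h Ma Mb x y \<epsilon>
        by (intro add_mono order_trans[OF Cauchy_Schwarz_ineq2] mult_mono) auto
      finally show ?thesis by (simp add: algebra_simps)
    qed
    have "norm (integral {0..T-h} (\<lambda>t. ?F t - ?G t)) \<le> integral {0..T-h} (\<lambda>t. \<epsilon> * (Ma + Mb + 1))"
      by (rule integral_norm_bound_integral) (auto intro!: hk_integrable_diff F G1 pt[simplified])
    also have "\<dots> = (T - h) * (\<epsilon> * (Ma + Mb + 1))" using hT by simp
    also have "\<dots> \<le> T * (\<epsilon> * (Ma + Mb + 1))" using h \<epsilon> Ma Mb by (intro mult_right_mono) auto
    finally have 1: "\<bar>integral {0..T-h} ?F - integral {0..T-h} ?G\<bar> \<le> T * (\<epsilon> * (Ma + Mb + 1))"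
      by (simp add: hk_integral_diff F G1)
    have "norm (integral {T-h..T} ?G) \<le> integral {T-h..T} (\<lambda>t. Ma * Mb)"
      using h hT Ma Mb by (intro integral_norm_bound_integral G1)
        (auto intro!: order_trans[OF Cauchy_Schwarz_ineq2] mult_mono)
    also have "\<dots> = h * (Ma * Mb)" using h by simp
    also have "\<dots> < h * (Ma * Mb + 1)" using h by simp
    finally have 2: "\<bar>integral {T-h..T} ?G\<bar> < \<epsilon>" using h\<epsilon> by simp
    have 3: "integral {0..T} ?G = integral {0..T-h} ?G + integral {T-h..T} ?G"
      using hk_integral_combine[OF _ _ G, of "T-h"] h hT by simp
    have 4: "integral {0..T-h} ?F = integral {0..T-h} (\<lambda>t. inner (A (t+h) - A t) (B (t+h) - B t)) / h\<^sup>2"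
      by simp
    have "\<bar>integral {0..T-h} ?F - integral {0..T} ?G\<bar> < T * (\<epsilon> * (Ma + Mb + 1)) + \<epsilon>"
      using 1 2 3 by linarith
    also have "\<dots> = \<epsilon> * L" by (simp add: L_def algebra_simps)
    also have "\<dots> \<le> e / 2" by (rule \<epsilon>)
    finally show ?thesis unfolding 4[symmetric] dist_real_def using \<open>0 < e\<close> by linarith
  qed
  then show "\<forall>\<^sub>F h in at_right 0. dist (integral {0..T-h} (\<lambda>t. inner (A (t+h) - A t) (B (t+h) - B t)) / h\<^sup>2)
      (integral {0..T} (\<lambda>t. inner (a t) (b t))) < e"
    unfolding eventually_at_right_field using \<open>\<delta> > 0\<close> by blast
qed

lemma L2_primitive_shift_diff_continuous:
  assumes "L2_primitive 0 T A a" "0 < h"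
  shows "continuous_on {0..T-h} (\<lambda>t. A (t+h) - A t)"
  by (intro continuous_intros continuous_on_compose2[OF L2_primitive_continuous[OF assms(1)]]) (use assms in auto)

text \<open>With K(t) the integral of a^2 over [0, t], Cauchy-Schwarz bounds the squared increment
  by h (K(t + h) - K(t)). Integrated in t, the interior parts cancel and only the end layers of
  width h remain, of which the right one is at most h K(T).\<close>

lemma steklov_bound:
  assumes A: "L2_primitive 0 T A a" and h: "0 < h" "h < T"
  shows "L2_norm 0 (T-h) (\<lambda>t. A (t+h) - A t) \<le> h * L2_norm 0 T a"
proof -
  note a = L2_primitiveD(1)[OF A]
  let ?D = "\<lambda>t. A (t+h) - A t"
  have sq: "(\<lambda>x. (a x)\<^sup>2) integrable_on {0..T}"
    using L2_mult_integrable_on[OF a a] by (simp add: power2_eq_square)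
  define K where "K t = integral {0..t} (\<lambda>x. (a x)\<^sup>2)" for t
  have K: "continuous_on {0..T} K" unfolding K_def by (rule indefinite_integral_continuous_1[OF sq])
  have Kdiff: "K t - K s = integral {s..t} (\<lambda>x. (a x)\<^sup>2)" if "0 \<le> s" "s \<le> t" "t \<le> T" for s t
    unfolding K_def by (rule integral_sub_diff[OF sq that])
  have Kmono: "K s \<le> K t" if "0 \<le> s" "s \<le> t" "t \<le> T" for s t
  proof -
    have "0 \<le> integral {s..t} (\<lambda>x. (a x)\<^sup>2)"
      by (rule integral_nonneg) (use integrable_subinterval_real[OF sq] that in auto)
    then show ?thesis using Kdiff[OF that] by simp
  qed
  have K0: "0 \<le> K t" if "0 \<le> t" "t \<le> T" for t using Kmono[of 0 t] that by (simp add: K_def)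
  have KT: "K T = (L2_norm 0 T a)\<^sup>2"
    unfolding K_def L2_norm_square L2_inner_integral[OF a a] by (simp add: power2_eq_square)
  have Kint: "K integrable_on {s..t}" if "0 \<le> s" "t \<le> T" for s t
    by (rule integrable_continuous_real) (rule continuous_on_subset[OF K], use that in auto)
  have Kh: "(\<lambda>t. K (t+h)) integrable_on {0..T-h}"
    by (intro integrable_continuous_real continuous_on_compose2[OF K] continuous_intros) (use h in auto)
  have DL2: "?D \<in> L2 0 (T-h)" by (rule L2_continuous[OF L2_primitive_shift_diff_continuous[OF A h(1)]])
  have "L2_inner 0 (T-h) ?D ?D = integral {0..T-h} (\<lambda>t. (?D t)\<^sup>2)"
    by (simp add: L2_inner_integral[OF DL2 DL2] power2_eq_square)
  also have "\<dots> \<le> integral {0..T-h} (\<lambda>t. h * (K (t+h) - K t))"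
  proof (rule integral_le)
    show "(\<lambda>t. (?D t)\<^sup>2) integrable_on {0..T-h}"
      using L2_mult_integrable_on[OF DL2 DL2] by (simp add: power2_eq_square)
    show "(\<lambda>t. h * (K (t+h) - K t)) integrable_on {0..T-h}"
      by (intro integrable_on_mult_right hk_integrable_diff Kh Kint) (use h in auto)
    fix t assume "t \<in> {0..T-h}"
    then show "(?D t)\<^sup>2 \<le> h * (K (t+h) - K t)"
      using L2_primitive_diff_square[OF A, of t "t+h"] Kdiff[of t "t+h"] h by simp
  qed
  also have "\<dots> = h * (integral {0..T-h} (\<lambda>t. K (t+h)) - integral {0..T-h} K)"
    using h by (simp add: hk_integral_diff Kh Kint)
  also have "integral {0..T-h} (\<lambda>t. K (t+h)) = integral {h..T} K"
    using integral_shift_real_ivl[of h h T K] by simp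
  also have "integral {h..T} K - integral {0..T-h} K = integral {T-h..T} K - integral {0..h} K"
    using hk_integral_combine[OF _ _ Kint[of 0 T], of h]
      hk_integral_combine[OF _ _ Kint[of 0 T], of "T-h"] h by simp
  also have "\<dots> \<le> h * K T - 0"
  proof (rule diff_mono)
    have "integral {T-h..T} K \<le> integral {T-h..T} (\<lambda>_. K T)"
      by (rule integral_le) (use h in \<open>auto intro!: Kint Kmono\<close>)
    then show "integral {T-h..T} K \<le> h * K T" using h by simp
    show "0 \<le> integral {0..h} K" by (rule integral_nonneg) (use h in \<open>auto intro!: Kint K0\<close>)
  qed
  finally have "L2_inner 0 (T-h) ?D ?D \<le> h * (h * K T)" using h by simp
  also have "\<dots> = (h * L2_norm 0 T a)\<^sup>2" by (simp add: KT power2_eq_square)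
  finally show ?thesis using h by (subst L2_norm_le_iff) (auto simp: L2_norm_nonneg)
qed

text \<open>For functions that are not continuous, the averages converge only in \<open>L\<^sup>2\<close>; the bilinear
  functional below is bounded uniformly in \<open>h\<close>, so it suffices to treat the dense class of
  continuous functions.\<close>

lemma steklov_L2:
  assumes "0 < T" and A: "L2_primitive 0 T A a" and B: "L2_primitive 0 T B b"
  shows "((\<lambda>h. integral {0..T-h} (\<lambda>t. (A (t+h) - A t) * (B (t+h) - B t)) / h\<^sup>2)
           \<longlongrightarrow> integral {0..T} (\<lambda>t. a t * b t)) (at_right 0)"
proof (rule tendstoI)
  note a = L2_primitiveD(1)[OF A] and b = L2_primitiveD(1)[OF B]
  define I where "I A B h = L2_inner 0 (T-h) (\<lambda>t. A (t+h) - A t) (\<lambda>t. B (t+h) - B t) / h\<^sup>2" for A B :: "real \<Rightarrow> real" and h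
  have cont: "(\<lambda>t. A (t+h) - A t) \<in> L2 0 (T-h)" if "L2_primitive 0 T A a" "0 < h" for A a h
    by (rule L2_continuous[OF L2_primitive_shift_diff_continuous[OF that]])
  have Ibound: "\<bar>I A B h\<bar> \<le> L2_norm 0 T a * L2_norm 0 T b"
    if "L2_primitive 0 T A a" "L2_primitive 0 T B b" "0 < h" "h < T" for A B a b h
  proof -
    have "\<bar>L2_inner 0 (T-h) (\<lambda>t. A (t+h) - A t) (\<lambda>t. B (t+h) - B t)\<bar> \<le> (h * L2_norm 0 T a) * (h * L2_norm 0 T b)"
      using that by (intro order_trans[OF L2_Cauchy_Schwarz] mult_mono steklov_bound cont) (auto simp: L2_norm_nonneg)
    then show ?thesis using \<open>0 < h\<close> by (simp add: I_def power2_eq_square field_simps)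
  qed
  fix e :: real assume "0 < e"
  \<comment> \<open>The summand 1 leaves room for the norm of the continuous approximation
    \<open>d\<close> of \<open>b\<close>, which may exceed that of \<open>b\<close> by
    \<epsilon>.\<close>
  define M where "M = L2_norm 0 T a + L2_norm 0 T b + 1"
  have M: "M > 0" unfolding M_def using L2_norm_nonneg[of 0 T a] L2_norm_nonneg[of 0 T b] by linarith
  define \<epsilon> where "\<epsilon> = min 1 (e / (6 * M))"
  have \<epsilon>: "0 < \<epsilon>" "\<epsilon> \<le> 1" "\<epsilon> * M \<le> e / 6"
  proof -
    show "0 < \<epsilon>" "\<epsilon> \<le> 1" using \<open>0 < e\<close> M by (auto simp: \<epsilon>_def)
    have "\<epsilon> * M \<le> e / (6 * M) * M" using M by (intro mult_right_mono) (auto simp: \<epsilon>_def)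
    then show "\<epsilon> * M \<le> e / 6" using M by simp
  qed
  obtain c where c: "continuous_on UNIV c" "L2_norm 0 T (\<lambda>x. a x - c x) < \<epsilon>" using L2_dense_continuous[OF a \<epsilon>(1)] by blast
  obtain d where d: "continuous_on UNIV d" "L2_norm 0 T (\<lambda>x. b x - d x) < \<epsilon>" using L2_dense_continuous[OF b \<epsilon>(1)] by blast
  have c': "continuous_on {0..T} c" and d': "continuous_on {0..T} d" using c d continuous_on_subset by blast+
  have cL2: "c \<in> L2 0 T" and dL2: "d \<in> L2 0 T" by (auto intro: L2_continuous c' d')
  define C where "C t = integral {0..t} c" for t
  define D where "D t = integral {0..t} d" for t
  have C: "L2_primitive 0 T C c" and D: "L2_primitive 0 T D d"
    unfolding C_def D_def by (auto intro: L2_primitive_integral cL2 dL2)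
  have dn: "L2_norm 0 T d \<le> L2_norm 0 T b + \<epsilon>"
    using L2_norm_triangle[OF b L2_diff[OF dL2 b]] L2_norm_minus_commute[of 0 T b d] d(2) by simp
  then have dM: "L2_norm 0 T d \<le> M" using \<epsilon>(2) L2_norm_nonneg[of 0 T a] unfolding M_def by linarith
  \<comment> \<open>The exchange of (a, b) for (c, d) costs the same for the averages, uniformly in
    h, and for the limit; both follow from this bilinear estimate.\<close>
  have split: "\<bar>x - y\<bar> \<le> \<epsilon> * M + \<epsilon> * M"
    if J1: "x - y = J1 + J2" and "\<bar>J1\<bar> \<le> L2_norm 0 T a * L2_norm 0 T (\<lambda>x. b x - d x)"
      "\<bar>J2\<bar> \<le> L2_norm 0 T (\<lambda>x. a x - c x) * L2_norm 0 T d" for x y J1 J2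
  proof -
    have "\<bar>J1\<bar> \<le> M * \<epsilon>"
      using d(2) M by (intro order_trans[OF that(2)] mult_mono) (auto simp: L2_norm_nonneg M_def)
    moreover have "\<bar>J2\<bar> \<le> \<epsilon> * M"
      using c(2) \<epsilon>(1) by (intro order_trans[OF that(3)] mult_mono dM) (simp_all add: L2_norm_nonneg)
    ultimately show ?thesis unfolding J1 by (simp add: mult.commute)
  qed
  have 1: "\<bar>I A B h - I C D h\<bar> \<le> \<epsilon> * M + \<epsilon> * M" if h: "0 < h" "h < T" for h
  proof (rule split)
    note s = cont[OF A h(1)] cont[OF B h(1)] cont[OF C h(1)] cont[OF D h(1)]
    have bd: "(\<lambda>t. B (t + h) - D (t + h) - (B t - D t)) = (\<lambda>t. (B (t+h) - B t) - (D (t+h) - D t))"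
      "(\<lambda>t. A (t + h) - C (t + h) - (A t - C t)) = (\<lambda>t. (A (t+h) - A t) - (C (t+h) - C t))"
      by (auto simp: fun_eq_iff)
    show "I A B h - I C D h = I A (\<lambda>t. B t - D t) h + I (\<lambda>t. A t - C t) D h"
      unfolding I_def bd using L2_inner_diff_left[OF s(1) s(3) s(4)] L2_inner_diff_left[OF s(2) s(4) s(1)]
      by (simp add: L2_inner_commute[of 0 "T-h" "\<lambda>t. A (t+h) - A t"] add_divide_distrib diff_divide_distrib)
    show "\<bar>I A (\<lambda>t. B t - D t) h\<bar> \<le> L2_norm 0 T a * L2_norm 0 T (\<lambda>x. b x - d x)"
      by (rule Ibound[OF A L2_primitive_diff[OF B D] h])
    show "\<bar>I (\<lambda>t. A t - C t) D h\<bar> \<le> L2_norm 0 T (\<lambda>x. a x - c x) * L2_norm 0 T d"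
      by (rule Ibound[OF L2_primitive_diff[OF A C] D h])
  qed
  have 2: "\<bar>L2_inner 0 T a b - L2_inner 0 T c d\<bar> \<le> \<epsilon> * M + \<epsilon> * M"
  proof (rule split)
    show "L2_inner 0 T a b - L2_inner 0 T c d = L2_inner 0 T a (\<lambda>x. b x - d x) + L2_inner 0 T (\<lambda>x. a x - c x) d"
      using L2_inner_diff_left[OF a cL2 dL2] L2_inner_diff_left[OF b dL2 a]
      by (simp add: L2_inner_commute[of 0 T a])
  qed (auto intro!: L2_Cauchy_Schwarz L2_diff a b cL2 dL2)
  have "((\<lambda>h. integral {0..T-h} (\<lambda>t. inner (C (t+h) - C t) (D (t+h) - D t)) / h\<^sup>2)
           \<longlongrightarrow> integral {0..T} (\<lambda>t. inner (c t) (d t))) (at_right 0)"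
    unfolding C_def D_def
    by (rule steklov_C1[OF \<open>0 < T\<close>]) (auto intro!: integral_has_vector_derivative c' d')
  from tendstoD[OF this, of "e/3"] \<open>0 < e\<close>
  have "\<forall>\<^sub>F h in at_right 0. dist (integral {0..T-h} (\<lambda>t. (C (t+h) - C t) * (D (t+h) - D t)) / h\<^sup>2) (integral {0..T} (\<lambda>t. c t * d t)) < e/3"
    by simp
  moreover have "\<forall>\<^sub>F h in at_right 0. 0 < h \<and> h < T"
    unfolding eventually_at_right_field using \<open>0 < T\<close> by blast
  ultimately show "\<forall>\<^sub>F h in at_right 0. dist (integral {0..T-h} (\<lambda>t. (A (t+h) - A t) * (B (t+h) - B t)) / h\<^sup>2)
      (integral {0..T} (\<lambda>t. a t * b t)) < e"
  proof eventually_elim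
    case (elim h)
    have "I A B h = integral {0..T-h} (\<lambda>t. (A (t+h) - A t) * (B (t+h) - B t)) / h\<^sup>2"
      "I C D h = integral {0..T-h} (\<lambda>t. (C (t+h) - C t) * (D (t+h) - D t)) / h\<^sup>2"
      using elim by (simp_all add: I_def L2_inner_integral cont[OF A] cont[OF B] cont[OF C] cont[OF D])
    moreover have "L2_inner 0 T a b = integral {0..T} (\<lambda>t. a t * b t)" "L2_inner 0 T c d = integral {0..T} (\<lambda>t. c t * d t)"
      by (simp_all add: L2_inner_integral a b cL2 dL2)
    ultimately show ?case using 1[of h] 2 \<epsilon>(3) elim unfolding dist_real_def by linarith
  qed
qed

section \<open>Weak derivatives\<close>

definition smooth :: "(real \<Rightarrow> real) \<Rightarrow> bool" where
  "smooth f \<longleftrightarrow> (\<forall>n x. ((deriv ^^ n) f) field_differentiable (at x))"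

text \<open>Iterated derivatives never have to be computed: it suffices to exhibit a class that
  contains \<open>f\<close> and is closed under differentiation.\<close>

lemma smooth_coinduct:
  assumes "f \<in> S" and step: "\<And>g. g \<in> S \<Longrightarrow> \<exists>g'\<in>S. \<forall>x. (g has_field_derivative g' x) (at x)"
  shows "smooth f"
proof -
  have "(deriv ^^ n) f \<in> S" for n
  proof (induction n)
    case (Suc n)
    from step[OF this] obtain g' where g': "g' \<in> S" "\<And>x. ((deriv ^^ n) f has_field_derivative g' x) (at x)" by blast
    then have "deriv ((deriv ^^ n) f) = g'" by (auto simp: fun_eq_iff intro: DERIV_imp_deriv)
    with g' show ?case by simp
  qed (simp add: assms)
  with step show ?thesis unfolding smooth_def field_differentiable_def by blast
qed

lemma smooth_deriv: "smooth f \<Longrightarrow> smooth (deriv f)"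
  unfolding smooth_def by (metis funpow_Suc_right comp_apply)

lemma smooth_DERIV: "smooth f \<Longrightarrow> (f has_field_derivative deriv f x) (at x)"
  unfolding smooth_def by (metis DERIV_deriv_iff_field_differentiable funpow_0)

lemma smooth_continuous: "smooth f \<Longrightarrow> continuous_on A f"
  by (meson DERIV_continuous_on DERIV_subset smooth_DERIV subset_UNIV)

lemma smooth_antiderivative:
  assumes "smooth g" "\<And>x. (f has_field_derivative g x) (at x)"
  shows "smooth f"
proof (rule smooth_coinduct[of _ "insert f (Collect smooth)"])
  fix h assume "h \<in> insert f (Collect smooth)"
  then show "\<exists>g'\<in>insert f (Collect smooth). \<forall>x. (h has_field_derivative g' x) (at x)"
    using assms smooth_deriv smooth_DERIV by blast
qed simp

text \<open>The class contains all multiples \<open>c\<close>, which absorb the factor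
  \<open>a\<close> that the chain rule produces at each differentiation.\<close>

lemma smooth_affine:
  assumes "smooth f"
  shows "smooth (\<lambda>x. f (a * x + b))"
proof (rule smooth_coinduct[of _ "{\<lambda>x. c * f (a * x + b) | c f. smooth f}"])
  show "(\<lambda>x. f (a * x + b)) \<in> {\<lambda>x. c * f (a * x + b) | c f. smooth f}"
    using assms by (auto intro!: exI[of _ 1] exI[of _ f])
  fix g assume "g \<in> {\<lambda>x. c * f (a * x + b) | c f. smooth f}"
  then obtain c f where g: "g = (\<lambda>x. c * f (a * x + b))" "smooth f" by blast
  have "(g has_field_derivative (c * a) * deriv f (a * x + b)) (at x)" for x
    unfolding g by (auto intro!: derivative_eq_intros DERIV_chain2[OF smooth_DERIV[OF g(2)]])
  with smooth_deriv[OF g(2)] show "\<exists>g'\<in>{\<lambda>x. c * f (a * x + b) | c f. smooth f}. \<forall>x. (g has_field_derivative g' x) (at x)"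
    by (intro bexI[of _ "\<lambda>x. (c * a) * deriv f (a * x + b)"]) blast+
qed

lemma smooth_diff:
  assumes "smooth f" "smooth g"
  shows "smooth (\<lambda>x. f x - g x)"
proof (rule smooth_coinduct[of _ "{\<lambda>x. f x - g x | f g. smooth f \<and> smooth g}"])
  show "(\<lambda>x. f x - g x) \<in> {\<lambda>x. f x - g x | f g. smooth f \<and> smooth g}" using assms by blast
  fix h assume "h \<in> {\<lambda>x. f x - g x | f g. smooth f \<and> smooth g}"
  then obtain f g where h: "h = (\<lambda>x. f x - g x)" "smooth f" "smooth g" by blast
  have "(h has_field_derivative deriv f x - deriv g x) (at x)" for x
    unfolding h by (intro DERIV_diff smooth_DERIV h)
  with h(2,3)[THEN smooth_deriv] show "\<exists>g'\<in>{\<lambda>x. f x - g x | f g. smooth f \<and> smooth g}. \<forall>x. (h has_field_derivative g' x) (at x)"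
    by (intro bexI[of _ "\<lambda>x. deriv f x - deriv g x"]) blast+
qed

text \<open>A single product is not a class closed under differentiation; the finite sums of
  products are, by the Leibniz rule.\<close>

inductive_set smooth_products :: "(real \<Rightarrow> real) set" where
  mult: "smooth f \<Longrightarrow> smooth g \<Longrightarrow> (\<lambda>x. f x * g x) \<in> smooth_products"
| add: "h \<in> smooth_products \<Longrightarrow> k \<in> smooth_products \<Longrightarrow> (\<lambda>x. h x + k x) \<in> smooth_products"

lemma smooth_mult:
  assumes "smooth f" "smooth g"
  shows "smooth (\<lambda>x. f x * g x)"
proof (rule smooth_coinduct[OF smooth_products.mult[OF assms]])
  fix h assume "h \<in> smooth_products"
  then show "\<exists>g'\<in>smooth_products. \<forall>x. (h has_field_derivative g' x) (at x)"
  proof induction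
    case (mult f g)
    have "(\<lambda>x. f x * deriv g x + deriv f x * g x) \<in> smooth_products"
      by (intro smooth_products.intros smooth_deriv mult)
    moreover have "((\<lambda>x. f x * g x) has_field_derivative f x * deriv g x + deriv f x * g x) (at x)" for x
      using DERIV_mult[OF smooth_DERIV[OF mult(1)] smooth_DERIV[OF mult(2)]] by (simp add: algebra_simps)
    ultimately show ?case by (intro bexI[of _ "\<lambda>x. f x * deriv g x + deriv f x * g x"]) auto
  next
    case (add h k)
    then obtain h' k' where "h' \<in> smooth_products" "k' \<in> smooth_products"
      "\<And>x. (h has_field_derivative h' x) (at x)" "\<And>x. (k has_field_derivative k' x) (at x)" by blast
    then show ?case by (intro bexI[of _ "\<lambda>x. h' x + k' x"]) (auto intro: DERIV_add smooth_products.add)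
  qed
qed

text \<open>The functions \<open>q(1/x) exp(-1/x)\<close>, extended by \<open>0\<close>, form a class closed under differentiation.\<close>

definition flat_exp :: "real poly \<Rightarrow> real \<Rightarrow> real" where
  "flat_exp q x = (if x > 0 then poly q (inverse x) * exp (- inverse x) else 0)"

lemma poly_exp_decay: "((\<lambda>y. poly q y * exp (- y)) \<longlongrightarrow> (0::real)) at_top"
proof (induction q)
  case 0
  show ?case by simp
next
  case (pCons a q)
  have half: "((\<lambda>y. exp (- y)) \<longlongrightarrow> (0::real)) at_top"
    using tendsto_power_div_exp_0[of 0] by (simp add: exp_minus divide_inverse)
  have "((\<lambda>y. poly q y * y * exp (- y)) \<longlongrightarrow> (0::real)) at_top"
  proof -
    have "((\<lambda>y. \<Sum>i\<le>degree q. coeff q i * (y ^ Suc i / exp y)) \<longlongrightarrow> (\<Sum>i\<le>degree q. coeff q i * (0::real))) at_top"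
      by (intro tendsto_sum tendsto_mult tendsto_const tendsto_power_div_exp_0)
    moreover have "(\<Sum>i\<le>degree q. coeff q i * (y ^ Suc i / exp y)) = poly q y * y * exp (- y)" for y
      by (simp add: poly_altdef exp_minus divide_inverse sum_distrib_right sum_distrib_left mult_ac)
    ultimately show ?thesis by simp
  qed
  from tendsto_add[OF tendsto_mult[OF tendsto_const[of a] half] this]
  show ?case by (simp add: algebra_simps)
qed

text \<open>With y = 1/x, differentiation in x is -y^2 times differentiation in y, so q(y) exp(-y)
  becomes y^2 (q - q')(y) exp(-y). At 0 the difference quotient from the right is y q(y) exp(-y),
  which tends to 0.\<close>

lemma flat_exp_DERIV:
  "(flat_exp q has_field_derivative flat_exp (monom 1 2 * (q - pderiv q)) x) (at x)"
proof -
  consider "x < 0" | "x = 0" | "x > 0" by linarith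
  then show ?thesis
  proof cases
    case 1
    have "((\<lambda>x. 0) has_field_derivative 0) (at x)" by simp
    then have "(flat_exp q has_field_derivative 0) (at x)"
      by (rule has_field_derivative_transform_within_open[of _ _ _ "{..<0}"]) (use 1 in \<open>auto simp: flat_exp_def\<close>)
    then show ?thesis using 1 by (simp add: flat_exp_def)
  next
    case 3
    have "((\<lambda>x. poly q (inverse x) * exp (- inverse x)) has_field_derivative
       poly (pderiv q) (inverse x) * (- (inverse x)\<^sup>2) * exp (- inverse x)
        + poly q (inverse x) * (exp (- inverse x) * (inverse x)\<^sup>2)) (at x)"
      using 3 by (auto intro!: derivative_eq_intros DERIV_chain2[OF poly_DERIV] simp: power2_eq_square)
    then have "(flat_exp q has_field_derivative
       poly (pderiv q) (inverse x) * (- (inverse x)\<^sup>2) * exp (- inverse x)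
        + poly q (inverse x) * (exp (- inverse x) * (inverse x)\<^sup>2)) (at x)"
      by (rule has_field_derivative_transform_within_open[of _ _ _ "{0<..}"]) (use 3 in \<open>auto simp: flat_exp_def\<close>)
    then show ?thesis using 3 by (simp add: flat_exp_def poly_monom algebra_simps)
  next
    case 2
    have "((\<lambda>h. flat_exp q h / h) \<longlongrightarrow> 0) (at_right 0)"
    proof -
      have "((\<lambda>h. poly (pCons 0 q) (inverse h) * exp (- inverse h)) \<longlongrightarrow> 0) (at_right (0::real))"
        by (rule filterlim_compose[OF poly_exp_decay filterlim_inverse_at_top_right])
      then show ?thesis
        by (rule Lim_transform_eventually) (auto simp: eventually_at_right_field flat_exp_def divide_inverse intro!: exI[of _ 1])
    qed
    moreover have "((\<lambda>h. flat_exp q h / h) \<longlongrightarrow> 0) (at_left 0)"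
      by (rule tendsto_eventually) (auto simp: eventually_at_left_field flat_exp_def intro!: exI[of _ "-1"])
    ultimately have "((\<lambda>h. flat_exp q h / h) \<longlongrightarrow> 0) (at 0)"
      by (simp add: filterlim_split_at)
    then show ?thesis using 2 by (simp add: DERIV_def flat_exp_def)
  qed
qed

lemma smooth_flat_exp: "smooth (flat_exp q)"
  by (rule smooth_coinduct[of _ "range flat_exp"]) (use flat_exp_DERIV in blast)+

text \<open>The step is the normalised integral of exp(-1/x) exp(-1/(1-x)). The sign and the support
  of its derivative are recorded because rescaled copies of that derivative act as an approximate
  identity.\<close>

lemma smooth_step_exists:
  "\<exists>\<eta>. smooth \<eta> \<and> (\<forall>x\<le>0. \<eta> x = 0) \<and> (\<forall>x\<ge>1. \<eta> x = 1) \<and> (\<forall>x. 0 \<le> \<eta> x \<and> \<eta> x \<le> 1) \<and>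
     (\<forall>x. 0 \<le> deriv \<eta> x) \<and> (\<forall>x. x \<notin> {0..1} \<longrightarrow> deriv \<eta> x = 0)"
proof -
  define B where "B x = flat_exp 1 x * flat_exp 1 (-1 * x + 1)" for x
  have smooth_B: "smooth B" unfolding B_def by (intro smooth_mult smooth_affine smooth_flat_exp)
  have B0: "B x = 0" if "x \<notin> {0<..<1}" for x using that by (auto simp: B_def flat_exp_def)
  have Bpos: "B x > 0" if "x \<in> {0<..<1}" for x using that by (auto simp: B_def flat_exp_def)
  have Bnn: "B x \<ge> 0" for x using B0[of x] Bpos[of x] by (cases "x \<in> {0<..<1}") auto
  have Bi: "B integrable_on {a..b}" for a b
    by (intro integrable_continuous_real smooth_continuous smooth_B)
  define E where "E x = integral {0..x} B" for x
  \<comment> \<open>The base point is moved far to the left so that any given point becomes interior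
    and the one-sided derivative of the integral is a full derivative.\<close>
  have E: "E x = integral {-N..x} B" if "0 \<le> N" for N x
  proof (cases "0 \<le> x")
    case True
    have "integral {-N..0} B = integral {-N..0} (\<lambda>x. 0)"
      by (intro hk_integral_cong B0) auto
    then show ?thesis
      using hk_integral_combine[of "-N" 0 x B] Bi True that by (simp add: E_def)
  next
    case False
    have "integral {-N..x} B = integral {-N..x} (\<lambda>x. 0)"
      by (intro hk_integral_cong B0) (use False in auto)
    then show ?thesis using False by (simp add: E_def)
  qed
  have DE: "(E has_field_derivative B x) (at x)" for x
  proof -
    define N where "N = \<bar>x\<bar> + 1"
    have "((\<lambda>u. integral {-N..u} B) has_real_derivative B x) (at x within {-N..N})"
      by (rule integral_has_real_derivative) (auto simp: N_def intro: smooth_continuous[OF smooth_B])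
    moreover have "E = (\<lambda>u. integral {-N..u} B)" by (intro ext E) (simp add: N_def)
    ultimately have "(E has_field_derivative B x) (at x within {-N..N})" by simp
    then show ?thesis
      by (subst (asm) at_within_interior) (auto simp: N_def)
  qed
  have E_le0: "E x = 0" if "x \<le> 0" for x using that by (cases "x = 0") (auto simp: E_def)
  have E_mono: "E x \<le> E y" if "x \<le> y" for x y
    by (rule DERIV_nonneg_imp_nondecreasing[OF that]) (use DE Bnn in blast)
  have E_ge1: "E x = E 1" if "1 \<le> x" for x
  proof -
    have "integral {1..x} B = integral {1..x} (\<lambda>x. 0)"
      by (intro hk_integral_cong B0) auto
    then show ?thesis
      using hk_integral_combine[of 0 1 x B] Bi that by (simp add: E_def)
  qed
  have "E 0 < E 1"
  proof (rule DERIV_pos_imp_increasing_open[of 0 1 E])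
    show "\<exists>y. DERIV E x :> y \<and> 0 < y" if "0 < x" "x < 1" for x using DE Bpos that by force
    show "continuous_on {0..1} E" by (rule DERIV_continuous_on) (rule has_field_derivative_at_within[OF DE])
  qed simp
  then have c: "E 1 > 0" by (simp add: E_le0)
  define \<eta> where "\<eta> x = E x / E 1" for x
  have D: "(\<eta> has_field_derivative B x / E 1) (at x)" for x
    unfolding \<eta>_def by (intro DERIV_cdivide DE)
  have "smooth (\<lambda>x. c)" for c
    by (rule smooth_coinduct[of _ "range (\<lambda>c x. c)"]) (auto intro: DERIV_const)
  from smooth_mult[OF smooth_B this[of "1 / E 1"]] have "smooth (\<lambda>x. B x / E 1)" by simp
  then have "smooth \<eta>" by (rule smooth_antiderivative[OF _ D])
  moreover have "\<forall>x\<le>0. \<eta> x = 0" by (simp add: \<eta>_def E_le0)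
  moreover have "\<forall>x\<ge>1. \<eta> x = 1" unfolding \<eta>_def using c by (metis E_ge1 divide_self_if less_irrefl)
  moreover have D': "deriv \<eta> x = B x / E 1" for x by (rule DERIV_imp_deriv[OF D])
  moreover have "\<forall>x. 0 \<le> deriv \<eta> x" unfolding D' using c Bnn by (intro allI divide_nonneg_pos)
  moreover have "\<forall>x. x \<notin> {0..1} \<longrightarrow> deriv \<eta> x = 0" unfolding D' using B0 by fastforce
  moreover have E01: "0 \<le> E x" "E x \<le> E 1" for x
    using E_mono[of "min x 0" x] E_le0[of "min x 0"] E_mono[of x "max x 1"] E_ge1[of "max x 1"] by auto
  moreover have "\<forall>x. 0 \<le> \<eta> x \<and> \<eta> x \<le> 1" unfolding \<eta>_def using E01 c by (simp add: divide_le_eq_1)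
  ultimately show ?thesis by blast
qed

section \<open>Weak derivatives are densities of primitives\<close>

lemma L2_indicator: "indicat_real {s..t} \<in> L2 a b"
proof (rule L2_bounded[where M = 1])
  have "indicat_real {s..t} \<in> borel_measurable lebesgue" by (rule borel_measurable_indicator) simp
  then show "indicat_real {s..t} \<in> borel_measurable (lebesgue_on {a<..<b})" by (rule measurable_restrict_space1)
qed (simp add: indicator_def)

lemma L2_inner_indicator:
  assumes "g \<in> L2 a b" "a \<le> s" "t \<le> b"
  shows "L2_inner a b g (indicator {s..t}) = integral {s..t} g"
proof -
  have "L2_inner a b g (indicator {s..t}) = integral {a..b} (\<lambda>x. if x \<in> {s..t} then g x else 0)"
    unfolding L2_inner_integral[OF assms(1) L2_indicator]
    by (intro hk_integral_cong) (auto simp: indicator_def)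
  also have "\<dots> = integral {s..t} g"
    using assms by (subst hk_integral_restrict_Int) (simp add: Int_absorb2)
  finally show ?thesis .
qed

text \<open>Smoothed indicators of [s, t] are test functions. As they sharpen, their derivatives
  concentrate at s and t and pick out f(s) - f(t) by continuity, while dominated convergence gives
  the integral of \<open>g\<close> on the other side. Continuity extends the identity to the end
  points.\<close>

lemma weak_derivative_imp_primitive:
  assumes f: "continuous_on {a..b} f" and g: "g \<in> L2 a b" and weak: "has_weak_derivative a b f g"
  shows "L2_primitive a b f g"
proof -
  obtain \<eta> where \<eta>: "smooth \<eta>" and \<eta>0: "\<And>x. x \<le> 0 \<Longrightarrow> \<eta> x = 0" and \<eta>1: "\<And>x. x \<ge> 1 \<Longrightarrow> \<eta> x = 1"
    and \<eta>b: "\<And>x. 0 \<le> \<eta> x" "\<And>x. \<eta> x \<le> 1" and D\<eta>: "\<And>x. 0 \<le> deriv \<eta> x" and D\<eta>0: "\<And>x. x \<notin> {0..1} \<Longrightarrow> deriv \<eta> x = 0"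
    using smooth_step_exists by blast
  have inner: "f t - f s = integral {s..t} g" if st: "a < s" "s < t" "t < b" for s t
  proof -
    \<comment> \<open>The kernel lives on [r - \<sigma>/n, r + (1 - \<sigma>)/n]: the value \<sigma>
      = 1 puts the transition to the left of r, \<sigma> = 0 to the right.\<close>
    define k where "k \<sigma> r n x = real n * deriv \<eta> (real n * (x - r) + \<sigma>)" for \<sigma> r :: real and n :: nat and x
    have Dk: "((\<lambda>x. \<eta> (real n * (x - r) + \<sigma>)) has_field_derivative k \<sigma> r n x) (at x)" for \<sigma> r n x
    proof -
      have "((\<lambda>x. real n * (x - r) + \<sigma>) has_field_derivative real n) (at x)"
        by (auto intro!: derivative_eq_intros)
      from DERIV_chain2[OF smooth_DERIV[OF \<eta>] this] show ?thesis by (simp add: k_def mult.commute)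
    qed
    have kcont: "continuous_on A (k \<sigma> r n)" for A \<sigma> r n
      unfolding k_def by (intro continuous_intros continuous_on_compose2[OF smooth_continuous[OF smooth_deriv[OF \<eta>], of UNIV]]) auto
    have kernel: "(\<lambda>n. integral {a..b} (\<lambda>x. f x * k \<sigma> r n x)) \<longlonglongrightarrow> f r"
      if r: "a < r" "r < b" and \<sigma>: "0 \<le> \<sigma>" "\<sigma> \<le> 1" for r \<sigma>
    proof (rule LIMSEQ_I)
      fix e :: real assume "0 < e"
      obtain \<delta> where d: "\<delta> > 0" "\<And>x. x \<in> {a..b} \<Longrightarrow> \<bar>x - r\<bar> < \<delta> \<Longrightarrow> norm (f x - f r) < e/2"
        using uniform_modulus[OF f, of "e/2"] r \<open>0 < e\<close> by auto
      define \<delta>' where "\<delta>' = min \<delta> (min (r - a) (b - r))"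
      have d': "\<delta>' > 0" using d r by (simp add: \<delta>'_def)
      obtain N :: nat where N: "1 / \<delta>' < real N" using reals_Archimedean2 by blast
      have "norm (integral {a..b} (\<lambda>x. f x * k \<sigma> r n x) - f r) < e" if n: "n \<ge> N" for n
      proof -
        have n\<delta>: "1 < real n * \<delta>'" using N n d' by (simp add: field_simps) (smt (verit) mult_left_mono of_nat_mono)
        have n0: "0 < real n" using n\<delta> d' by (smt (verit) mult_nonpos_nonneg of_nat_0_le_iff)
        have total: "(k \<sigma> r n has_integral 1) {a..b}"
        proof -
          have "(k \<sigma> r n has_integral (\<eta> (real n * (b - r) + \<sigma>) - \<eta> (real n * (a - r) + \<sigma>))) {a..b}"
            using r Dk[of n r \<sigma>] by (intro fundamental_theorem_of_calculus)
              (auto simp: has_real_derivative_iff_has_vector_derivative intro: has_vector_derivative_at_within)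
          moreover have "real n * (b - r) \<ge> real n * \<delta>'" "real n * (r - a) \<ge> real n * \<delta>'"
            by (auto intro!: mult_left_mono simp: \<delta>'_def)
          then have "real n * (b - r) + \<sigma> \<ge> 1" "real n * (a - r) + \<sigma> \<le> 0"
            using n\<delta> \<sigma> by (auto simp: algebra_simps)
          ultimately show ?thesis using \<eta>0 \<eta>1 by simp
        qed
        have fk: "(\<lambda>x. f x * k \<sigma> r n x) integrable_on {a..b}"
          by (intro integrable_continuous_real continuous_intros f kcont)
        have "norm (integral {a..b} (\<lambda>x. f x * k \<sigma> r n x - f r * k \<sigma> r n x)) \<le> integral {a..b} (\<lambda>x. e/2 * k \<sigma> r n x)"
        proof (rule integral_norm_bound_integral)
          show "(\<lambda>x. f x * k \<sigma> r n x - f r * k \<sigma> r n x) integrable_on {a..b}"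
            by (intro integrable_continuous_real continuous_intros f kcont)
          show "(\<lambda>x. e/2 * k \<sigma> r n x) integrable_on {a..b}"
            by (intro integrable_continuous_real continuous_intros kcont)
          fix x assume x: "x \<in> {a..b}"
          show "norm (f x * k \<sigma> r n x - f r * k \<sigma> r n x) \<le> e/2 * k \<sigma> r n x"
          proof (cases "real n * (x - r) + \<sigma> \<in> {0..1}")
            case True
            then have "real n * \<bar>x - r\<bar> < real n * \<delta>'"
              using \<sigma> n\<delta> by (cases "x \<ge> r") (auto simp: algebra_simps)
            then have "\<bar>x - r\<bar> < \<delta>" using n0 by (simp add: \<delta>'_def)
            then have "\<bar>f x - f r\<bar> \<le> e/2" using d x by force
            moreover have "0 \<le> k \<sigma> r n x" by (simp add: k_def D\<eta>)
            ultimately show ?thesis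
              using mult_right_mono[of "\<bar>f x - f r\<bar>" "e/2" "k \<sigma> r n x"]
              by (simp only: left_diff_distrib[symmetric] abs_mult real_norm_def abs_of_nonneg)
          next
            case False
            then have "k \<sigma> r n x = 0" by (simp add: k_def D\<eta>0)
            then show ?thesis by simp
          qed
        qed
        moreover have "integral {a..b} (\<lambda>x. e/2 * k \<sigma> r n x) = e/2"
          using integral_unique[OF has_integral_mult_right[OF total, of "e/2"]] by simp
        moreover have "integral {a..b} (\<lambda>x. f x * k \<sigma> r n x - f r * k \<sigma> r n x) = integral {a..b} (\<lambda>x. f x * k \<sigma> r n x) - f r"
          using integral_unique[OF has_integral_diff[OF integrable_integral[OF fk] has_integral_mult_right[OF total, of "f r"]]] by simp
        ultimately show ?thesis using \<open>0 < e\<close> by simp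
      qed
      then show "\<exists>no. \<forall>n\<ge>no. norm (integral {a..b} (\<lambda>x. f x * k \<sigma> r n x) - f r) < e" by blast
    qed
    \<comment> \<open>Both transitions lie outside (s, t), so the function equals 1 on all of [s, t]
      and converges pointwise to the indicator of the closed interval.\<close>
    define \<phi> where "\<phi> n x = \<eta> (real n * (x - s) + 1) - \<eta> (real n * (x - t) + 0)" for n x
    have sm: "smooth (\<phi> n)" for n
    proof -
      have "\<phi> n = (\<lambda>x. \<eta> (real n * x + (1 - real n * s)) - \<eta> (real n * x + (- real n * t)))"
        by (auto simp: \<phi>_def fun_eq_iff algebra_simps)
      then show ?thesis by (simp only:) (intro smooth_diff smooth_affine \<eta>)
    qed
    have D\<phi>: "deriv (\<phi> n) x = k 1 s n x - k 0 t n x" for n x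
      unfolding \<phi>_def by (intro DERIV_imp_deriv DERIV_diff Dk)
    have \<phi>b: "\<bar>\<phi> n x\<bar> \<le> 1" for n x
      using \<eta>b(1)[of "real n * (x - s) + 1"] \<eta>b(2)[of "real n * (x - s) + 1"]
        \<eta>b(1)[of "real n * (x - t) + 0"] \<eta>b(2)[of "real n * (x - t) + 0"] unfolding \<phi>_def by linarith
    have fL2: "f \<in> L2 a b" by (rule L2_continuous[OF f])
    have \<phi>L2: "\<phi> n \<in> L2 a b" "deriv (\<phi> n) \<in> L2 a b" for n
      by (auto intro!: L2_continuous smooth_continuous smooth_deriv sm)
    have lhs: "(\<lambda>n. L2_inner a b f (deriv (\<phi> n))) \<longlonglongrightarrow> f s - f t"
    proof -
      have "L2_inner a b f (deriv (\<phi> n)) = integral {a..b} (\<lambda>x. f x * k 1 s n x) - integral {a..b} (\<lambda>x. f x * k 0 t n x)" for n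
      proof -
        have "(\<lambda>x. f x * k \<sigma> r n x) integrable_on {a..b}" for \<sigma> r
          by (intro integrable_continuous_real continuous_intros f kcont)
        then show ?thesis
          by (simp add: L2_inner_integral[OF fL2 \<phi>L2(2)] D\<phi> right_diff_distrib hk_integral_diff)
      qed
      then show ?thesis using st by (simp only:) (intro tendsto_diff kernel; simp)
    qed
    have rhs: "(\<lambda>n. L2_inner a b g (\<phi> n)) \<longlonglongrightarrow> L2_inner a b g (indicator {s..t})"
      unfolding L2_inner_def
    proof (rule integral_dominated_convergence[where w = "\<lambda>x. \<bar>g x\<bar>"])
      have ind: "indicat_real {s..t} \<in> L2 a b"
        by (rule L2_indicator)
      show "(\<lambda>x. g x * indicat_real {s..t} x) \<in> borel_measurable (lebesgue_on {a<..<b})"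
        by (intro borel_measurable_times L2_measurable g ind)
      show "(\<lambda>x. g x * \<phi> n x) \<in> borel_measurable (lebesgue_on {a<..<b})" for n
        by (intro borel_measurable_times L2_measurable g \<phi>L2)
      show "integrable (lebesgue_on {a<..<b}) (\<lambda>x. \<bar>g x\<bar>)" using L2_integrable[OF g] by simp
      show "AE x in lebesgue_on {a<..<b}. norm (g x * \<phi> n x) \<le> \<bar>g x\<bar>" for n
        using mult_left_mono[OF \<phi>b[of n], of "\<bar>g x\<bar>" for x] by (intro AE_I2) (simp add: abs_mult)
      show "AE x in lebesgue_on {a<..<b}. (\<lambda>n. g x * \<phi> n x) \<longlonglongrightarrow> g x * indicator {s..t} x"
      proof (intro AE_I2 tendsto_mult tendsto_const)
        fix x
        have large: "\<forall>\<^sub>F n in sequentially. real n * y \<ge> 1" if "y > 0" for y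
        proof -
          obtain N :: nat where "1 / y < real N" using reals_Archimedean2 by blast
          then have "1 \<le> real n * y" if "n \<ge> N" for n
            using \<open>y > 0\<close> that by (simp add: field_simps) (smt (verit) mult_left_mono of_nat_mono)
          then show ?thesis by (auto simp: eventually_sequentially)
        qed
        consider "x < s" | "s \<le> x" "x \<le> t" | "t < x" by linarith
        then have "\<forall>\<^sub>F n in sequentially. \<phi> n x = indicator {s..t} x"
        proof cases
          case 1
          have "\<forall>\<^sub>F n in sequentially. real n * (s - x) \<ge> 1" using 1 by (intro large) simp
          then show ?thesis
          proof eventually_elim
            case (elim n)
            have "real n * (x - t) \<le> 0" using 1 st by (intro mult_nonneg_nonpos) auto
            moreover have "real n * (x - s) + 1 \<le> 0" using elim by (simp add: algebra_simps)
            ultimately show ?case using 1 by (simp add: \<phi>_def \<eta>0)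
          qed
        next
          case 2
          have "real n * (x - t) \<le> 0" "real n * (x - s) \<ge> 0" for n using 2
            by (auto intro: mult_nonneg_nonpos)
          then show ?thesis using 2 by (intro always_eventually) (simp add: \<phi>_def \<eta>0 \<eta>1)
        next
          case 3
          have "\<forall>\<^sub>F n in sequentially. real n * (x - t) \<ge> 1" using 3 by (intro large) simp
          then show ?thesis
          proof eventually_elim
            case (elim n)
            have "real n * (x - s) \<ge> 0" using 3 st by simp
            then show ?case using 3 elim by (simp add: \<phi>_def \<eta>1)
          qed
        qed
        then show "(\<lambda>n. \<phi> n x) \<longlonglongrightarrow> indicator {s..t} x" by (rule tendsto_eventually)
      qed
    qed
    have ind: "L2_inner a b g (indicator {s..t}) = integral {s..t} g"
      by (rule L2_inner_indicator[OF g]) (use st in auto)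
    have "\<forall>\<^sub>F n in sequentially. L2_inner a b f (deriv (\<phi> n)) = - L2_inner a b g (\<phi> n)"
    proof -
      \<comment> \<open>Once n \<delta> \<ge> 1 the support lies in [s - \<delta>, t + \<delta>], a
        compact subset of (a, b).\<close>
      define \<delta> where "\<delta> = min (s - a) (b - t) / 2"
      have d: "\<delta> > 0" using st by (simp add: \<delta>_def)
      have d\<delta>: "\<delta> < s - a" "\<delta> < b - t" using st by (auto simp: \<delta>_def min_def)
      obtain N :: nat where N: "1 / \<delta> < real N" using reals_Archimedean2 by blast
      have "test_function a b (\<phi> n)" if n: "n \<ge> N" for n
      proof -
        have n\<delta>: "1 \<le> real n * \<delta>" using N n d by (simp add: field_simps) (smt (verit) mult_left_mono of_nat_mono)
        have "\<phi> n x = 0" if "x \<notin> {s - \<delta>..t + \<delta>}" for x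
        proof (cases "x < s - \<delta>")
          case True
          have "real n * (x - s) \<le> real n * (- \<delta>)" "real n * (x - t) \<le> real n * (- \<delta>)"
            by (intro mult_left_mono; use True st d in simp)+
          then show ?thesis using n\<delta> by (simp add: \<phi>_def \<eta>0)
        next
          case False
          then have "real n * (x - s) \<ge> real n * \<delta>" "real n * (x - t) \<ge> real n * \<delta>"
            by (intro mult_left_mono; use that st d in simp)+
          then show ?thesis using n\<delta> by (simp add: \<phi>_def \<eta>1)
        qed
        then have "{x. \<phi> n x \<noteq> 0} \<subseteq> {s - \<delta>..t + \<delta>}" by blast
        then have "closure {x. \<phi> n x \<noteq> 0} \<subseteq> {s - \<delta>..t + \<delta>}"
          by (intro closure_minimal) auto
        also have "\<dots> \<subseteq> {a<..<b}" using d\<delta> by auto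
        finally show ?thesis using sm by (auto simp: test_function_def smooth_def)
      qed
      then show ?thesis using weak by (auto simp: eventually_sequentially has_weak_derivative_def)
    qed
    then have "(\<lambda>n. - L2_inner a b g (\<phi> n)) \<longlonglongrightarrow> f s - f t"
      by (rule Lim_transform_eventually[OF lhs])
    from LIMSEQ_unique[OF this tendsto_minus[OF rhs]] ind show ?thesis by simp
  qed
  show ?thesis
    unfolding L2_primitive_def
  proof (intro conjI allI impI g)
    fix s t assume st: "a \<le> s \<and> s \<le> t \<and> t \<le> b"
    define h where "h x = f x - integral {a..x} g" for x
    show "f t - f s = integral {s..t} g"
    proof (cases "a < b")
      case True
      define m where "m = (a + b) / 2"
      have m: "a < m" "m < b" using True by (auto simp: m_def)
      note comb = integral_sub_diff[OF L2_integrable_on[OF g]]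
      have h: "h x = h m" if x: "x \<in> {a<..<b}" for x
        using inner[of x m] inner[of m x] comb[of x m] comb[of m x] x m
        by (cases x m rule: linorder_cases) (auto simp: h_def)
      have "continuous_on {a..b} h" unfolding h_def
        by (intro continuous_intros f indefinite_integral_continuous_1 L2_integrable_on g)
      then have "continuous_on (closure {a<..<b}) h" using True by simp
      then have "h x = h m" if "x \<in> {a..b}" for x
        using continuous_constant_on_closure[of "{a<..<b}" h "h m" x] h that True by simp
      then have "h t = h s" using st by auto
      then show ?thesis using comb[of s t] st by (simp add: h_def)
    next
      case False
      then have "t = s" using st by linarith
      then show ?thesis by simp
    qed
  qed
qed

text \<open>Integration by parts is the product rule for primitives, integrated over the whole
  interval, where the test function vanishes at both ends.\<close>

lemma primitive_imp_weak_derivative: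
  assumes "L2_primitive a b f g"
  shows "has_weak_derivative a b f g"
  unfolding has_weak_derivative_def
proof (intro allI impI)
  fix \<phi> assume "test_function a b \<phi>"
  then have \<phi>: "smooth \<phi>" and supp: "closure {x. \<phi> x \<noteq> 0} \<subseteq> {a<..<b}" by (auto simp: test_function_def smooth_def)
  have ends: "\<phi> a = 0" "\<phi> b = 0" using supp closure_subset[of "{x. \<phi> x \<noteq> 0}"] by force+
  have \<phi>p: "L2_primitive a b \<phi> (deriv \<phi>)"
    by (rule L2_primitive_C1)
      (auto simp: has_real_derivative_iff_has_vector_derivative[symmetric]
        intro!: has_field_derivative_at_within smooth_DERIV \<phi> smooth_continuous smooth_deriv)
  note L2s = L2_primitiveD(1)[OF assms] L2_primitiveD(1)[OF \<phi>p] L2_continuous[OF L2_primitive_continuous[OF assms]] L2_continuous[OF smooth_continuous[OF \<phi>]]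
  show "L2_inner a b f (deriv \<phi>) = - L2_inner a b g \<phi>"
  proof (cases "a \<le> b")
    case True
    from L2_primitiveD(2)[OF L2_primitive_mult[OF assms \<phi>p], of a b] True ends
    have "integral {a..b} (\<lambda>t. \<phi> t * g t + f t * deriv \<phi> t) = 0" by simp
    then have "integral {a..b} (\<lambda>t. g t * \<phi> t) + integral {a..b} (\<lambda>t. f t * deriv \<phi> t) = 0"
      using hk_integral_add[OF L2_mult_integrable_on[OF L2s(1) L2s(4)] L2_mult_integrable_on[OF L2s(3) L2s(2)]]
      by (simp add: mult.commute)
    then show ?thesis by (simp add: L2_inner_integral L2s)
  qed (simp add: L2_inner_def)
qed

lemma L2_norm_zero_AE:
  assumes "f \<in> L2 a b" "L2_norm a b f = 0"
  shows "AE x in lebesgue_on {a<..<b}. f x = 0"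
proof -
  have "(LINT x|lebesgue_on {a<..<b}. (f x)\<^sup>2) = 0"
    using assms(2) L2_norm_square[of a b f] by (simp add: L2_inner_def power2_eq_square)
  then have "AE x in lebesgue_on {a<..<b}. (f x)\<^sup>2 = 0"
    using integral_nonneg_eq_0_iff_AE[OF L2_square_integrable[OF assms(1)]] by simp
  then show ?thesis by simp
qed

text \<open>The zero function is a primitive of the difference of the densities. Its averaged
  squared increments vanish, yet they converge to the squared norm of that difference.\<close>

lemma L2_primitive_unique:
  assumes "0 < T" "L2_primitive 0 T f g" "L2_primitive 0 T f g'"
  shows "AE x in lebesgue_on {0<..<T}. g x = g' x"
proof -
  let ?d = "\<lambda>t. g t - g' t"
  have p: "L2_primitive 0 T (\<lambda>t. 0) ?d" using L2_primitive_diff[OF assms(2,3)] by simp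
  note d = L2_primitiveD(1)[OF p]
  have "((\<lambda>h::real. 0) \<longlongrightarrow> integral {0..T} (\<lambda>t. ?d t * ?d t)) (at_right 0)"
    using steklov_L2[OF assms(1) p p] by simp
  then have "integral {0..T} (\<lambda>t. ?d t * ?d t) = 0"
    using tendsto_unique[OF _ _ tendsto_const] trivial_limit_at_right_real by blast
  then have "L2_norm 0 T ?d = 0" by (simp add: L2_norm_def L2_inner_integral[OF d d])
  from L2_norm_zero_AE[OF d this] show ?thesis by simp
qed

lemma weak_deriv_primitive:
  assumes "v \<in> H1 a b"
  shows "L2_primitive a b v (weak_deriv a b v)"
proof -
  have "\<exists>g. g \<in> L2 a b \<and> has_weak_derivative a b v g" using assms by (auto simp: H1_def)
  from someI_ex[OF this] have "weak_deriv a b v \<in> L2 a b" "has_weak_derivative a b v (weak_deriv a b v)"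
    by (auto simp: weak_deriv_def)
  with assms show ?thesis by (intro weak_derivative_imp_primitive) (auto simp: H1_def)
qed

lemma L2_primitive_imp_H1: "L2_primitive a b v g \<Longrightarrow> v \<in> H1 a b"
  unfolding H1_def using L2_primitiveD(1) L2_primitive_continuous primitive_imp_weak_derivative L2_continuous
  by blast

lemma weak_deriv_L2: "v \<in> H1 a b \<Longrightarrow> weak_deriv a b v \<in> L2 a b"
  by (rule L2_primitiveD(1)[OF weak_deriv_primitive])

lemma weak_deriv_AE:
  assumes "0 < T" "L2_primitive 0 T v g"
  shows "AE x in lebesgue_on {0<..<T}. weak_deriv 0 T v x = g x"
  by (rule L2_primitive_unique[OF assms(1) weak_deriv_primitive[OF L2_primitive_imp_H1[OF assms(2)]] assms(2)])

lemma H1_diff: "u \<in> H1 a b \<Longrightarrow> v \<in> H1 a b \<Longrightarrow> (\<lambda>x. u x - v x) \<in> H1 a b"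
  by (rule L2_primitive_imp_H1[OF L2_primitive_diff[OF weak_deriv_primitive weak_deriv_primitive]])

text \<open>v(x) is compared with v(y) and the inequality is averaged over y in (0, 1). The factor 2
  comes from (a + b)^2 \<le> 2 a^2 + 2 b^2; it decides how large a boundary coupling the virial
  estimate tolerates.\<close>

lemma H1_sup_bound:
  assumes v: "v \<in> H1 0 1" and x: "x \<in> {0..1}"
  shows "(v x)\<^sup>2 \<le> 2 * (H1_norm 0 1 v)\<^sup>2"
proof -
  let ?D = "weak_deriv 0 1 v"
  note p = weak_deriv_primitive[OF v]
  note D = L2_primitiveD(1)[OF p]
  have vL2: "v \<in> L2 0 1" using v by (simp add: H1_def)
  have sq: "(\<lambda>x. (f x)\<^sup>2) integrable_on {a..b}" if "f \<in> L2 0 1" "0 \<le> a" "b \<le> 1" for f a b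
    using L2_mult_integrable_sub[OF that(1,1,2,3)] by (simp add: power2_eq_square)
  have n: "(L2_norm 0 1 f)\<^sup>2 = integral {0..1} (\<lambda>x. (f x)\<^sup>2)" if "f \<in> L2 0 1" for f
    unfolding L2_norm_square L2_inner_integral[OF that that] by (simp add: power2_eq_square)
  have le: "(v s - v t)\<^sup>2 \<le> (L2_norm 0 1 ?D)\<^sup>2" if "0 \<le> s" "s \<le> t" "t \<le> 1" for s t
  proof -
    have nn: "0 \<le> integral {s..t} (\<lambda>x. (?D x)\<^sup>2)"
      by (rule integral_nonneg) (use that in \<open>auto intro: sq D\<close>)
    have "(v s - v t)\<^sup>2 = (v t - v s)\<^sup>2" by (simp add: power2_commute)
    also have "\<dots> \<le> (t - s) * integral {s..t} (\<lambda>x. (?D x)\<^sup>2)"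
      by (rule L2_primitive_diff_square[OF p that])
    also have "\<dots> \<le> 1 * integral {s..t} (\<lambda>x. (?D x)\<^sup>2)" using that nn by (intro mult_right_mono) auto
    also have "\<dots> \<le> integral {0..1} (\<lambda>x. (?D x)\<^sup>2)"
      using integral_subset_le[of "{s..t}" "{0..1}" "\<lambda>x. (?D x)\<^sup>2"] that by (auto intro: sq D)
    finally show ?thesis by (simp add: n D)
  qed
  have *: "(v x)\<^sup>2 \<le> 2 * (v y)\<^sup>2 + 2 * (L2_norm 0 1 ?D)\<^sup>2" if y: "y \<in> {0..1}" for y
  proof -
    have "(v x - v y)\<^sup>2 \<le> (L2_norm 0 1 ?D)\<^sup>2"
      using le[of x y] le[of y x] x y by (cases "x \<le> y") (auto simp: power2_commute)
    moreover have "(v x)\<^sup>2 \<le> 2 * (v y)\<^sup>2 + 2 * (v x - v y)\<^sup>2"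
      using zero_le_power2[of "v x - 2 * v y"] by (simp add: power2_eq_square algebra_simps)
    ultimately show ?thesis by linarith
  qed
  have "integral {0..1::real} (\<lambda>y. (v x)\<^sup>2) \<le> integral {0..1} (\<lambda>y. 2 * (v y)\<^sup>2 + 2 * (L2_norm 0 1 ?D)\<^sup>2)"
    by (intro integral_le hk_integrable_add integrable_on_mult_right sq[OF vL2]) (auto simp: *)
  also have "\<dots> = 2 * (L2_norm 0 1 v)\<^sup>2 + 2 * (L2_norm 0 1 ?D)\<^sup>2"
    by (subst hk_integral_add) (auto intro!: integrable_on_mult_right sq[OF vL2] simp: n vL2)
  finally have "(v x)\<^sup>2 \<le> 2 * ((L2_norm 0 1 v)\<^sup>2 + (L2_norm 0 1 ?D)\<^sup>2)" by simp
  then show ?thesis by (simp add: H1_norm_def)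
qed

section \<open>The Hilbert space of classes of square integrable functions\<close>

text \<open>Membership is part of the relation because \<open>L2 0 1\<close> is a set and not a
  type: the quotient is partial. It becomes a Banach space with inner product, so vector derivatives
  and vector valued integrals apply to curves in it.\<close>

definition l2_rel :: "(real \<Rightarrow> real) \<Rightarrow> (real \<Rightarrow> real) \<Rightarrow> bool" where
  "l2_rel f g \<longleftrightarrow> f \<in> L2 0 1 \<and> g \<in> L2 0 1 \<and> (AE x in lebesgue_on {0<..<1}. f x = g x)"

lemma l2_relD:
  assumes "l2_rel f g"
  shows "f \<in> L2 0 1" "g \<in> L2 0 1" "AE x in lebesgue_on {0<..<1}. f x = g x"
  using assms by (auto simp: l2_rel_def)

lemma l2_rel_refl: "f \<in> L2 0 1 \<Longrightarrow> l2_rel f f"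
  by (simp add: l2_rel_def)

quotient_type l2 = "real \<Rightarrow> real" / partial: l2_rel morphisms rep_l2 cls
proof (rule part_equivpI)
  show "\<exists>f. l2_rel f f" using l2_rel_refl[OF L2_const] by blast
  show "symp l2_rel" by (auto simp: symp_def l2_rel_def elim: AE_mp)
  show "transp l2_rel"
  proof (rule transpI)
    fix f g h assume a: "l2_rel f g" "l2_rel g h"
    from l2_relD(3)[OF a(1)] l2_relD(3)[OF a(2)] have "AE x in lebesgue_on {0<..<1}. f x = h x"
      by eventually_elim simp
    with a show "l2_rel f h" by (auto simp: l2_rel_def)
  qed
qed

instantiation l2 :: real_vector
begin

lift_definition zero_l2 :: l2 is "\<lambda>x. 0" by (rule l2_rel_refl[OF L2_const])

lift_definition plus_l2 :: "l2 \<Rightarrow> l2 \<Rightarrow> l2" is "\<lambda>f g x. f x + g x"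
  unfolding l2_rel_def by (auto intro: L2_add elim: AE_mp)

lift_definition minus_l2 :: "l2 \<Rightarrow> l2 \<Rightarrow> l2" is "\<lambda>f g x. f x - g x"
  unfolding l2_rel_def by (auto intro: L2_diff elim: AE_mp)

lift_definition uminus_l2 :: "l2 \<Rightarrow> l2" is "\<lambda>f x. - f x"
  unfolding l2_rel_def by (auto intro: L2_uminus elim: AE_mp)

lift_definition scaleR_l2 :: "real \<Rightarrow> l2 \<Rightarrow> l2" is "\<lambda>c f x. c * f x"
  unfolding l2_rel_def by (auto intro: L2_scale elim: AE_mp)

instance
proof
  fix x y z :: l2 and a b :: real
  show "x + y + z = x + (y + z)"
    by transfer (auto simp: l2_rel_def add.assoc intro: L2_add)
  show "x + y = y + x"
    by transfer (auto simp: l2_rel_def add.commute intro: L2_add)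
  show "0 + x = x"
    by transfer (auto simp: l2_rel_def)
  show "- x + x = 0"
    by transfer (auto simp: l2_rel_def L2_const)
  show "x - y = x + - y"
    by transfer (auto simp: l2_rel_def intro: L2_diff)
  show "a *\<^sub>R (x + y) = a *\<^sub>R x + a *\<^sub>R y"
    by transfer (auto simp: l2_rel_def distrib_left intro!: L2_add L2_scale)
  show "(a + b) *\<^sub>R x = a *\<^sub>R x + b *\<^sub>R x"
    by transfer (auto simp: l2_rel_def distrib_right intro!: L2_add L2_scale)
  show "a *\<^sub>R b *\<^sub>R x = (a * b) *\<^sub>R x"
    by transfer (auto simp: l2_rel_def mult.assoc intro!: L2_scale)
  show "1 *\<^sub>R x = x"
    by transfer (auto simp: l2_rel_def)
qed

end

instantiation l2 :: real_inner
begin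

lift_definition inner_l2 :: "l2 \<Rightarrow> l2 \<Rightarrow> real" is "L2_inner 0 1"
  unfolding l2_rel_def by (auto intro: L2_inner_cong_AE)

definition norm_l2 :: "l2 \<Rightarrow> real" where "norm_l2 x = sqrt (inner x x)"
definition sgn_l2 :: "l2 \<Rightarrow> l2" where "sgn_l2 x = x /\<^sub>R norm x"
definition dist_l2 :: "l2 \<Rightarrow> l2 \<Rightarrow> real" where "dist_l2 x y = norm (x - y)"
definition uniformity_l2 :: "(l2 \<times> l2) filter" where
  "uniformity_l2 = (INF e\<in>{0 <..}. principal {(x, y). dist x y < e})"
definition open_l2 :: "l2 set \<Rightarrow> bool" where
  "open_l2 U \<longleftrightarrow> (\<forall>x\<in>U. \<forall>\<^sub>F (x', y) in uniformity. x' = x \<longrightarrow> y \<in> U)"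

instance
proof
  fix x y z :: l2 and a :: real and U :: "l2 set"
  show "inner x y = inner y x"
    by transfer (rule L2_inner_commute)
  show "inner (x + y) z = inner x z + inner y z"
    by transfer (auto simp: l2_rel_def intro: L2_inner_add_left)
  show "inner (a *\<^sub>R x) y = a * inner x y"
    by transfer (rule L2_inner_scale_left)
  show "0 \<le> inner x x"
    by transfer (rule L2_inner_self_nonneg)
  show "inner x x = 0 \<longleftrightarrow> x = 0"
  proof (transfer, safe)
    fix f assume f: "l2_rel f f" "L2_inner 0 1 f f = 0"
    with L2_norm_zero_AE[of f 0 1] show "l2_rel f (\<lambda>x. 0)"
      by (simp add: l2_rel_def L2_norm_def L2_const)
  next
    fix f assume f: "l2_rel f (\<lambda>x. 0)"
    then have "L2_inner 0 1 f f = L2_inner 0 1 (\<lambda>x. 0) (\<lambda>x. 0)"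
      by (intro L2_inner_cong_AE) (auto simp: l2_rel_def)
    then show "L2_inner 0 1 f f = 0" by (simp add: L2_inner_def)
  qed
  show "norm x = sqrt (inner x x)" by (rule norm_l2_def)
  show "sgn x = x /\<^sub>R norm x" by (rule sgn_l2_def)
  show "dist x y = norm (x - y)" by (rule dist_l2_def)
  show "(uniformity :: (l2 \<times> l2) filter) = (INF e\<in>{0 <..}. principal {(x, y). dist x y < e})"
    by (rule uniformity_l2_def)
  show "open U \<longleftrightarrow> (\<forall>x\<in>U. \<forall>\<^sub>F (x', y) in uniformity. x' = x \<longrightarrow> y \<in> U)"
    by (rule open_l2_def)
qed

end

lemma cls_surj: "\<exists>f\<in>L2 0 1. x = cls f"
  by (metis Quotient_l2 Quotient_abs_rep Quotient_rep_reflp l2_relD(1))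

lemma cls_eq_iff: "f \<in> L2 0 1 \<Longrightarrow> g \<in> L2 0 1 \<Longrightarrow> cls f = cls g \<longleftrightarrow> (AE x in lebesgue_on {0<..<1}. f x = g x)"
  using Quotient_rel_abs[OF Quotient_l2] Quotient_rel[OF Quotient_l2, of f g] l2_rel_refl
  by (auto simp: l2_rel_def)

lemma cls_diff: "f \<in> L2 0 1 \<Longrightarrow> g \<in> L2 0 1 \<Longrightarrow> cls (\<lambda>x. f x - g x) = cls f - cls g"
  by (simp add: minus_l2.abs_eq l2_rel_refl)

lemma cls_scale: "f \<in> L2 0 1 \<Longrightarrow> cls (\<lambda>x. c * f x) = c *\<^sub>R cls f"
  by (simp add: scaleR_l2.abs_eq l2_rel_refl)

lemma inner_cls: "f \<in> L2 0 1 \<Longrightarrow> g \<in> L2 0 1 \<Longrightarrow> inner (cls f) (cls g) = L2_inner 0 1 f g"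
  by (simp add: inner_l2.abs_eq l2_rel_refl)

lemma norm_cls: "f \<in> L2 0 1 \<Longrightarrow> norm (cls f) = L2_norm 0 1 f"
  by (simp add: norm_l2_def inner_cls L2_norm_def)

lemma norm_cls_diff: "f \<in> L2 0 1 \<Longrightarrow> g \<in> L2 0 1 \<Longrightarrow> norm (cls f - cls g) = L2_norm 0 1 (\<lambda>x. f x - g x)"
  by (simp add: cls_diff[symmetric] norm_cls L2_diff)

instance l2 :: banach
proof
  fix X :: "nat \<Rightarrow> l2" assume C: "Cauchy X"
  have "\<forall>n. \<exists>f. f \<in> L2 0 1 \<and> X n = cls f" using cls_surj by blast
  then obtain f where f: "\<And>n. f n \<in> L2 0 1" "\<And>n. X n = cls (f n)" by metis
  have "\<exists>g\<in>L2 0 1. (\<lambda>n. L2_norm 0 1 (\<lambda>x. f n x - g x)) \<longlonglongrightarrow> 0"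
  proof (rule L2_complete[OF f(1)])
    fix e :: real assume "0 < e"
    with CauchyD[OF C] obtain N where "\<forall>m\<ge>N. \<forall>n\<ge>N. norm (X m - X n) < e" by blast
    then show "\<exists>N. \<forall>m\<ge>N. \<forall>n\<ge>N. L2_norm 0 1 (\<lambda>x. f m x - f n x) < e"
      by (auto simp: f norm_cls_diff)
  qed
  then obtain g where g: "g \<in> L2 0 1" "(\<lambda>n. L2_norm 0 1 (\<lambda>x. f n x - g x)) \<longlonglongrightarrow> 0" by blast
  have "norm (X n - cls g) = L2_norm 0 1 (\<lambda>x. f n x - g x)" for n
    by (simp only: f(2) norm_cls_diff[OF f(1) g(1)])
  with g(2) have "(\<lambda>n. norm (X n - cls g)) \<longlonglongrightarrow> 0" by simp
  then have "(\<lambda>n. X n - cls g) \<longlonglongrightarrow> 0" by (rule tendsto_norm_zero_cancel)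
  then have "X \<longlonglongrightarrow> cls g" by (rule Lim_null[THEN iffD2])
  then show "convergent X" by (rule convergentI)
qed

section \<open>The Sobolev space as a closed subspace of pairs\<close>

definition H1_pair :: "(real \<Rightarrow> real) \<Rightarrow> l2 \<times> l2" where
  "H1_pair v = (cls v, cls (weak_deriv 0 1 v))"

lemma H1_L2: "v \<in> H1 a b \<Longrightarrow> v \<in> L2 a b"
  by (simp add: H1_def)

lemma norm_H1_pair: "v \<in> H1 0 1 \<Longrightarrow> norm (H1_pair v) = H1_norm 0 1 v"
  by (simp add: H1_pair_def H1_norm_def norm_Pair norm_cls H1_L2 weak_deriv_L2)

lemma inner_H1_pair:
  "u \<in> H1 0 1 \<Longrightarrow> v \<in> H1 0 1 \<Longrightarrow>
    inner (H1_pair u) (H1_pair v) = L2_inner 0 1 u v + L2_inner 0 1 (weak_deriv 0 1 u) (weak_deriv 0 1 v)"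
  by (simp add: H1_pair_def inner_cls H1_L2 weak_deriv_L2)

text \<open>The derivative chosen for a difference agrees with the difference of the chosen
  derivatives only almost everywhere; passing to classes turns this into an equation.\<close>

lemma H1_pair_diff:
  assumes "u \<in> H1 0 1" "v \<in> H1 0 1"
  shows "H1_pair (\<lambda>x. u x - v x) = H1_pair u - H1_pair v"
proof -
  note d = H1_diff[OF assms]
  have "AE x in lebesgue_on {0<..<1}. weak_deriv 0 1 (\<lambda>x. u x - v x) x = weak_deriv 0 1 u x - weak_deriv 0 1 v x"
    by (rule weak_deriv_AE[OF _ L2_primitive_diff[OF weak_deriv_primitive weak_deriv_primitive]]) (use assms in auto)
  then have "cls (weak_deriv 0 1 (\<lambda>x. u x - v x)) = cls (\<lambda>x. weak_deriv 0 1 u x - weak_deriv 0 1 v x)"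
    by (subst cls_eq_iff) (auto intro!: weak_deriv_L2 L2_diff assms d)
  then show ?thesis using assms by (simp add: H1_pair_def cls_diff H1_L2 weak_deriv_L2)
qed

lemma H1_sup_norm:
  assumes "v \<in> H1 0 1" "x \<in> {0..1}"
  shows "\<bar>v x\<bar> \<le> 2 * norm (H1_pair v)"
proof -
  have "(v x)\<^sup>2 \<le> 2 * (norm (H1_pair v))\<^sup>2" using H1_sup_bound[OF assms] by (simp add: norm_H1_pair assms)
  also have "\<dots> \<le> (2 * norm (H1_pair v))\<^sup>2" by (simp add: power_mult_distrib)
  finally show ?thesis by (rule abs_le_square_iff[THEN iffD2, THEN order_trans]) simp
qed

lemma H1_sup_diff:
  assumes "u \<in> H1 0 1" "v \<in> H1 0 1" "x \<in> {0..1}"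
  shows "\<bar>u x - v x\<bar> \<le> 2 * norm (H1_pair u - H1_pair v)"
  using H1_sup_norm[OF H1_diff[OF assms(1,2)] assms(3)] H1_pair_diff[OF assms(1,2)] by simp

lemma H1_pair_AE:
  assumes "L2_primitive 0 1 v g"
  shows "H1_pair v = (cls v, cls g)"
  unfolding H1_pair_def using weak_deriv_AE[OF _ assms] weak_deriv_L2[OF L2_primitive_imp_H1[OF assms]] L2_primitiveD(1)[OF assms]
  by (simp add: cls_eq_iff)

text \<open>Convergence of the pairs is uniform convergence on [0, 1] by the sup bound, so the limit
  has pointwise values, in particular traces. That the second component is still its derivative
  follows by pairing with indicators of intervals.\<close>

lemma H1_complete:
  assumes v: "\<And>n. v n \<in> H1 0 1" and lim: "(\<lambda>n. H1_pair (v n)) \<longlonglongrightarrow> X"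
  shows "\<exists>w\<in>H1 0 1. H1_pair w = X \<and> (\<forall>x\<in>{0..1}. (\<lambda>n. v n x) \<longlonglongrightarrow> w x)"
proof -
  obtain A B where X: "X = (A, B)" by fastforce
  obtain a b where a: "a \<in> L2 0 1" "A = cls a" and b: "b \<in> L2 0 1" "B = cls b" using cls_surj by metis
  have limA: "(\<lambda>n. cls (v n)) \<longlonglongrightarrow> cls a" and limB: "(\<lambda>n. cls (weak_deriv 0 1 (v n))) \<longlonglongrightarrow> cls b"
    using tendsto_fst[OF lim] tendsto_snd[OF lim] by (simp_all add: H1_pair_def X a b)
  have "uniformly_Cauchy_on {0..1} v"
  proof (rule uniformly_Cauchy_onI)
    fix e :: real assume "0 < e"
    then have "\<exists>M. \<forall>m\<ge>M. \<forall>n\<ge>M. norm (H1_pair (v m) - H1_pair (v n)) < e/2"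
      using CauchyD[OF LIMSEQ_imp_Cauchy[OF lim], of "e/2"] by simp
    then obtain M where M: "\<And>m n. m \<ge> M \<Longrightarrow> n \<ge> M \<Longrightarrow> norm (H1_pair (v m) - H1_pair (v n)) < e/2" by blast
    have "dist (v m x) (v n x) < e" if "x \<in> {0..1}" "m \<ge> M" "n \<ge> M" for x m n
      using H1_sup_diff[OF v v that(1), of m n] M[OF that(2,3)] by (simp add: dist_real_def)
    then show "\<exists>M. \<forall>x\<in>{0..1}. \<forall>m\<ge>M. \<forall>n\<ge>M. dist (v m x) (v n x) < e" by blast
  qed
  then have "uniformly_convergent_on {0..1} v" by (rule Cauchy_uniformly_convergent)
  then obtain w where w: "uniform_limit {0..1} v w sequentially" by (auto simp: uniformly_convergent_on_def)
  have vc: "continuous_on {0..1} (v n)" for n using v[of n] by (simp add: H1_def)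
  have wc: "continuous_on {0..1} w"
    by (rule uniform_limit_theorem[OF _ w]) (auto simp: vc)
  have wlim: "(\<lambda>n. v n x) \<longlonglongrightarrow> w x" if "x \<in> {0..1}" for x by (rule tendsto_uniform_limitI[OF w that])
  have wL2: "w \<in> L2 0 1" by (rule L2_continuous[OF wc])
  have "(\<lambda>n. cls (v n)) \<longlonglongrightarrow> cls w"
  proof (rule LIMSEQ_I)
    fix e :: real assume "0 < e"
    then have "\<forall>\<^sub>F n in sequentially. \<forall>x\<in>{0..1}. dist (v n x) (w x) < e/2" using uniform_limitD[OF w, of "e/2"] by simp
    then obtain N where N: "\<And>n x. n \<ge> N \<Longrightarrow> x \<in> {0..1} \<Longrightarrow> \<bar>v n x - w x\<bar> < e/2"
      by (force simp: eventually_sequentially dist_real_def)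
    have "norm (cls (v n) - cls w) < e" if "n \<ge> N" for n
    proof -
      have d: "(\<lambda>x. v n x - w x) \<in> L2 0 1" by (intro L2_diff H1_L2 v wL2)
      have "L2_inner 0 1 (\<lambda>x. v n x - w x) (\<lambda>x. v n x - w x) \<le> integral {0..1} (\<lambda>x::real. (e/2)\<^sup>2)"
        unfolding L2_inner_integral[OF d d]
      proof (rule integral_le[OF L2_mult_integrable_on[OF d d]])
        fix x :: real assume "x \<in> {0..1}"
        from N[OF that this] have "\<bar>v n x - w x\<bar>\<^sup>2 \<le> (e/2)\<^sup>2" by (intro power_mono) auto
        then show "(v n x - w x) * (v n x - w x) \<le> (e/2)\<^sup>2" by (simp add: power2_eq_square)
      qed auto
      then have "L2_norm 0 1 (\<lambda>x. v n x - w x) \<le> e/2" using \<open>0 < e\<close> by (subst L2_norm_le_iff) auto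
      then show ?thesis using \<open>0 < e\<close> by (simp add: norm_cls_diff H1_L2 v wL2)
    qed
    then show "\<exists>no. \<forall>n\<ge>no. norm (cls (v n) - cls w) < e" by blast
  qed
  from LIMSEQ_unique[OF limA this] have aw: "cls w = cls a" by simp
  have "L2_primitive 0 1 w b"
    unfolding L2_primitive_def
  proof (intro conjI allI impI b)
    fix s t :: real assume st: "0 \<le> s \<and> s \<le> t \<and> t \<le> 1"
    have ind: "inner (cls g) (cls (indicator {s..t})) = integral {s..t} g" if "g \<in> L2 0 1" for g
      using that st by (simp add: inner_cls L2_indicator L2_inner_indicator)
    have "(\<lambda>n. inner (cls (weak_deriv 0 1 (v n))) (cls (indicator {s..t}))) \<longlonglongrightarrow> inner (cls b) (cls (indicator {s..t}))"
      by (intro tendsto_inner limB tendsto_const)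
    then have "(\<lambda>n. v n t - v n s) \<longlonglongrightarrow> integral {s..t} b"
      using L2_primitiveD(2)[OF weak_deriv_primitive[OF v]] st by (simp add: ind b weak_deriv_L2 v)
    moreover have "(\<lambda>n. v n t - v n s) \<longlonglongrightarrow> w t - w s" using st by (intro tendsto_diff wlim) auto
    ultimately show "w t - w s = integral {s..t} b" by (rule LIMSEQ_unique[symmetric])
  qed
  with H1_pair_AE[OF this] L2_primitive_imp_H1[OF this] wlim show ?thesis
    by (intro bexI[of _ w]) (auto simp: X a b aw)
qed

section \<open>Energy and virial identities for abstract wave equations\<close>

lemma has_vector_derivative_slope:
  fixes f :: "real \<Rightarrow> 'a::real_normed_vector"
  shows "(f has_vector_derivative f') (at x within S) \<longleftrightarrow>
    ((\<lambda>y. (f y - f x) /\<^sub>R (y - x)) \<longlongrightarrow> f') (at x within S)"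
proof -
  have "(f has_vector_derivative f') (at x within S) \<longleftrightarrow>
      ((\<lambda>y. norm (f y - f x - (y - x) *\<^sub>R f') / norm (y - x)) \<longlongrightarrow> 0) (at x within S)"
    by (simp add: has_vector_derivative_def has_derivative_iff_norm bounded_linear_scaleR_left)
  also have "\<dots> \<longleftrightarrow> ((\<lambda>y. norm ((f y - f x) /\<^sub>R (y - x) - f')) \<longlongrightarrow> 0) (at x within S)"
  proof (rule filterlim_cong[OF refl refl])
    show "\<forall>\<^sub>F y in at x within S. norm (f y - f x - (y - x) *\<^sub>R f') / norm (y - x) = norm ((f y - f x) /\<^sub>R (y - x) - f')"
    proof (subst eventually_at_filter, intro always_eventually allI impI)
      fix y assume "y \<noteq> x"
      then have "f y - f x - (y - x) *\<^sub>R f' = (y - x) *\<^sub>R ((f y - f x) /\<^sub>R (y - x) - f')"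
        by (simp add: scaleR_diff_right)
      then show "norm (f y - f x - (y - x) *\<^sub>R f') / norm (y - x) = norm ((f y - f x) /\<^sub>R (y - x) - f')"
        using \<open>y \<noteq> x\<close> by simp
    qed
  qed
  also have "\<dots> \<longleftrightarrow> ((\<lambda>y. (f y - f x) /\<^sub>R (y - x)) \<longlongrightarrow> f') (at x within S)"
    using Lim_null[of "\<lambda>y. (f y - f x) /\<^sub>R (y - x)" f' "at x within S"]
      tendsto_norm_zero_iff[of "\<lambda>y. (f y - f x) /\<^sub>R (y - x) - f'" "at x within S"] by blast
  finally show ?thesis .
qed

lemma increment_limit:
  fixes A a :: "real \<Rightarrow> 'h::banach"
  assumes A: "\<And>t. t \<in> {0..T} \<Longrightarrow> (A has_vector_derivative a t) (at t within {0..T})"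
    and a: "continuous_on {0..T} a" and "0 < T"
  shows "((\<lambda>h. (A h - A 0) /\<^sub>R h) \<longlongrightarrow> a 0) (at_right 0)"
    and "((\<lambda>h. (A T - A (T - h)) /\<^sub>R h) \<longlongrightarrow> a T) (at_right 0)"
proof -
  have ev: "\<forall>\<^sub>F h in at_right 0. dist ((A h - A 0) /\<^sub>R h) (a 0) < e \<and> dist ((A T - A (T - h)) /\<^sub>R h) (a T) < e"
    if e: "0 < e" for e
  proof -
    obtain \<delta> where d: "\<delta> > 0" "\<And>s t. s \<in> {0..T} \<Longrightarrow> t \<in> {0..T} \<Longrightarrow> \<bar>t - s\<bar> < \<delta> \<Longrightarrow> norm (a t - a s) < e/2"
      using uniform_modulus[OF a, of "e/2"] e by auto
    have "dist ((A t - A s) /\<^sub>R h) (a r) < e" if "0 \<le> s" "t \<le> T" "0 < h" "h < \<delta>" "t - s = h" "r \<in> {s..t}" for s t r h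
    proof -
      have "norm (A t - A s - (t - s) *\<^sub>R a r) \<le> e/2 * (t - s)"
        by (rule increment_bound[OF has_vector_derivative_within_subset[OF A]])
          (use that d(2)[of r] in \<open>auto intro!: less_imp_le\<close>)
      also have "A t - A s - (t - s) *\<^sub>R a r = h *\<^sub>R ((A t - A s) /\<^sub>R h - a r)"
        using that by (simp add: scaleR_diff_right)
      finally show ?thesis using that \<open>0 < e\<close> by (simp add: dist_norm)
    qed
    from this[of 0] this[of "T - h" T h T for h]
    have "dist ((A h - A 0) /\<^sub>R h) (a 0) < e \<and> dist ((A T - A (T - h)) /\<^sub>R h) (a T) < e" if "0 < h" "h < min \<delta> T" for h
      using that by auto
    then show ?thesis unfolding eventually_at_right_field using d \<open>0 < T\<close> by (intro exI[of _ "min \<delta> T"]) auto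
  qed
  show "((\<lambda>h. (A h - A 0) /\<^sub>R h) \<longlongrightarrow> a 0) (at_right 0)"
    "((\<lambda>h. (A T - A (T - h)) /\<^sub>R h) \<longlongrightarrow> a T) (at_right 0)"
    by - (intro tendstoI, drule ev, erule eventually_mono, simp)+
qed

lemma shift_diff_derivative:
  fixes A a :: "real \<Rightarrow> 'h::real_normed_vector"
  assumes A: "\<And>t. t \<in> {0..T} \<Longrightarrow> (A has_vector_derivative a t) (at t within {0..T})"
    and h: "0 < h" "h < T" and t: "t \<in> {0..T-h}"
  shows "((\<lambda>t. A (t + h) - A t) has_vector_derivative a (t + h) - a t) (at t within {0..T-h})"
proof (rule has_vector_derivative_diff)
  have "(A has_vector_derivative a (t + h)) (at (t + h) within (\<lambda>t. t + h) ` {0..T-h})"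
    by (rule has_vector_derivative_within_subset[OF A]) (use h t in auto)
  moreover have "((\<lambda>t. t + h) has_vector_derivative 1) (at t within {0..T-h})"
    by (auto intro!: derivative_eq_intros)
  ultimately show "((\<lambda>t. A (t + h)) has_vector_derivative a (t + h)) (at t within {0..T-h})"
    using vector_diff_chain_within by (fastforce simp: o_def)
  show "(A has_vector_derivative a t) (at t within {0..T-h})"
    by (rule has_vector_derivative_within_subset[OF A]) (use h t in auto)
qed

text \<open>The integrand is half the time derivative of the squared norm of A(t + h) - A(t). The
  integral reduces to its two end values, which after division by h^2 are squared difference
  quotients at T and at 0.\<close>

lemma shift_energy_limit:
  fixes A a :: "real \<Rightarrow> 'h::{real_inner,banach}"
  assumes A: "\<And>t. t \<in> {0..T} \<Longrightarrow> (A has_vector_derivative a t) (at t within {0..T})"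
    and a: "continuous_on {0..T} a" and "0 < T"
  shows "((\<lambda>h. integral {0..T-h} (\<lambda>t. inner (a (t + h) - a t) (A (t + h) - A t)) / h\<^sup>2)
     \<longlongrightarrow> ((norm (a T))\<^sup>2 - (norm (a 0))\<^sup>2) / 2) (at_right 0)"
proof -
  have "integral {0..T-h} (\<lambda>t. inner (a (t + h) - a t) (A (t + h) - A t)) / h\<^sup>2
      = ((norm ((A T - A (T - h)) /\<^sub>R h))\<^sup>2 - (norm ((A h - A 0) /\<^sub>R h))\<^sup>2) / 2" if h: "0 < h" "h < T" for h
  proof -
    let ?D = "\<lambda>t. A (t + h) - A t"
    have "((\<lambda>t. inner (?D t) (?D t)) has_vector_derivative 2 * inner (a (t + h) - a t) (?D t)) (at t within {0..T-h})"
      if "t \<in> {0..T-h}" for t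
      using bounded_bilinear.has_vector_derivative[OF bounded_bilinear_inner
          shift_diff_derivative[OF A h that] shift_diff_derivative[OF A h that]]
      by (simp add: inner_commute)
    from fundamental_theorem_of_calculus[OF _ this] h
    have "integral {0..T-h} (\<lambda>t. inner (a (t + h) - a t) (?D t)) = inner (A T - A (T-h)) (A T - A (T-h)) / 2 - inner (A h - A 0) (A h - A 0) / 2"
      by (auto dest!: integral_unique)
    moreover have "(norm (x /\<^sub>R h))\<^sup>2 = inner x x / h\<^sup>2" for x :: 'h
      using h by (simp add: power_mult_distrib power_inverse power2_norm_eq_inner divide_inverse)
    ultimately show ?thesis by (simp only:) (simp add: diff_divide_distrib)
  qed
  then have ev: "\<forall>\<^sub>F h in at_right 0. ((norm ((A T - A (T - h)) /\<^sub>R h))\<^sup>2 - (norm ((A h - A 0) /\<^sub>R h))\<^sup>2) / 2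
     = integral {0..T-h} (\<lambda>t. inner (a (t + h) - a t) (A (t + h) - A t)) / h\<^sup>2"
    unfolding eventually_at_right_field using \<open>0 < T\<close> by auto
  have "((\<lambda>h. ((norm ((A T - A (T - h)) /\<^sub>R h))\<^sup>2 - (norm ((A h - A 0) /\<^sub>R h))\<^sup>2) / 2) \<longlongrightarrow> ((norm (a T))\<^sup>2 - (norm (a 0))\<^sup>2) / 2) (at_right 0)"
    by (intro tendsto_intros increment_limit[OF A a \<open>0 < T\<close>]) auto
  then show ?thesis by (rule Lim_transform_eventually[OF _ ev])
qed

text \<open>The equation cannot be tested with \<open>U'\<close>, which has no traces. It is tested instead on \<open>[t, t + h]\<close>
  with the increment \<open>(X (t + h) - X t) / h\<close>, integrated over \<open>t\<close>, and \<open>h\<close> tends to \<open>0\<close>.\<close>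

lemma energy_identity:
  fixes U U' F JF :: "real \<Rightarrow> 'h::{real_inner,banach}" and W JW :: "real \<Rightarrow> 'w::{real_inner,banach}"
  assumes T: "0 < T"
    and U: "\<And>t. t \<in> {0..T} \<Longrightarrow> (U has_vector_derivative U' t) (at t within {0..T})" and U': "continuous_on {0..T} U'"
    and JW: "\<And>t. t \<in> {0..T} \<Longrightarrow> (JW has_vector_derivative W t) (at t within {0..T})" and W: "continuous_on {0..T} W"
    and JF: "\<And>t. t \<in> {0..T} \<Longrightarrow> (JF has_vector_derivative F t) (at t within {0..T})" and F: "continuous_on {0..T} F"
    and b0: "L2_primitive 0 T b0 d0" and b1: "L2_primitive 0 T b1 d1"
    and G0: "L2_primitive 0 T G0 g0" and G1: "L2_primitive 0 T G1 g1"
    and eq: "\<And>s t. 0 \<le> s \<Longrightarrow> s \<le> t \<Longrightarrow> t \<le> T \<Longrightarrow>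
      inner (U' t - U' s) (U t - U s) + inner (JW t - JW s) (W t - W s) + inner (JF t - JF s) (U t - U s)
      + (G0 t - G0 s) * (b0 t - b0 s) + (G1 t - G1 s) * (b1 t - b1 s) = 0"
  shows "(norm (U' T))\<^sup>2 / 2 + (norm (W T))\<^sup>2 / 2 + integral {0..T} (\<lambda>t. inner (F t) (U' t))
      + integral {0..T} (\<lambda>t. g0 t * d0 t) + integral {0..T} (\<lambda>t. g1 t * d1 t)
      = (norm (U' 0))\<^sup>2 / 2 + (norm (W 0))\<^sup>2 / 2"
proof -
  let ?I = "\<lambda>f h. integral {0..T-h} (f h) / h\<^sup>2"
  \<comment> \<open>The terms \<open>?f1\<close> and \<open>?f2\<close> are total derivatives in t,
    \<open>?f3\<close> pairs increments of continuously differentiable curves, and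
    \<open>?f4\<close>, \<open>?f5\<close> involve the traces, for which only the L^2 version of the
    limit is available.\<close>
  let ?f1 = "\<lambda>h t. inner (U' (t+h) - U' t) (U (t+h) - U t)" and ?f2 = "\<lambda>h t. inner (W (t+h) - W t) (JW (t+h) - JW t)"
    and ?f3 = "\<lambda>h t. inner (JF (t+h) - JF t) (U (t+h) - U t)" and ?f4 = "\<lambda>h t. (G0 (t+h) - G0 t) * (b0 (t+h) - b0 t)"
    and ?f5 = "\<lambda>h t. (G1 (t+h) - G1 t) * (b1 (t+h) - b1 t)"
  have "((\<lambda>h. ?I ?f1 h + ?I ?f2 h + ?I ?f3 h + ?I ?f4 h + ?I ?f5 h) \<longlongrightarrow>
    ((norm (U' T))\<^sup>2 - (norm (U' 0))\<^sup>2) / 2 + ((norm (W T))\<^sup>2 - (norm (W 0))\<^sup>2) / 2 + integral {0..T} (\<lambda>t. inner (F t) (U' t))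
      + integral {0..T} (\<lambda>t. g0 t * d0 t) + integral {0..T} (\<lambda>t. g1 t * d1 t)) (at_right 0)"
    by (intro tendsto_add shift_energy_limit[OF U U' T] shift_energy_limit[OF JW W T] steklov_C1[OF T JF U F U']
        steklov_L2[OF T G0 b0] steklov_L2[OF T G1 b1])
  moreover have "\<forall>\<^sub>F h in at_right 0. ?I ?f1 h + ?I ?f2 h + ?I ?f3 h + ?I ?f4 h + ?I ?f5 h = 0"
  proof -
    have cont: "continuous_on {0..T} f" if "\<And>t. t \<in> {0..T} \<Longrightarrow> (f has_vector_derivative f' t) (at t within {0..T})"
      for f :: "real \<Rightarrow> 'k::real_normed_vector" and f'
      unfolding continuous_on_eq_continuous_within by (auto intro!: has_vector_derivative_continuous[OF that])
    have "?I ?f1 h + ?I ?f2 h + ?I ?f3 h + ?I ?f4 h + ?I ?f5 h = 0" if h: "0 < h" "h < T" for h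
    proof -
      have shift: "continuous_on {0..T-h} (\<lambda>t. f (t+h) - f t)" if "continuous_on {0..T} f" for f :: "real \<Rightarrow> 'k::real_normed_vector"
        by (intro continuous_intros continuous_on_compose2[OF that]) (use h in auto)
      note i = integrable_integral[OF integrable_continuous_real]
      have "((\<lambda>t. ?f1 h t + ?f2 h t + ?f3 h t + ?f4 h t + ?f5 h t) has_integral
          integral {0..T-h} (?f1 h) + integral {0..T-h} (?f2 h) + integral {0..T-h} (?f3 h) + integral {0..T-h} (?f4 h) + integral {0..T-h} (?f5 h)) {0..T-h}"
        by (intro has_integral_add i continuous_on_inner continuous_on_mult shift cont[OF U] cont[OF JW] cont[OF JF]
            U' W b0[THEN L2_primitive_continuous] b1[THEN L2_primitive_continuous] G0[THEN L2_primitive_continuous] G1[THEN L2_primitive_continuous])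
      moreover have "((\<lambda>t. ?f1 h t + ?f2 h t + ?f3 h t + ?f4 h t + ?f5 h t) has_integral 0) {0..T-h}"
      proof (rule has_integral_eq[OF _ has_integral_0])
        fix t assume "t \<in> {0..T-h}"
        with eq[of t "t+h"] h show "0 = ?f1 h t + ?f2 h t + ?f3 h t + ?f4 h t + ?f5 h t"
          by (simp add: inner_commute)
      qed
      ultimately have "integral {0..T-h} (?f1 h) + integral {0..T-h} (?f2 h) + integral {0..T-h} (?f3 h) + integral {0..T-h} (?f4 h) + integral {0..T-h} (?f5 h) = 0"
        by (rule has_integral_unique)
      then show ?thesis by (simp only: add_divide_distrib[symmetric])
    qed
    then show ?thesis unfolding eventually_at_right_field using T by blast
  qed
  ultimately have "((\<lambda>h::real. 0::real) \<longlongrightarrow>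
    ((norm (U' T))\<^sup>2 - (norm (U' 0))\<^sup>2) / 2 + ((norm (W T))\<^sup>2 - (norm (W 0))\<^sup>2) / 2 + integral {0..T} (\<lambda>t. inner (F t) (U' t))
      + integral {0..T} (\<lambda>t. g0 t * d0 t) + integral {0..T} (\<lambda>t. g1 t * d1 t)) (at_right 0)"
    by (rule Lim_transform_eventually)
  then have "((norm (U' T))\<^sup>2 - (norm (U' 0))\<^sup>2) / 2 + ((norm (W T))\<^sup>2 - (norm (W 0))\<^sup>2) / 2 + integral {0..T} (\<lambda>t. inner (F t) (U' t))
      + integral {0..T} (\<lambda>t. g0 t * d0 t) + integral {0..T} (\<lambda>t. g1 t * d1 t) = 0"
    by (rule tendsto_unique[OF trivial_limit_at_right_real _ tendsto_const])
  then show ?thesis by (simp add: diff_divide_distrib)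
qed

text \<open>The squared increment is at most |t - s| times the increment of the continuous function
  K, the integral of the squared density. Hence quadratic trace terms drop out of a derivative in
  time even where the trace itself is not differentiable.\<close>

lemma L2_primitive_small_square:
  assumes b: "L2_primitive 0 T b d" and s: "s \<in> {0..T}"
  shows "((\<lambda>t. (b t - b s)\<^sup>2 / (t - s)) \<longlongrightarrow> 0) (at s within {0..T})"
proof (rule tendsto_rabs_zero_cancel, rule Lim_null_comparison)
  note d = L2_primitiveD(1)[OF b]
  have sq: "(\<lambda>x. (d x)\<^sup>2) integrable_on {0..T}"
    using L2_mult_integrable_on[OF d d] by (simp add: power2_eq_square)
  define K where "K t = integral {0..t} (\<lambda>x. (d x)\<^sup>2)" for t
  have K: "continuous_on {0..T} K" unfolding K_def by (rule indefinite_integral_continuous_1[OF sq])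
  have le: "(b t - b r)\<^sup>2 \<le> (t - r) * (K t - K r)" if "0 \<le> r" "r \<le> t" "t \<le> T" for r t
    using L2_primitive_diff_square[OF b that] integral_sub_diff[OF sq that] by (simp add: K_def)
  have "((\<lambda>t. \<bar>K t - K s\<bar>) \<longlongrightarrow> \<bar>K s - K s\<bar>) (at s within {0..T})"
    by (intro tendsto_intros) (use K s in \<open>auto simp: continuous_on_def\<close>)
  then show "((\<lambda>t. \<bar>K t - K s\<bar>) \<longlongrightarrow> 0) (at s within {0..T})" by simp
  show "\<forall>\<^sub>F t in at s within {0..T}. norm \<bar>(b t - b s)\<^sup>2 / (t - s)\<bar> \<le> \<bar>K t - K s\<bar>"
  proof (subst eventually_at_filter, intro always_eventually allI impI)
    fix t assume t: "t \<noteq> s" "t \<in> {0..T}"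
    have "(b t - b s)\<^sup>2 \<le> \<bar>t - s\<bar> * \<bar>K t - K s\<bar>"
    proof (cases "s \<le> t")
      case True
      then have "(b t - b s)\<^sup>2 \<le> (t - s) * (K t - K s)" using le[of s t] s t by simp
      also have "\<dots> \<le> \<bar>(t - s) * (K t - K s)\<bar>" by simp
      finally show ?thesis by (simp only: abs_mult)
    next
      case False
      then have "(b t - b s)\<^sup>2 \<le> (s - t) * (K s - K t)" using le[of t s] s t by (simp add: power2_commute)
      also have "\<dots> \<le> \<bar>(s - t) * (K s - K t)\<bar>" by simp
      also have "\<dots> = \<bar>t - s\<bar> * \<bar>K t - K s\<bar>" by (simp add: abs_mult abs_minus_commute)
      finally show ?thesis .
    qed
    then show "norm \<bar>(b t - b s)\<^sup>2 / (t - s)\<bar> \<le> \<bar>K t - K s\<bar>"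
      using t by (simp add: abs_divide divide_le_eq mult.commute)
  qed
qed

text \<open>The separate terms of the functional need not be differentiable, because
  \<open>U'\<close> is only continuous and the traces have merely L^2 densities. Testing with the
  fixed vector U(s) replaces exactly the dangerous increments, and what is left over is quadratic in
  increments.\<close>

lemma virial_identity:
  fixes U U' N JN :: "real \<Rightarrow> 'h::{real_inner,banach}" and W JW :: "real \<Rightarrow> 'w::{real_inner,banach}"
    and lam lam0 lam1 lamt :: real
  assumes s: "s \<in> {0..T}"
    and U: "(U has_vector_derivative U' s) (at s within {0..T})" and U': "continuous_on {0..T} U'"
    and JW: "(JW has_vector_derivative W s) (at s within {0..T})"
    and JN: "(JN has_vector_derivative N s) (at s within {0..T})"
    and b0: "L2_primitive 0 T b0 d0" and b1: "L2_primitive 0 T b1 d1"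
    and K0: "(K0 has_vector_derivative k0 s) (at s within {0..T})" and K1: "(K1 has_vector_derivative k1 s) (at s within {0..T})"
    and eq: "\<And>t. t \<in> {0..T} \<Longrightarrow>
      inner (U' t - U' s) (U s) + inner (JW t - JW s) (W s) + lam * inner (U t - U s) (U s) - inner (JN t - JN s) (U s)
      + (lam0 * (b0 t - b0 s) + lamt * (b1 t - b1 s) + (K0 t - K0 s)) * b0 s
      + (lam1 * (b1 t - b1 s) + lamt * (b0 t - b0 s) + (K1 t - K1 s)) * b1 s = 0"
  shows "((\<lambda>t. inner (U' t) (U t) + lam / 2 * (norm (U t))\<^sup>2 + lam0 / 2 * (b0 t)\<^sup>2 + lam1 / 2 * (b1 t)\<^sup>2 + lamt * b0 t * b1 t)
     has_real_derivative (norm (U' s))\<^sup>2 - (norm (W s))\<^sup>2 + inner (N s) (U s) - k0 s * b0 s - k1 s * b1 s) (at s within {0..T})"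
proof -
  define \<Phi> where "\<Phi> t = inner (U' t) (U t) + lam / 2 * (norm (U t))\<^sup>2 + lam0 / 2 * (b0 t)\<^sup>2 + lam1 / 2 * (b1 t)\<^sup>2 + lamt * b0 t * b1 t" for t
  \<comment> \<open>The quadratic leftovers, all tending to 0. The mixed trace term is polarised
    through the increment of b0 - b1, so that only squares occur.\<close>
  define R where "R t = lam / 2 * inner ((U t - U s) /\<^sub>R (t - s)) (U t - U s)
      + lam0 / 2 * ((b0 t - b0 s)\<^sup>2 / (t - s)) + lam1 / 2 * ((b1 t - b1 s)\<^sup>2 / (t - s))
      + lamt / 2 * ((b0 t - b0 s)\<^sup>2 / (t - s) + (b1 t - b1 s)\<^sup>2 / (t - s) - ((b0 t - b1 t) - (b0 s - b1 s))\<^sup>2 / (t - s))" for t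
  \<comment> \<open>The part with a nonzero limit: genuine difference quotients of differentiable
    curves.\<close>
  define Q where "Q t = inner (U' t) ((U t - U s) /\<^sub>R (t - s)) - inner ((JW t - JW s) /\<^sub>R (t - s)) (W s)
     + inner ((JN t - JN s) /\<^sub>R (t - s)) (U s) - ((K0 t - K0 s) /\<^sub>R (t - s)) * b0 s - ((K1 t - K1 s) /\<^sub>R (t - s)) * b1 s" for t
  have Ulim: "((\<lambda>t. (U t - U s) /\<^sub>R (t - s)) \<longlongrightarrow> U' s) (at s within {0..T})"
    using U by (simp add: has_vector_derivative_slope)
  have "((\<lambda>t. U t - U s) \<longlongrightarrow> U s - U s) (at s within {0..T})"
    using has_vector_derivative_continuous[OF U] by (intro tendsto_intros) (simp add: continuous_within)
  then have U0: "((\<lambda>t. U t - U s) \<longlongrightarrow> 0) (at s within {0..T})" by simp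
  have U's: "(U' \<longlongrightarrow> U' s) (at s within {0..T})" using U' s by (simp add: continuous_on_def)
  have "(R \<longlongrightarrow> lam / 2 * inner (U' s) 0 + lam0 / 2 * 0 + lam1 / 2 * 0 + lamt / 2 * (0 + 0 - 0)) (at s within {0..T})"
    unfolding R_def by (intro tendsto_add tendsto_diff tendsto_mult tendsto_const tendsto_inner Ulim U0
        L2_primitive_small_square[OF b0 s] L2_primitive_small_square[OF b1 s] L2_primitive_small_square[OF L2_primitive_diff[OF b0 b1] s])
  moreover have "(Q \<longlongrightarrow> inner (U' s) (U' s) - inner (W s) (W s) + inner (N s) (U s) - k0 s * b0 s - k1 s * b1 s) (at s within {0..T})"
    unfolding Q_def using JW JN K0 K1
    by (intro tendsto_add tendsto_diff tendsto_mult tendsto_const tendsto_inner Ulim U's) (simp_all add: has_vector_derivative_slope)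
  ultimately have lim: "((\<lambda>t. Q t + R t) \<longlongrightarrow> inner (U' s) (U' s) - inner (W s) (W s) + inner (N s) (U s) - k0 s * b0 s - k1 s * b1 s) (at s within {0..T})"
    using tendsto_add by fastforce
  have "(\<Phi> t - \<Phi> s) / (t - s) = Q t + R t" if t: "t \<noteq> s" "t \<in> {0..T}" for t
  proof -
    have "(t - s) * (Q t + R t) = inner (U' t) (U t - U s) - inner (JW t - JW s) (W s) + inner (JN t - JN s) (U s) - (K0 t - K0 s) * b0 s - (K1 t - K1 s) * b1 s
       + lam / 2 * inner (U t - U s) (U t - U s) + lam0 / 2 * (b0 t - b0 s)\<^sup>2 + lam1 / 2 * (b1 t - b1 s)\<^sup>2
       + lamt / 2 * ((b0 t - b0 s)\<^sup>2 + (b1 t - b1 s)\<^sup>2 - ((b0 t - b1 t) - (b0 s - b1 s))\<^sup>2)"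
    proof -
      obtain h where h: "t - s = h" "h \<noteq> 0" using t by simp
      then show ?thesis unfolding Q_def R_def h(1)
        by (simp only: inner_scaleR_left inner_scaleR_right real_scaleR_def) (simp add: field_simps)
    qed
    also have "\<dots> = \<Phi> t - \<Phi> s"
      using eq[OF t(2)] unfolding \<Phi>_def power2_norm_eq_inner
      by (simp add: inner_diff_left inner_diff_right power2_eq_square inner_commute algebra_simps)
    finally show ?thesis using t by (simp add: field_simps)
  qed
  then have "\<forall>\<^sub>F t in at s within {0..T}. Q t + R t = (\<Phi> t - \<Phi> s) / (t - s)"
    by (subst eventually_at_filter) (intro always_eventually, simp)
  from Lim_transform_eventually[OF lim this] show ?thesis
    unfolding \<Phi>_def[symmetric] has_field_derivative_iff by (simp add: power2_norm_eq_inner)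
qed

lemma L2_cong:
  assumes "f \<in> L2 a b" "\<And>x. x \<in> {a<..<b} \<Longrightarrow> f x = g x"
  shows "g \<in> L2 a b"
proof -
  have "g \<in> borel_measurable (lebesgue_on {a<..<b})"
    using L2_measurable[OF assms(1)] by (rule measurable_cong[THEN iffD1, rotated]) (use assms(2) in auto)
  moreover have "integrable (lebesgue_on {a<..<b}) (\<lambda>x. (g x)\<^sup>2)"
    using L2_square_integrable[OF assms(1)]
    by (rule Bochner_Integration.integrable_cong[THEN iffD1, rotated 2]) (use assms(2) in auto)
  ultimately show ?thesis by (simp add: L2_def)
qed

lemma L2_primitive_cong:
  assumes "L2_primitive a b f g" "\<And>t. t \<in> {a..b} \<Longrightarrow> f t = f' t" "\<And>t. t \<in> {a..b} \<Longrightarrow> g t = g' t"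
  shows "L2_primitive a b f' g'"
  unfolding L2_primitive_def
proof (intro conjI allI impI)
  show "g' \<in> L2 a b" by (rule L2_cong[OF L2_primitiveD(1)[OF assms(1)]]) (use assms(3) in auto)
  fix s t assume st: "a \<le> s \<and> s \<le> t \<and> t \<le> b"
  have "integral {s..t} g = integral {s..t} g'"
    by (rule hk_integral_cong) (use st assms(3) in auto)
  then show "f' t - f' s = integral {s..t} g'"
    using L2_primitiveD(2)[OF assms(1), of s t] assms(2)[of s] assms(2)[of t] st by simp
qed

lemma L2_primitive_AE:
  assumes "L2_primitive a b f g" "g' \<in> L2 a b" "AE x in lebesgue_on {a<..<b}. g x = g' x"
  shows "L2_primitive a b f g'"
  unfolding L2_primitive_def
proof (intro conjI allI impI assms(2))
  fix s t assume st: "a \<le> s \<and> s \<le> t \<and> t \<le> b"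
  note g = L2_primitiveD(1)[OF assms(1)]
  have "integral {s..t} g = L2_inner a b g (indicator {s..t})" using st by (simp add: L2_inner_indicator g)
  also have "\<dots> = L2_inner a b g' (indicator {s..t})"
    by (rule L2_inner_cong_AE) (use assms g in \<open>auto simp: L2_indicator\<close>)
  also have "\<dots> = integral {s..t} g'" using st by (simp add: L2_inner_indicator assms)
  finally show "f t - f s = integral {s..t} g'" using L2_primitiveD(2)[OF assms(1), of s t] st by simp
qed

section \<open>Power nonlinearities\<close>

definition power_force :: "real \<Rightarrow> real \<Rightarrow> real" where
  "power_force r x = \<bar>x\<bar> powr (r - 2) * x"

lemma power_force_mult: "power_force r x * x = \<bar>x\<bar> powr r"
proof (cases "x = 0")
  case False
  have "power_force r x * x = \<bar>x\<bar> powr (r - 2) * \<bar>x\<bar> powr 2"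
    using False by (simp add: power_force_def mult.assoc power2_eq_square[symmetric])
  also have "\<dots> = \<bar>x\<bar> powr r" by (simp only: powr_add[symmetric]) simp
  finally show ?thesis .
qed (simp add: power_force_def)

lemma abs_powr_DERIV_0:
  assumes "r > (1::real)"
  shows "((\<lambda>x. \<bar>x\<bar> powr r) has_real_derivative 0) (at 0)"
proof -
  have "((\<lambda>h. \<bar>h\<bar> powr r / h) \<longlongrightarrow> 0) (at (0::real))"
  proof (rule Lim_null_comparison)
    show "\<forall>\<^sub>F h in at 0. norm (\<bar>h\<bar> powr r / h) \<le> \<bar>h\<bar> powr (r - 1)"
    proof (subst eventually_at_filter, intro always_eventually allI impI)
      fix h :: real assume "h \<noteq> 0"
      then show "norm (\<bar>h\<bar> powr r / h) \<le> \<bar>h\<bar> powr (r - 1)" by (simp add: powr_diff abs_divide)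
    qed
    have "((\<lambda>h::real. \<bar>h\<bar> powr (r - 1)) \<longlongrightarrow> \<bar>0\<bar> powr (r - 1)) (at 0)"
      using assms by (intro tendsto_powr' tendsto_rabs tendsto_ident_at tendsto_const) auto
    then show "((\<lambda>h::real. \<bar>h\<bar> powr (r - 1)) \<longlongrightarrow> 0) (at 0)" by simp
  qed
  then show ?thesis by (simp add: DERIV_def)
qed

lemma abs_powr_DERIV_nonzero:
  assumes "x \<noteq> (0::real)"
  shows "((\<lambda>x. \<bar>x\<bar> powr s) has_real_derivative s * (\<bar>x\<bar> powr (s - 1) * sgn x)) (at x)"
proof (cases "x > 0")
  case True
  have "((\<lambda>x. x powr s) has_real_derivative s * x powr (s - 1)) (at x)"
    by (rule has_real_derivative_powr[OF True])
  then have "((\<lambda>x. \<bar>x\<bar> powr s) has_real_derivative s * x powr (s - 1)) (at x)"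
    by (rule has_field_derivative_transform_within_open[of _ _ _ "{0<..}"]) (use True in auto)
  then show ?thesis using True by simp
next
  case False
  then have "x < 0" using assms by simp
  have "((\<lambda>x. (- x) powr s) has_real_derivative s * (- x) powr (s - 1) * (- 1)) (at x)"
    using \<open>x < 0\<close> by (intro DERIV_chain2[OF has_real_derivative_powr]) (auto intro!: derivative_eq_intros)
  then have "((\<lambda>x. \<bar>x\<bar> powr s) has_real_derivative s * (- x) powr (s - 1) * (- 1)) (at x)"
    by (rule has_field_derivative_transform_within_open[of _ _ _ "{..<0}"]) (use \<open>x < 0\<close> in auto)
  then show ?thesis using \<open>x < 0\<close> by simp
qed

lemma abs_powr_sgn: "\<bar>x\<bar> powr (s - 1) * sgn x * x = \<bar>x\<bar> powr s" for x :: real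
proof (cases "x = 0")
  case False
  have "\<bar>x\<bar> powr s = \<bar>x\<bar> powr (s - 1) * \<bar>x\<bar> powr 1" by (simp only: powr_add[symmetric]) simp
  also have "\<bar>x\<bar> powr 1 = sgn x * x" by (simp add: sgn_if abs_if)
  finally show ?thesis by (simp add: mult.assoc)
qed simp

lemma abs_powr_DERIV:
  assumes "r > 1"
  shows "((\<lambda>x. \<bar>x\<bar> powr r) has_real_derivative r * power_force r x) (at x)"
proof (cases "x = 0")
  case True
  with abs_powr_DERIV_0[OF assms] show ?thesis by (simp add: power_force_def)
next
  case False
  have "\<bar>x\<bar> powr (r - 1) * sgn x = power_force r x"
    using False abs_powr_sgn[of x r] power_force_mult[of r x] by (metis mult_right_cancel)
  with abs_powr_DERIV_nonzero[OF False, of r] show ?thesis by simp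
qed

lemma power_force_DERIV:
  assumes "r > 2"
  shows "(power_force r has_real_derivative (r - 1) * \<bar>x\<bar> powr (r - 2)) (at x)"
proof (cases "x = 0")
  case True
  have "((\<lambda>h. \<bar>h\<bar> powr (r - 2)) \<longlongrightarrow> \<bar>0\<bar> powr (r - 2)) (at (0::real))"
    using assms by (intro tendsto_powr' tendsto_rabs tendsto_ident_at tendsto_const) auto
  moreover have "\<forall>\<^sub>F h in at 0. \<bar>h\<bar> powr (r - 2) = power_force r h / h"
    by (subst eventually_at_filter) (simp add: power_force_def)
  ultimately have "((\<lambda>h. power_force r h / h) \<longlongrightarrow> 0) (at 0)"
    using Lim_transform_eventually by fastforce
  then show ?thesis using True assms by (simp add: DERIV_def power_force_def)
next
  case False
  from DERIV_mult[OF abs_powr_DERIV_nonzero[OF False, of "r - 2"] DERIV_ident]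
  have "(power_force r has_real_derivative (r - 2) * (\<bar>x\<bar> powr (r - 2 - 1) * sgn x * x) + \<bar>x\<bar> powr (r - 2)) (at x)"
    unfolding power_force_def[abs_def] by (simp add: algebra_simps)
  then show ?thesis unfolding abs_powr_sgn by (simp add: algebra_simps)
qed

lemma power_force_continuous: "r > 2 \<Longrightarrow> continuous_on A (power_force r)"
  by (rule DERIV_continuous_on[OF has_field_derivative_at_within[OF power_force_DERIV]])

text \<open>The maximum over [-M, M] of the derivative of \<open>power_force r\<close>, for r > 2
  and M \<ge> 0.\<close>

definition force_Lipschitz :: "real \<Rightarrow> real \<Rightarrow> real" where
  "force_Lipschitz r M = (r - 1) * M powr (r - 2)"

lemma force_Lipschitz_nonneg: "r > 2 \<Longrightarrow> 0 \<le> force_Lipschitz r M"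
  by (simp add: force_Lipschitz_def)

lemma power_force_Lipschitz:
  assumes r: "r > 2" and x: "\<bar>x\<bar> \<le> M" and y: "\<bar>y\<bar> \<le> M"
  shows "\<bar>power_force r x - power_force r y\<bar> \<le> force_Lipschitz r M * \<bar>x - y\<bar>"
proof -
  have "norm (power_force r x - power_force r y) \<le> force_Lipschitz r M * norm (x - y)"
  proof (rule field_differentiable_bound[of "{-M..M}" "power_force r"])
    fix z assume z: "z \<in> {-M..M}"
    show "(power_force r has_field_derivative (r - 1) * \<bar>z\<bar> powr (r - 2)) (at z within {-M..M})"
      by (rule has_field_derivative_at_within[OF power_force_DERIV[OF r]])
    have "\<bar>z\<bar> powr (r - 2) \<le> M powr (r - 2)" using z r by (intro powr_mono2) auto
    then show "norm ((r - 1) * \<bar>z\<bar> powr (r - 2)) \<le> force_Lipschitz r M"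
      using r by (simp add: force_Lipschitz_def abs_mult)
  qed (use x y in auto)
  then show ?thesis by simp
qed

text \<open>\<open>?g\<close> is the potential minus its tangent at y; its derivative is a
  difference of forces, hence at most the Lipschitz constant times |x - y| on the segment. The
  result has the form that the chain rule for primitives asks for.\<close>

lemma abs_powr_Taylor:
  assumes r: "r > 2" and x: "\<bar>x\<bar> \<le> M" and y: "\<bar>y\<bar> \<le> M"
  shows "\<bar>\<bar>x\<bar> powr r / r - \<bar>y\<bar> powr r / r - power_force r y * (x - y)\<bar> \<le> force_Lipschitz r M * (x - y)\<^sup>2"
proof -
  let ?g = "\<lambda>z. \<bar>z\<bar> powr r / r - power_force r y * z"
  have "norm (?g x - ?g y) \<le> (force_Lipschitz r M * \<bar>x - y\<bar>) * norm (x - y)"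
  proof (rule field_differentiable_bound[of "closed_segment x y" ?g])
    fix z assume z: "z \<in> closed_segment x y"
    show "(?g has_field_derivative power_force r z - power_force r y) (at z within closed_segment x y)"
    proof (rule has_field_derivative_at_within)
      show "(?g has_field_derivative power_force r z - power_force r y) (at z)"
        using DERIV_diff[OF DERIV_cdivide[OF abs_powr_DERIV[of r z], of r] DERIV_cmult_Id[of "power_force r y" z UNIV]] r by simp
    qed
    have "\<bar>z\<bar> \<le> M" "\<bar>z - y\<bar> \<le> \<bar>x - y\<bar>" using z x y by (auto simp: closed_segment_eq_real_ivl split: if_splits)
    then have "\<bar>power_force r z - power_force r y\<bar> \<le> force_Lipschitz r M * \<bar>z - y\<bar>"
      by (intro power_force_Lipschitz[OF r] y)
    also have "\<dots> \<le> force_Lipschitz r M * \<bar>x - y\<bar>"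
      by (intro mult_left_mono force_Lipschitz_nonneg r) fact
    finally show "norm (power_force r z - power_force r y) \<le> force_Lipschitz r M * \<bar>x - y\<bar>" by simp
  qed auto
  moreover have "?g x - ?g y = \<bar>x\<bar> powr r / r - \<bar>y\<bar> powr r / r - power_force r y * (x - y)"
    by (simp add: right_diff_distrib)
  moreover have "force_Lipschitz r M * \<bar>x - y\<bar> * norm (x - y) = force_Lipschitz r M * (x - y)\<^sup>2"
    by (simp add: power2_eq_square mult.assoc)
  ultimately show ?thesis by (simp only: real_norm_def)
qed

definition force :: "real \<Rightarrow> (real \<Rightarrow> real) \<Rightarrow> l2" where
  "force r v = cls (\<lambda>x. power_force r (v x))"

lemma power_force_comp_L2:
  assumes "r > 2" "v \<in> H1 0 1"
  shows "(\<lambda>x. power_force r (v x)) \<in> L2 0 1"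
  by (intro L2_continuous continuous_on_compose2[OF power_force_continuous[OF assms(1), of UNIV]])
    (use assms(2) in \<open>auto simp: H1_def\<close>)

lemma L2_norm_le_scaled:
  assumes f: "f \<in> L2 a b" and g: "g \<in> L2 a b" and "0 \<le> c" and le: "\<And>x. x \<in> {a..b} \<Longrightarrow> \<bar>f x\<bar> \<le> c * \<bar>g x\<bar>"
  shows "L2_norm a b f \<le> c * L2_norm a b g"
proof (subst L2_norm_le_iff)
  show "0 \<le> c * L2_norm a b g" using \<open>0 \<le> c\<close> by (simp add: L2_norm_nonneg)
  have "L2_inner a b f f \<le> integral {a..b} (\<lambda>x. c\<^sup>2 * (g x * g x))"
    unfolding L2_inner_integral[OF f f]
  proof (rule integral_le)
    show "(\<lambda>x. c\<^sup>2 * (g x * g x)) integrable_on {a..b}"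
      by (intro integrable_on_mult_right L2_mult_integrable_on g)
    fix x assume "x \<in> {a..b}"
    from power_mono[OF le[OF this], of 2] show "f x * f x \<le> c\<^sup>2 * (g x * g x)"
      unfolding power_mult_distrib power2_abs by (simp add: power2_eq_square)
  qed (rule L2_mult_integrable_on[OF f f])
  also have "\<dots> = (c * L2_norm a b g)\<^sup>2" by (simp add: power_mult_distrib L2_norm_square L2_inner_integral[OF g g])
  finally show "L2_inner a b f f \<le> (c * L2_norm a b g)\<^sup>2" .
qed

text \<open>An H^1 bound M gives a pointwise bound 2 M, so the force is Lipschitz on H^1 balls, and
  with respect to the weaker L^2 norm.\<close>

lemma force_Lipschitz_H1:
  assumes r: "r > 2" and u: "u \<in> H1 0 1" "norm (H1_pair u) \<le> M" and v: "v \<in> H1 0 1" "norm (H1_pair v) \<le> M"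
  shows "norm (force r u - force r v) \<le> force_Lipschitz r (2 * M) * norm (cls u - cls v)"
proof -
  have "\<bar>power_force r (u x) - power_force r (v x)\<bar> \<le> force_Lipschitz r (2 * M) * \<bar>u x - v x\<bar>" if "x \<in> {0..1}" for x
    using H1_sup_norm[OF u(1) that] H1_sup_norm[OF v(1) that] u(2) v(2) by (intro power_force_Lipschitz r) auto
  then show ?thesis unfolding force_def
    by (simp add: norm_cls_diff power_force_comp_L2 r u v H1_L2)
      (intro L2_norm_le_scaled L2_diff power_force_comp_L2 H1_L2 r u v force_Lipschitz_nonneg, simp)
qed

lemma inner_force: "r > 2 \<Longrightarrow> v \<in> H1 0 1 \<Longrightarrow> w \<in> L2 0 1 \<Longrightarrow>
    inner (force r v) (cls w) = L2_inner 0 1 (\<lambda>x. \<bar>v x\<bar> powr (r - 2) * v x) w"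
  unfolding force_def power_force_def[symmetric] by (intro inner_cls power_force_comp_L2)

lemma force_potential:
  assumes "r > 2" "v \<in> H1 0 1"
  shows "inner (force r v) (cls v) = (LINT x|lebesgue_on {0<..<1}. \<bar>v x\<bar> powr r)"
  using assms by (simp add: force_def inner_cls power_force_comp_L2 H1_L2 L2_inner_def power_force_mult)

text \<open>The pointwise expansion, integrated over space. The remainder is measured in L^2, the
  only norm in which the solution is differentiable in time.\<close>

lemma force_Taylor:
  assumes r: "r > 2" and u: "u \<in> H1 0 1" "norm (H1_pair u) \<le> M" and v: "v \<in> H1 0 1" "norm (H1_pair v) \<le> M"
  shows "\<bar>inner (force r u) (cls u) / r - inner (force r v) (cls v) / r - inner (force r v) (cls u - cls v)\<bar>
    \<le> force_Lipschitz r (2 * M) * (norm (cls u - cls v))\<^sup>2"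
proof -
  note uL = power_force_comp_L2[OF r u(1)] H1_L2[OF u(1)] and vL = power_force_comp_L2[OF r v(1)] H1_L2[OF v(1)]
  note d = L2_diff[OF uL(2) vL(2)]
  have i: "((\<lambda>x. power_force r (u x) * u x) has_integral inner (force r u) (cls u)) {0..1}"
    "((\<lambda>x. power_force r (v x) * v x) has_integral inner (force r v) (cls v)) {0..1}"
    "((\<lambda>x. power_force r (v x) * (u x - v x)) has_integral inner (force r v) (cls u - cls v)) {0..1}"
    "((\<lambda>x. (u x - v x) * (u x - v x)) has_integral (norm (cls u - cls v))\<^sup>2) {0..1}"
    by (simp_all add: force_def power2_norm_eq_inner cls_diff[OF uL(2) vL(2), symmetric] inner_cls uL vL d L2_inner_integral
        integrable_integral L2_mult_integrable_on)
  have e: "((\<lambda>x. power_force r (u x) * u x / r - power_force r (v x) * v x / r - power_force r (v x) * (u x - v x))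
      has_integral (inner (force r u) (cls u) / r - inner (force r v) (cls v) / r - inner (force r v) (cls u - cls v))) {0..1}"
    by (intro has_integral_diff has_integral_divide i)
  have b: "((\<lambda>x. force_Lipschitz r (2 * M) * ((u x - v x) * (u x - v x))) has_integral force_Lipschitz r (2 * M) * (norm (cls u - cls v))\<^sup>2) {0..1}"
    by (intro has_integral_mult_right i)
  have "norm (integral {0..1} (\<lambda>x. power_force r (u x) * u x / r - power_force r (v x) * v x / r - power_force r (v x) * (u x - v x)))
      \<le> integral {0..1} (\<lambda>x. force_Lipschitz r (2 * M) * ((u x - v x) * (u x - v x)))"
  proof (rule integral_norm_bound_integral)
    fix x :: real assume x: "x \<in> {0..1}"
    have "\<bar>u x\<bar> \<le> 2 * M" "\<bar>v x\<bar> \<le> 2 * M" using H1_sup_norm[OF u(1) x] H1_sup_norm[OF v(1) x] u(2) v(2) by auto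
    from abs_powr_Taylor[OF r this]
    show "norm (power_force r (u x) * u x / r - power_force r (v x) * v x / r - power_force r (v x) * (u x - v x))
       \<le> force_Lipschitz r (2 * M) * ((u x - v x) * (u x - v x))"
      by (simp add: power_force_mult power2_eq_square)
  qed (use e b in \<open>auto simp: integrable_on_def\<close>)
  then show ?thesis by (simp only: integral_unique[OF e] integral_unique[OF b] real_norm_def)
qed

section \<open>Weak solutions as curves in Hilbert space\<close>

lemma L2_scale_right: "f \<in> L2 a b \<Longrightarrow> (\<lambda>x. f x * c) \<in> L2 a b"
  using L2_scale[of f a b c] by (simp add: mult.commute)

lemma L2_inner_cong:
  assumes "\<And>x. x \<in> {a<..<b} \<Longrightarrow> f x = f' x" "\<And>x. x \<in> {a<..<b} \<Longrightarrow> g x = g' x"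
  shows "L2_inner a b f g = L2_inner a b f' g'"
  unfolding L2_inner_def by (intro Bochner_Integration.integral_cong) (use assms in auto)

lemma tendsto_norm_diff_iff:
  fixes f :: "'a \<Rightarrow> 'b::real_normed_vector"
  assumes "\<forall>\<^sub>F s in F. h s = norm (f s - l)"
  shows "(h \<longlongrightarrow> 0) F \<longleftrightarrow> (f \<longlongrightarrow> l) F"
proof -
  have "(h \<longlongrightarrow> 0) F \<longleftrightarrow> ((\<lambda>s. norm (f s - l)) \<longlongrightarrow> 0) F"
    by (rule filterlim_cong[OF refl refl assms])
  also have "\<dots> \<longleftrightarrow> (f \<longlongrightarrow> l) F"
    using Lim_null[of f l F] tendsto_norm_zero_iff[of "\<lambda>s. f s - l" F] by blast
  finally show ?thesis .
qed

lemma continuous_in_H1_iff: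
  "continuous_in_H1 T u \<longleftrightarrow>
    (\<forall>t\<in>{0..T}. u t \<in> H1 0 1) \<and> continuous_on {0..T} (\<lambda>t. H1_pair (u t))"
proof -
  have "((\<lambda>s. H1_norm 0 1 (\<lambda>x. u s x - u t x)) \<longlongrightarrow> 0) (at t within {0..T})
      \<longleftrightarrow> ((\<lambda>s. H1_pair (u s)) \<longlongrightarrow> H1_pair (u t)) (at t within {0..T})"
    if H: "\<forall>t\<in>{0..T}. u t \<in> H1 0 1" and t: "t \<in> {0..T}" for t
  proof (rule tendsto_norm_diff_iff)
    have "H1_norm 0 1 (\<lambda>x. u s x - u t x) = norm (H1_pair (u s) - H1_pair (u t))" if "s \<in> {0..T}" for s
      using H t that by (simp add: norm_H1_pair[OF H1_diff, symmetric] H1_pair_diff)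
    then show "\<forall>\<^sub>F s in at t within {0..T}. H1_norm 0 1 (\<lambda>x. u s x - u t x) = norm (H1_pair (u s) - H1_pair (u t))"
      by (simp add: eventually_at_filter)
  qed
  then show ?thesis unfolding continuous_in_H1_def continuous_on_def by (metis (no_types, lifting))
qed

lemma C1_in_L2_iff:
  "C1_in_L2 T u u' \<longleftrightarrow>
    (\<forall>t\<in>{0..T}. u t \<in> L2 0 1 \<and> u' t \<in> L2 0 1) \<and>
    (\<forall>t\<in>{0..T}. ((\<lambda>t. cls (u t)) has_vector_derivative cls (u' t)) (at t within {0..T})) \<and>
    continuous_on {0..T} (\<lambda>t. cls (u' t))"
proof -
  have 1: "((\<lambda>s. L2_norm 0 1 (\<lambda>x. (u s x - u t x) / (s - t) - u' t x)) \<longlongrightarrow> 0) (at t within {0..T})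
      \<longleftrightarrow> ((\<lambda>t. cls (u t)) has_vector_derivative cls (u' t)) (at t within {0..T})"
    if L: "\<forall>t\<in>{0..T}. u t \<in> L2 0 1 \<and> u' t \<in> L2 0 1" and t: "t \<in> {0..T}" for t
    unfolding has_vector_derivative_slope
  proof (rule tendsto_norm_diff_iff)
    have "L2_norm 0 1 (\<lambda>x. (u s x - u t x) / (s - t) - u' t x) = norm ((cls (u s) - cls (u t)) /\<^sub>R (s - t) - cls (u' t))"
      if "s \<in> {0..T}" for s
    proof -
      have a: "u s \<in> L2 0 1" "u t \<in> L2 0 1" "u' t \<in> L2 0 1" using L t that by auto
      have d: "(\<lambda>x. u s x - u t x) \<in> L2 0 1" by (intro L2_diff a)
      have q: "(\<lambda>x. inverse (s - t) * (u s x - u t x)) \<in> L2 0 1" by (rule L2_scale[OF d])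
      have "(cls (u s) - cls (u t)) /\<^sub>R (s - t) - cls (u' t) = cls (\<lambda>x. inverse (s - t) * (u s x - u t x) - u' t x)"
        by (simp only: cls_diff[OF a(1,2), symmetric] cls_scale[OF d, symmetric] cls_diff[OF q a(3), symmetric])
      then show ?thesis using norm_cls[OF L2_diff[OF q a(3)]] by (simp add: divide_inverse mult.commute)
    qed
    then show "\<forall>\<^sub>F s in at t within {0..T}. L2_norm 0 1 (\<lambda>x. (u s x - u t x) / (s - t) - u' t x)
        = norm ((cls (u s) - cls (u t)) /\<^sub>R (s - t) - cls (u' t))"
      by (simp add: eventually_at_filter)
  qed
  have 2: "((\<lambda>s. L2_norm 0 1 (\<lambda>x. u' s x - u' t x)) \<longlongrightarrow> 0) (at t within {0..T})
      \<longleftrightarrow> ((\<lambda>s. cls (u' s)) \<longlongrightarrow> cls (u' t)) (at t within {0..T})"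
    if L: "\<forall>t\<in>{0..T}. u t \<in> L2 0 1 \<and> u' t \<in> L2 0 1" and t: "t \<in> {0..T}" for t
    by (rule tendsto_norm_diff_iff) (use L t in \<open>simp add: eventually_at_filter norm_cls_diff\<close>)
  show ?thesis
  proof (cases "\<forall>t\<in>{0..T}. u t \<in> L2 0 1 \<and> u' t \<in> L2 0 1")
    case True
    have "(\<forall>t\<in>{0..T}. ((\<lambda>s. L2_norm 0 1 (\<lambda>x. (u s x - u t x) / (s - t) - u' t x)) \<longlongrightarrow> 0) (at t within {0..T}))
        \<longleftrightarrow> (\<forall>t\<in>{0..T}. ((\<lambda>t. cls (u t)) has_vector_derivative cls (u' t)) (at t within {0..T}))"
      by (intro ball_cong refl 1[OF True])
    moreover have "(\<forall>t\<in>{0..T}. ((\<lambda>s. L2_norm 0 1 (\<lambda>x. u' s x - u' t x)) \<longlongrightarrow> 0) (at t within {0..T}))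
        \<longleftrightarrow> continuous_on {0..T} (\<lambda>t. cls (u' t))"
      unfolding continuous_on_def by (intro ball_cong refl 2[OF True])
    ultimately show ?thesis unfolding C1_in_L2_def by blast
  next
    case False
    then show ?thesis unfolding C1_in_L2_def by blast
  qed
qed

text \<open>The trace densities \<open>d0\<close> and \<open>d1\<close> are parameters and not
  \<open>weak_deriv 0 T\<close>: the latter is chosen anew for each T, whereas restriction and
  exhaustion of the time interval need densities that can be carried from one interval to
  another.\<close>

locale wave_path =
  fixes T :: real and u u' :: "real \<Rightarrow> real \<Rightarrow> real" and d0 d1 :: "real \<Rightarrow> real"
  assumes T_pos: "0 < T"
    and u_H1: "\<And>t. t \<in> {0..T} \<Longrightarrow> u t \<in> H1 0 1"
    and u'_L2: "\<And>t. t \<in> {0..T} \<Longrightarrow> u' t \<in> L2 0 1"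
    and pair_continuous: "continuous_on {0..T} (\<lambda>t. H1_pair (u t))"
    and u'_continuous: "continuous_on {0..T} (\<lambda>t. cls (u' t))"
    and u_deriv: "\<And>t. t \<in> {0..T} \<Longrightarrow> ((\<lambda>t. cls (u t)) has_vector_derivative cls (u' t)) (at t within {0..T})"
    and trace0: "L2_primitive 0 T (\<lambda>t. u t 0) d0"
    and trace1: "L2_primitive 0 T (\<lambda>t. u t 1) d1"
begin

lemma pair_bounded: "\<exists>M\<ge>0. \<forall>t\<in>{0..T}. norm (H1_pair (u t)) \<le> M"
  by (rule continuous_on_Icc_bounded[OF pair_continuous])

lemma u_continuous: "continuous_on {0..T} (\<lambda>t. cls (u t))"
  unfolding continuous_on_eq_continuous_within by (auto intro!: has_vector_derivative_continuous[OF u_deriv])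

lemma force_continuous:
  assumes r: "r > 2"
  shows "continuous_on {0..T} (\<lambda>t. force r (u t))"
  unfolding continuous_on_def
proof (intro ballI)
  fix t assume t: "t \<in> {0..T}"
  obtain M where M: "0 \<le> M" "\<And>t. t \<in> {0..T} \<Longrightarrow> norm (H1_pair (u t)) \<le> M" using pair_bounded by blast
  have "((\<lambda>s. force_Lipschitz r (2 * M) * norm (cls (u s) - cls (u t))) \<longlongrightarrow> force_Lipschitz r (2 * M) * norm (cls (u t) - cls (u t))) (at t within {0..T})"
    by (intro tendsto_intros) (use u_continuous t in \<open>auto simp: continuous_on_def\<close>)
  then have "((\<lambda>s. force_Lipschitz r (2 * M) * norm (cls (u s) - cls (u t))) \<longlongrightarrow> 0) (at t within {0..T})" by simp
  moreover have "\<forall>\<^sub>F s in at t within {0..T}. norm (force r (u s) - force r (u t)) \<le> force_Lipschitz r (2 * M) * norm (cls (u s) - cls (u t))"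
    using force_Lipschitz_H1[OF r u_H1 M(2) u_H1 M(2)] t by (simp add: eventually_at_filter)
  ultimately have "((\<lambda>s. force r (u s) - force r (u t)) \<longlongrightarrow> 0) (at t within {0..T})"
    by (rule Lim_null_comparison[rotated])
  then show "((\<lambda>t. force r (u t)) \<longlongrightarrow> force r (u t)) (at t within {0..T})" by (rule Lim_null[THEN iffD2])
qed

lemmas trace_continuous = L2_primitive_continuous[OF trace0] L2_primitive_continuous[OF trace1]

lemma trace_force_continuous:
  assumes "r > 2"
  shows "continuous_on {0..T} (\<lambda>t. power_force r (u t 0))" "continuous_on {0..T} (\<lambda>t. power_force r (u t 1))"
  by (rule continuous_on_compose2[OF power_force_continuous[OF assms, of UNIV]], rule trace_continuous, simp)+

end

text \<open>Everything in the weak equation except the time derivative of <u', v>, brought to one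
  side; its negative is therefore the density of t -> <u'(t), v>.\<close>

definition residual where
  "residual p \<alpha> \<beta> lam lam0 lam1 lamt ht u u' d0 d1 v t =
     inner (H1_pair (u t)) (H1_pair v) + lam * inner (cls (u' t)) (cls v)
     + (lam0 * d0 t + ht * u t 1 + lamt * d1 t - power_force \<alpha> (u t 0)) * v 0
     + (lam1 * d1 t + ht * u t 0 + lamt * d0 t - power_force \<beta> (u t 1)) * v 1
     - inner (force p (u t)) (cls v)"
  for d0 d1 v :: "real \<Rightarrow> real" and u u' :: "real \<Rightarrow> real \<Rightarrow> real"

locale wave_solution = wave_path +
  fixes p \<alpha> \<beta> lam lam0 lam1 lamt ht :: real
  assumes p: "p > 2" and \<alpha>: "\<alpha> > 2" and \<beta>: "\<beta> > 2"
    and equation: "\<And>v. v \<in> H1 0 1 \<Longrightarrow>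
      L2_primitive 0 T (\<lambda>t. inner (cls (u' t)) (cls v)) (\<lambda>t. - residual p \<alpha> \<beta> lam lam0 lam1 lamt ht u u' d0 d1 v t)"

context wave_path
begin

lemma residual_L2:
  assumes p: "p > 2" and \<alpha>: "\<alpha> > 2" and \<beta>: "\<beta> > 2"
  shows "residual p \<alpha> \<beta> lam lam0 lam1 lamt ht u u' d0 d1 v \<in> L2 0 T"
proof -
  note b = L2_continuous[OF trace_continuous(1)] L2_continuous[OF trace_continuous(2)]
    L2_continuous[OF trace_force_continuous(1)[OF \<alpha>]] L2_continuous[OF trace_force_continuous(2)[OF \<beta>]]
  note d = L2_primitiveD(1)[OF trace0] L2_primitiveD(1)[OF trace1]
  have "continuous_on {0..T} (\<lambda>t. inner (H1_pair (u t)) (H1_pair v))" "continuous_on {0..T} (\<lambda>t. inner (cls (u' t)) (cls v))"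
    "continuous_on {0..T} (\<lambda>t. inner (force p (u t)) (cls v))"
    by (intro continuous_intros pair_continuous u'_continuous force_continuous p)+
  note c = this[THEN L2_continuous]
  show ?thesis unfolding residual_def[abs_def]
    by (intro L2_add L2_diff L2_scale L2_scale_right b d c)
qed

text \<open>In distributional form the equation says that the function <u'(t), v> has a certain weak
  derivative. The function is continuous in t and the derivative square integrable, so weak
  derivatives and primitives coincide.\<close>

lemma weak_form_iff:
  assumes p: "p > 2" and \<alpha>: "\<alpha> > 2" and \<beta>: "\<beta> > 2" and v: "v \<in> H1 0 1"
  shows "(\<forall>\<phi>. test_function 0 T \<phi> \<longrightarrow>
           - (LINT t|lebesgue_on {0<..<T}. L2_inner 0 1 (u' t) v * deriv \<phi> t)
           + (LINT t|lebesgue_on {0<..<T}.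
                (L2_inner 0 1 (weak_deriv 0 1 (u t)) (weak_deriv 0 1 v)
                 + L2_inner 0 1 (u t) v
                 + lam * L2_inner 0 1 (u' t) v
                 + (lam0 * d0 t + ht * u t 1 + lamt * d1 t) * v 0
                 + (lam1 * d1 t + ht * u t 0 + lamt * d0 t) * v 1) * \<phi> t)
           = (LINT t|lebesgue_on {0<..<T}.
                (L2_inner 0 1 (\<lambda>x. \<bar>u t x\<bar> powr (p - 2) * u t x) v
                 + \<bar>u t 0\<bar> powr (\<alpha> - 2) * u t 0 * v 0
                 + \<bar>u t 1\<bar> powr (\<beta> - 2) * u t 1 * v 1) * \<phi> t))
     \<longleftrightarrow> L2_primitive 0 T (\<lambda>t. inner (cls (u' t)) (cls v)) (\<lambda>t. - residual p \<alpha> \<beta> lam lam0 lam1 lamt ht u u' d0 d1 v t)"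
proof -
  define A where "A t = L2_inner 0 1 (weak_deriv 0 1 (u t)) (weak_deriv 0 1 v)
                 + L2_inner 0 1 (u t) v
                 + lam * L2_inner 0 1 (u' t) v
                 + (lam0 * d0 t + ht * u t 1 + lamt * d1 t) * v 0
                 + (lam1 * d1 t + ht * u t 0 + lamt * d0 t) * v 1" for t
  define R where "R t = L2_inner 0 1 (\<lambda>x. \<bar>u t x\<bar> powr (p - 2) * u t x) v
                 + \<bar>u t 0\<bar> powr (\<alpha> - 2) * u t 0 * v 0
                 + \<bar>u t 1\<bar> powr (\<beta> - 2) * u t 1 * v 1" for t
  define g where "g t = inner (cls (u' t)) (cls v)" for t
  define K where "K t = residual p \<alpha> \<beta> lam lam0 lam1 lamt ht u u' d0 d1 v t" for t
  have vL2: "v \<in> L2 0 1" by (rule H1_L2[OF v])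
  have A: "A t = inner (H1_pair (u t)) (H1_pair v) + lam * inner (cls (u' t)) (cls v)
      + (lam0 * d0 t + ht * u t 1 + lamt * d1 t) * v 0 + (lam1 * d1 t + ht * u t 0 + lamt * d0 t) * v 1"
    if "t \<in> {0..T}" for t
    using that by (simp add: A_def inner_H1_pair u_H1 v inner_cls u'_L2 vL2)
  have R: "R t = inner (force p (u t)) (cls v) + power_force \<alpha> (u t 0) * v 0 + power_force \<beta> (u t 1) * v 1"
    if "t \<in> {0..T}" for t
    using that by (simp add: R_def inner_force[OF p u_H1 vL2] power_force_def)
  have K: "K t = A t - R t" if "t \<in> {0..T}" for t
    unfolding K_def residual_def A[OF that] R[OF that] by (simp add: algebra_simps)
  have g: "g t = L2_inner 0 1 (u' t) v" if "t \<in> {0..T}" for t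
    using that by (simp add: g_def inner_cls u'_L2 vL2)
  have gc: "continuous_on {0..T} g" unfolding g_def by (intro continuous_intros u'_continuous)
  have "(\<lambda>t. inner (force p (u t)) (cls v) + power_force \<alpha> (u t 0) * v 0 + power_force \<beta> (u t 1) * v 1) \<in> L2 0 T"
    by (intro L2_continuous continuous_intros force_continuous trace_force_continuous p \<alpha> \<beta>)
  then have RL2: "R \<in> L2 0 T" by (rule L2_cong) (simp add: R)
  have KL2': "K \<in> L2 0 T" using residual_L2[OF p \<alpha> \<beta>] by (simp add: K_def[abs_def])
  then have KL2: "(\<lambda>t. - K t) \<in> L2 0 T" by (rule L2_uminus)
  have AL2: "A \<in> L2 0 T" by (rule L2_cong[OF L2_add[OF KL2' RL2]]) (simp add: K)
  have "(- (LINT t|lebesgue_on {0<..<T}. L2_inner 0 1 (u' t) v * deriv \<phi> t) + (LINT t|lebesgue_on {0<..<T}. A t * \<phi> t)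
       = (LINT t|lebesgue_on {0<..<T}. R t * \<phi> t))
     \<longleftrightarrow> L2_inner 0 T g (deriv \<phi>) = - L2_inner 0 T (\<lambda>t. - K t) \<phi>" if "test_function 0 T \<phi>" for \<phi>
  proof -
    have \<phi>: "smooth \<phi>" using that by (simp add: test_function_def smooth_def)
    have \<phi>L2: "\<phi> \<in> L2 0 T" by (intro L2_continuous smooth_continuous \<phi>)
    have "(LINT t|lebesgue_on {0<..<T}. L2_inner 0 1 (u' t) v * deriv \<phi> t) = L2_inner 0 T g (deriv \<phi>)"
      unfolding L2_inner_def[of 0 T, symmetric] by (rule L2_inner_cong) (simp_all add: g)
    moreover have "L2_inner 0 T (\<lambda>t. - K t) \<phi> = L2_inner 0 T (\<lambda>t. R t - A t) \<phi>"
      by (rule L2_inner_cong) (simp_all add: K)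
    moreover have "\<dots> = L2_inner 0 T R \<phi> - L2_inner 0 T A \<phi>" by (rule L2_inner_diff_left[OF RL2 AL2 \<phi>L2])
    ultimately show ?thesis unfolding L2_inner_def[of 0 T, symmetric] by linarith
  qed
  then have "(\<forall>\<phi>. test_function 0 T \<phi> \<longrightarrow>
      - (LINT t|lebesgue_on {0<..<T}. L2_inner 0 1 (u' t) v * deriv \<phi> t) + (LINT t|lebesgue_on {0<..<T}. A t * \<phi> t)
       = (LINT t|lebesgue_on {0<..<T}. R t * \<phi> t))
     \<longleftrightarrow> has_weak_derivative 0 T g (\<lambda>t. - K t)" unfolding has_weak_derivative_def by blast
  also have "\<dots> \<longleftrightarrow> L2_primitive 0 T g (\<lambda>t. - K t)"
    using weak_derivative_imp_primitive[OF gc KL2] primitive_imp_weak_derivative by blast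
  finally show ?thesis unfolding A_def R_def g_def K_def .
qed

end

lemma weak_solution_imp_wave_solution:
  assumes "p > 2" "\<alpha> > 2" "\<beta> > 2" and weak: "weak_solution p \<alpha> \<beta> lam lam0 lam1 lamt ht u0 u1 T u u'"
  shows "\<exists>d0 d1. wave_solution T u u' d0 d1 p \<alpha> \<beta> lam lam0 lam1 lamt ht"
proof -
  let ?d0 = "weak_deriv 0 T (\<lambda>t. u t 0)" and ?d1 = "weak_deriv 0 T (\<lambda>t. u t 1)"
  have path: "wave_path T u u' ?d0 ?d1"
    using weak unfolding weak_solution_def continuous_in_H1_iff C1_in_L2_iff
    by unfold_locales (auto intro: weak_deriv_primitive)
  then interpret wave_path T u u' ?d0 ?d1 .
  have "wave_solution T u u' ?d0 ?d1 p \<alpha> \<beta> lam lam0 lam1 lamt ht"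
  proof unfold_locales
    fix v assume v: "v \<in> H1 0 1"
    show "L2_primitive 0 T (\<lambda>t. inner (cls (u' t)) (cls v)) (\<lambda>t. - residual p \<alpha> \<beta> lam lam0 lam1 lamt ht u u' ?d0 ?d1 v t)"
      using weak v unfolding weak_form_iff[OF assms(1-3) v, symmetric] weak_solution_def Let_def by blast
  qed (use assms in auto)
  then show ?thesis by blast
qed

text \<open>Two densities of the same trace agree almost everywhere, so the residual changes only on
  a null set of times.\<close>

lemma (in wave_solution) change_densities:
  assumes e0: "L2_primitive 0 T (\<lambda>t. u t 0) e0" and e1: "L2_primitive 0 T (\<lambda>t. u t 1) e1"
  shows "wave_solution T u u' e0 e1 p \<alpha> \<beta> lam lam0 lam1 lamt ht"
proof -
  interpret new: wave_path T u u' e0 e1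
    by unfold_locales (auto intro: T_pos u_H1 u'_L2 pair_continuous u'_continuous u_deriv e0 e1)
  have AE: "AE t in lebesgue_on {0<..<T}. d0 t = e0 t" "AE t in lebesgue_on {0<..<T}. d1 t = e1 t"
    by (rule L2_primitive_unique[OF T_pos trace0 e0] L2_primitive_unique[OF T_pos trace1 e1])+
  show ?thesis
  proof unfold_locales
    fix v assume v: "v \<in> H1 0 1"
    let ?r = "\<lambda>d0 d1 t. - residual p \<alpha> \<beta> lam lam0 lam1 lamt ht u u' d0 d1 v t"
    show "L2_primitive 0 T (\<lambda>t. inner (cls (u' t)) (cls v)) (?r e0 e1)"
    proof (rule L2_primitive_AE[OF equation[OF v]])
      show "?r e0 e1 \<in> L2 0 T" by (rule L2_uminus[OF new.residual_L2[OF p \<alpha> \<beta>]])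
      show "AE t in lebesgue_on {0<..<T}. ?r d0 d1 t = ?r e0 e1 t"
        using AE by eventually_elim (simp add: residual_def)
    qed
  qed (rule p \<alpha> \<beta>)+
qed

lemma (in wave_solution) weak_solution:
  assumes "\<forall>x\<in>{0..1}. u 0 x = u0 x" "AE x in lebesgue_on {0<..<1}. u' 0 x = u1 x"
  shows "weak_solution p \<alpha> \<beta> lam lam0 lam1 lamt ht u0 u1 T u u'"
proof -
  let ?d0 = "weak_deriv 0 T (\<lambda>t. u t 0)" and ?d1 = "weak_deriv 0 T (\<lambda>t. u t 1)"
  have H: "(\<lambda>t. u t 0) \<in> H1 0 T" "(\<lambda>t. u t 1) \<in> H1 0 T"
    using trace0 trace1 by (auto intro: L2_primitive_imp_H1)
  interpret weak: wave_solution T u u' ?d0 ?d1 p \<alpha> \<beta> lam lam0 lam1 lamt ht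
    by (rule change_densities[OF H[THEN weak_deriv_primitive]])
  show ?thesis
    unfolding weak_solution_def Let_def continuous_in_H1_iff C1_in_L2_iff
  proof (intro conjI ballI)
    fix v assume v: "v \<in> H1 0 1"
    from weak.equation[OF v] show "\<forall>\<phi>. test_function 0 T \<phi> \<longrightarrow>
           - (LINT t|lebesgue_on {0<..<T}. L2_inner 0 1 (u' t) v * deriv \<phi> t)
           + (LINT t|lebesgue_on {0<..<T}.
                (L2_inner 0 1 (weak_deriv 0 1 (u t)) (weak_deriv 0 1 v)
                 + L2_inner 0 1 (u t) v
                 + lam * L2_inner 0 1 (u' t) v
                 + (lam0 * ?d0 t + ht * u t 1 + lamt * ?d1 t) * v 0
                 + (lam1 * ?d1 t + ht * u t 0 + lamt * ?d0 t) * v 1) * \<phi> t)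
           = (LINT t|lebesgue_on {0<..<T}.
                (L2_inner 0 1 (\<lambda>x. \<bar>u t x\<bar> powr (p - 2) * u t x) v
                 + \<bar>u t 0\<bar> powr (\<alpha> - 2) * u t 0 * v 0
                 + \<bar>u t 1\<bar> powr (\<beta> - 2) * u t 1 * v 1) * \<phi> t)"
      by (simp only: weak.weak_form_iff[OF p \<alpha> \<beta> v])
  qed (use assms in \<open>auto intro: T_pos u_H1 u'_L2 pair_continuous u'_continuous u_deriv H H1_L2[OF u_H1]\<close>)
qed

lemma L2_primitive_scale:
  assumes "L2_primitive a b f g"
  shows "L2_primitive a b (\<lambda>t. c * f t) (\<lambda>t. c * g t)"
  using assms unfolding L2_primitive_def by (auto intro: L2_scale simp: right_diff_distrib[symmetric])

lemma L2_primitive_add: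
  assumes "L2_primitive a b f g" "L2_primitive a b f' g'"
  shows "L2_primitive a b (\<lambda>t. f t + f' t) (\<lambda>t. g t + g' t)"
  using L2_primitive_diff[OF assms(1) L2_primitive_scale[OF assms(2), of "-1"]] by simp

lemma L2_primitive_inner:
  fixes J W :: "real \<Rightarrow> 'h::real_inner"
  assumes "\<And>t. t \<in> {a..b} \<Longrightarrow> (J has_vector_derivative W t) (at t within {a..b})" "continuous_on {a..b} W"
  shows "L2_primitive a b (\<lambda>t. inner (J t) c) (\<lambda>t. inner (W t) c)"
  by (intro L2_primitive_C1 bounded_linear.has_vector_derivative[OF bounded_linear_inner_left] assms continuous_intros)

lemma L2_primitive_abs_powr:
  assumes r: "r > 2" and b: "L2_primitive 0 T b d"
  shows "L2_primitive 0 T (\<lambda>t. \<bar>b t\<bar> powr r / r) (\<lambda>t. power_force r (b t) * d t)"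
proof -
  have c: "continuous_on {0..T} b" by (rule L2_primitive_continuous[OF b])
  obtain M where M: "\<And>t. t \<in> {0..T} \<Longrightarrow> \<bar>b t\<bar> \<le> M" using continuous_on_Icc_bounded[OF c] by (metis real_norm_def)
  \<comment> \<open>The chain rule has two slots; the second is filled with the same function and
    coefficient 0.\<close>
  have "L2_primitive 0 T (\<lambda>t. \<bar>b t\<bar> powr r / r) (\<lambda>t. power_force r (b t) * d t + 0 * d t)"
  proof (rule L2_primitive_chain[OF b b, where C = "force_Lipschitz r M"])
    show "continuous_on {0..T} (\<lambda>t. power_force r (b t))"
      by (rule continuous_on_compose2[OF power_force_continuous[OF r, of UNIV] c]) simp
    fix s t assume "0 \<le> s" "s \<le> t" "t \<le> T"
    then have "\<bar>\<bar>b t\<bar> powr r / r - \<bar>b s\<bar> powr r / r - power_force r (b s) * (b t - b s)\<bar> \<le> force_Lipschitz r M * (b t - b s)\<^sup>2"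
      by (intro abs_powr_Taylor r M) auto
    also have "\<dots> \<le> force_Lipschitz r M * ((b t - b s)\<^sup>2 + (b t - b s)\<^sup>2)"
      by (intro mult_left_mono force_Lipschitz_nonneg r) simp
    finally show "\<bar>\<bar>b t\<bar> powr r / r - \<bar>b s\<bar> powr r / r - power_force r (b s) * (b t - b s) - 0 * (b t - b s)\<bar>
      \<le> force_Lipschitz r M * ((b t - b s)\<^sup>2 + (b t - b s)\<^sup>2)" by simp
  qed simp
  then show ?thesis by simp
qed

text \<open>Divided by t - s, the Taylor remainder is a constant times the norm of the difference
  quotient of \<open>u\<close> times the norm of its increment: a bounded factor times a vanishing
  one.\<close>

lemma (in wave_path) potential_derivative:
  assumes r: "r > 2" and s: "s \<in> {0..T}"
  shows "((\<lambda>t. inner (force r (u t)) (cls (u t)) / r) has_real_derivative inner (force r (u s)) (cls (u' s))) (at s within {0..T})"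
proof -
  obtain M where M: "0 \<le> M" "\<And>t. t \<in> {0..T} \<Longrightarrow> norm (H1_pair (u t)) \<le> M" using pair_bounded by blast
  let ?P = "\<lambda>t. inner (force r (u t)) (cls (u t)) / r" and ?U = "\<lambda>t. cls (u t)"
  let ?S = "\<lambda>t. (?U t - ?U s) /\<^sub>R (t - s)"
  define L where "L = force_Lipschitz r (2 * M)"
  have slope: "(?S \<longlongrightarrow> cls (u' s)) (at s within {0..T})"
    using u_deriv[OF s] by (simp add: has_vector_derivative_slope)
  have "((\<lambda>t. ?U t - ?U s) \<longlongrightarrow> ?U s - ?U s) (at s within {0..T})"
    by (intro tendsto_intros) (use u_continuous s in \<open>auto simp: continuous_on_def\<close>)
  then have zero: "((\<lambda>t. ?U t - ?U s) \<longlongrightarrow> 0) (at s within {0..T})" by simp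
  have "((\<lambda>t. L * (norm (?S t) * norm (?U t - ?U s))) \<longlongrightarrow> L * (norm (cls (u' s)) * norm (0::l2))) (at s within {0..T})"
    by (intro tendsto_intros slope zero)
  then have lim0: "((\<lambda>t. L * (norm (?S t) * norm (?U t - ?U s))) \<longlongrightarrow> 0) (at s within {0..T})" by simp
  have "\<forall>\<^sub>F t in at s within {0..T}. norm ((?P t - ?P s) / (t - s) - inner (force r (u s)) (?S t)) \<le> L * (norm (?S t) * norm (?U t - ?U s))"
  proof (subst eventually_at_filter, intro always_eventually allI impI)
    fix t assume t: "t \<noteq> s" "t \<in> {0..T}"
    have T: "\<bar>?P t - ?P s - inner (force r (u s)) (?U t - ?U s)\<bar> \<le> L * (norm (?U t - ?U s))\<^sup>2"
      unfolding L_def by (intro force_Taylor r u_H1 M t s)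
    have gen: "x / h - inverse h * y = (x - y) / h" for x y h :: real
      by (simp add: divide_inverse algebra_simps)
    have "(?P t - ?P s) / (t - s) - inner (force r (u s)) (?S t) = (?P t - ?P s - inner (force r (u s)) (?U t - ?U s)) / (t - s)"
      unfolding inner_scaleR_right by (rule gen)
    also have "norm \<dots> \<le> (L * (norm (?U t - ?U s))\<^sup>2) / \<bar>t - s\<bar>"
      unfolding real_norm_def abs_divide by (intro divide_right_mono T) simp
    also have "\<dots> = L * (norm (?S t) * norm (?U t - ?U s))"
      by (simp add: power2_eq_square divide_inverse mult_ac)
    finally show "norm ((?P t - ?P s) / (t - s) - inner (force r (u s)) (?S t)) \<le> L * (norm (?S t) * norm (?U t - ?U s))" .
  qed
  from Lim_null_comparison[OF this lim0]
  have "((\<lambda>t. (?P t - ?P s) / (t - s) - inner (force r (u s)) (?S t)) \<longlongrightarrow> 0) (at s within {0..T})" .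
  from tendsto_add[OF this tendsto_inner[OF tendsto_const[of "force r (u s)"] slope]]
  show ?thesis unfolding has_field_derivative_iff by simp
qed

section \<open>Energy balance and virial identity along a weak solution\<close>

context wave_solution
begin

definition pair_integral where "pair_integral t = integral {0..t} (\<lambda>s. H1_pair (u s))"
definition force_integral where "force_integral t = integral {0..t} (\<lambda>s. force p (u s))"
definition load0 where "load0 t = ht * u t 1 - power_force \<alpha> (u t 0)"
definition load1 where "load1 t = ht * u t 0 - power_force \<beta> (u t 1)"
definition load0_integral where "load0_integral t = integral {0..t} load0"
definition load1_integral where "load1_integral t = integral {0..t} load1"

lemma load_continuous: "continuous_on {0..T} load0" "continuous_on {0..T} load1"
  unfolding load0_def load1_def by (intro continuous_intros trace_continuous trace_force_continuous \<alpha> \<beta>)+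

lemma integral_derivs:
  assumes "t \<in> {0..T}"
  shows "(pair_integral has_vector_derivative H1_pair (u t)) (at t within {0..T})"
    and "(force_integral has_vector_derivative force p (u t)) (at t within {0..T})"
    and "(load0_integral has_vector_derivative load0 t) (at t within {0..T})"
    and "(load1_integral has_vector_derivative load1 t) (at t within {0..T})"
  unfolding pair_integral_def[abs_def] force_integral_def[abs_def] load0_integral_def[abs_def] load1_integral_def[abs_def]
  by (intro integral_has_vector_derivative pair_continuous force_continuous p load_continuous assms)+

lemma load_primitive: "L2_primitive 0 T load0_integral load0" "L2_primitive 0 T load1_integral load1"
  by (intro L2_primitive_C1 integral_derivs load_continuous, assumption)+

text \<open>The equation integrated over time, with every term an increment of a function defined
  everywhere. For fixed \<open>v\<close> it holds at all pairs of times without exceptional null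
  sets, so \<open>v\<close> may afterwards be chosen depending on s and t, for example as u(t) -
  u(s).\<close>

lemma increment_equation:
  assumes v: "v \<in> H1 0 1" and s: "s \<in> {0..T}" and t: "t \<in> {0..T}"
  shows "inner (cls (u' t) - cls (u' s)) (cls v) + inner (pair_integral t - pair_integral s) (H1_pair v)
      + lam * inner (cls (u t) - cls (u s)) (cls v) - inner (force_integral t - force_integral s) (cls v)
      + (lam0 * (u t 0 - u s 0) + lamt * (u t 1 - u s 1) + (load0_integral t - load0_integral s)) * v 0
      + (lam1 * (u t 1 - u s 1) + lamt * (u t 0 - u s 0) + (load1_integral t - load1_integral s)) * v 1 = 0"
proof -
  define E where "E t = inner (cls (u' t)) (cls v) + (inner (pair_integral t) (H1_pair v) + (lam * inner (cls (u t)) (cls v)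
      + (- 1 * inner (force_integral t) (cls v)
      + (v 0 * (lam0 * u t 0 + (lamt * u t 1 + load0_integral t)) + v 1 * (lam1 * u t 1 + (lamt * u t 0 + load1_integral t))))))" for t
  have "L2_primitive 0 T E (\<lambda>t. - residual p \<alpha> \<beta> lam lam0 lam1 lamt ht u u' d0 d1 v t + (inner (H1_pair (u t)) (H1_pair v) + (lam * inner (cls (u' t)) (cls v)
      + (- 1 * inner (force p (u t)) (cls v) + (v 0 * (lam0 * d0 t + (lamt * d1 t + load0 t)) + v 1 * (lam1 * d1 t + (lamt * d0 t + load1 t)))))))"
    unfolding E_def
    by (intro L2_primitive_add L2_primitive_scale L2_primitive_inner equation[OF v] integral_derivs u_deriv trace0 trace1 load_primitive
        pair_continuous force_continuous p u'_continuous; assumption)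
  then have E: "L2_primitive 0 T E (\<lambda>t. 0)"
    by (rule L2_primitive_cong) (simp_all add: residual_def load0_def load1_def algebra_simps)
  have "E t = E 0" if "t \<in> {0..T}" for t using L2_primitiveD(2)[OF E, of 0 t] that by simp
  from this[OF t] this[OF s] show ?thesis
    unfolding E_def by (simp add: inner_diff_left algebra_simps)
qed

definition dissipation where
  "dissipation t = lam0 * (d0 t)\<^sup>2 + lam1 * (d1 t)\<^sup>2 + 2 * lamt * (d0 t * d1 t)"

text \<open>Minus the usual mechanical energy, following the sign of \<open>H_initial\<close>;
  positive damping makes it grow.\<close>

definition energy where
  "energy t = - (norm (cls (u' t)))\<^sup>2 / 2 - (norm (H1_pair (u t)))\<^sup>2 / 2 + inner (force p (u t)) (cls (u t)) / p
     + \<bar>u t 0\<bar> powr \<alpha> / \<alpha> + \<bar>u t 1\<bar> powr \<beta> / \<beta> - ht * (u t 0 * u t 1)"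

lemma dissipation_integrable:
  assumes "0 \<le> s" "t \<le> T"
  shows "dissipation integrable_on {s..t}"
  unfolding dissipation_def[abs_def] power2_eq_square
  by (intro hk_integrable_add integrable_on_mult_right L2_mult_integrable_sub[where a = 0 and b = T]
      L2_primitiveD(1)[OF trace0] L2_primitiveD(1)[OF trace1] assms)

lemma speed_square_continuous: "continuous_on {0..T} (\<lambda>t. (norm (cls (u' t)))\<^sup>2)"
  by (intro continuous_intros u'_continuous)

lemma energy_balance:
  assumes t: "t \<in> {0..T}"
  shows "energy t = energy 0 + lam * integral {0..t} (\<lambda>s. (norm (cls (u' s)))\<^sup>2) + integral {0..t} dissipation"
proof (cases "t = 0")
  case True
  then show ?thesis by simp
next
  case False
  with t have t0: "0 < t" "t \<le> T" by auto
  have sub: "{0..t} \<subseteq> {0..T}" using t0 by auto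
  note cont = continuous_on_subset[OF _ sub]
  note der = has_vector_derivative_within_subset[OF _ sub]
  note prim = L2_primitive_sub[OF _ order_refl t0(2)]
  let ?U = "\<lambda>t. cls (u t)" and ?V = "\<lambda>t. cls (u' t)"
  let ?g0 = "\<lambda>t. lam0 * d0 t + (lamt * d1 t + load0 t)" and ?g1 = "\<lambda>t. lam1 * d1 t + (lamt * d0 t + load1 t)"
  have g0: "L2_primitive 0 t (\<lambda>t. lam0 * u t 0 + (lamt * u t 1 + load0_integral t)) ?g0"
    and g1: "L2_primitive 0 t (\<lambda>t. lam1 * u t 1 + (lamt * u t 0 + load1_integral t)) ?g1"
    by (intro L2_primitive_add L2_primitive_scale prim trace0 trace1 load_primitive)+
  note d = L2_primitiveD(1)[OF prim[OF trace0]] L2_primitiveD(1)[OF prim[OF trace1]]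
  \<comment> \<open>The abstract identity is applied with interior damping minus source as the
    force, and with boundary damping plus load as the boundary terms.\<close>
  have id: "(norm (?V t))\<^sup>2 / 2 + (norm (H1_pair (u t)))\<^sup>2 / 2 + integral {0..t} (\<lambda>t. inner (lam *\<^sub>R ?V t - force p (u t)) (?V t))
      + integral {0..t} (\<lambda>t. ?g0 t * d0 t) + integral {0..t} (\<lambda>t. ?g1 t * d1 t)
      = (norm (?V 0))\<^sup>2 / 2 + (norm (H1_pair (u 0)))\<^sup>2 / 2"
  proof (rule energy_identity[OF t0(1) _ _ _ _ _ _ prim[OF trace0] prim[OF trace1] g0 g1])
    show "(?U has_vector_derivative ?V r) (at r within {0..t})" if "r \<in> {0..t}" for r
      using that t0 by (intro der[OF u_deriv]) auto
    show "(pair_integral has_vector_derivative H1_pair (u r)) (at r within {0..t})" if "r \<in> {0..t}" for r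
      using that t0 by (intro der[OF integral_derivs(1)]) auto
    show "((\<lambda>r. lam *\<^sub>R ?U r - force_integral r) has_vector_derivative lam *\<^sub>R ?V r - force p (u r)) (at r within {0..t})" if "r \<in> {0..t}" for r
      using that t0 by (intro has_vector_derivative_diff bounded_linear.has_vector_derivative[OF bounded_linear_scaleR_right]
          der[OF integral_derivs(2)] der[OF u_deriv]) auto
    show "continuous_on {0..t} ?V" "continuous_on {0..t} (\<lambda>t. H1_pair (u t))" "continuous_on {0..t} (\<lambda>r. lam *\<^sub>R ?V r - force p (u r))"
      by (intro continuous_intros cont[OF u'_continuous] cont[OF pair_continuous] cont[OF force_continuous[OF p]])+
    fix r1 r2 assume r: "0 \<le> r1" "r1 \<le> r2" "r2 \<le> t"
    then have r': "r1 \<in> {0..T}" "r2 \<in> {0..T}" using t0 by auto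
    note u12 = u_H1[OF r'(1)] u_H1[OF r'(2)]
    from increment_equation[OF H1_diff[OF u12(2) u12(1)] r']
    show "inner (?V r2 - ?V r1) (?U r2 - ?U r1) + inner (pair_integral r2 - pair_integral r1) (H1_pair (u r2) - H1_pair (u r1))
       + inner (lam *\<^sub>R ?U r2 - force_integral r2 - (lam *\<^sub>R ?U r1 - force_integral r1)) (?U r2 - ?U r1)
       + ((lam0 * u r2 0 + (lamt * u r2 1 + load0_integral r2)) - (lam0 * u r1 0 + (lamt * u r1 1 + load0_integral r1))) * (u r2 0 - u r1 0)
       + ((lam1 * u r2 1 + (lamt * u r2 0 + load1_integral r2)) - (lam1 * u r1 1 + (lamt * u r1 0 + load1_integral r1))) * (u r2 1 - u r1 1) = 0"
      unfolding cls_diff[OF H1_L2[OF u12(2)] H1_L2[OF u12(1)]] H1_pair_diff[OF u12(2) u12(1)]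
      by (simp add: inner_diff_left algebra_simps)
  qed
  let ?P = "\<lambda>t. inner (force p (u t)) (?U t) / p"
  have fc: "continuous_on {0..t} (\<lambda>t. inner (force p (u t)) (?V t))"
    by (intro continuous_intros cont[OF u'_continuous] cont[OF force_continuous[OF p]])
  have "((\<lambda>t. inner (force p (u t)) (?V t)) has_integral (?P t - ?P 0)) {0..t}"
    using t0 sub has_field_derivative_subset[OF potential_derivative[OF p] sub]
    by (intro fundamental_theorem_of_calculus) (auto simp: has_real_derivative_iff_has_vector_derivative[symmetric])
  moreover have "((\<lambda>t. lam * (norm (?V t))\<^sup>2) has_integral lam * integral {0..t} (\<lambda>s. (norm (?V s))\<^sup>2)) {0..t}"
    by (intro has_integral_mult_right integrable_integral integrable_continuous_real cont[OF speed_square_continuous])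
  ultimately have "((\<lambda>t. lam * (norm (?V t))\<^sup>2 - inner (force p (u t)) (?V t)) has_integral
      lam * integral {0..t} (\<lambda>s. (norm (?V s))\<^sup>2) - (?P t - ?P 0)) {0..t}"
    by (rule has_integral_diff[rotated])
  then have F: "integral {0..t} (\<lambda>t. inner (lam *\<^sub>R ?V t - force p (u t)) (?V t)) = lam * integral {0..t} (\<lambda>s. (norm (?V s))\<^sup>2) - (?P t - ?P 0)"
    by (simp add: inner_diff_left power2_norm_eq_inner integral_unique)
  \<comment> \<open>The potential of the two boundary loads. It exists because the coupling is
    symmetric: the same \<open>ht\<close> acts at both ends.\<close>
  define Y where "Y t = ht * (u t 0 * u t 1) - (\<bar>u t 0\<bar> powr \<alpha> / \<alpha> + \<bar>u t 1\<bar> powr \<beta> / \<beta>)" for t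
  have Yp: "L2_primitive 0 T Y (\<lambda>t. ht * (u t 1 * d0 t + u t 0 * d1 t) - (power_force \<alpha> (u t 0) * d0 t + power_force \<beta> (u t 1) * d1 t))"
    unfolding Y_def by (intro L2_primitive_diff L2_primitive_add L2_primitive_scale L2_primitive_mult[OF trace0 trace1] L2_primitive_abs_powr \<alpha> \<beta> trace0 trace1)
  let ?y = "\<lambda>t. ht * (u t 1 * d0 t + u t 0 * d1 t) - (power_force \<alpha> (u t 0) * d0 t + power_force \<beta> (u t 1) * d1 t)"
  have "integral {0..t} (\<lambda>t. ?g0 t * d0 t) + integral {0..t} (\<lambda>t. ?g1 t * d1 t) = integral {0..t} (\<lambda>t. ?g0 t * d0 t + ?g1 t * d1 t)"
    by (intro hk_integral_add[symmetric] L2_mult_integrable_on L2_primitiveD(1)[OF g0] L2_primitiveD(1)[OF g1] d)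
  also have "\<dots> = integral {0..t} (\<lambda>t. dissipation t + ?y t)"
    by (rule hk_integral_cong) (simp add: dissipation_def load0_def load1_def power2_eq_square algebra_simps)
  also have "\<dots> = integral {0..t} dissipation + integral {0..t} ?y"
    by (intro hk_integral_add dissipation_integrable L2_integrable_sub[OF L2_primitiveD(1)[OF Yp]]) (use t0 in auto)
  also have "integral {0..t} ?y = Y t - Y 0" using L2_primitiveD(2)[OF Yp, of 0 t] t0 by simp
  finally show ?thesis using id unfolding F energy_def Y_def by simp
qed

lemma virial:
  assumes s: "s \<in> {0..T}"
  shows "((\<lambda>t. inner (cls (u' t)) (cls (u t)) + lam / 2 * (norm (cls (u t)))\<^sup>2 + lam0 / 2 * (u t 0)\<^sup>2 + lam1 / 2 * (u t 1)\<^sup>2 + lamt * u t 0 * u t 1)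
     has_real_derivative (norm (cls (u' s)))\<^sup>2 - (norm (H1_pair (u s)))\<^sup>2 + inner (force p (u s)) (cls (u s))
       + \<bar>u s 0\<bar> powr \<alpha> + \<bar>u s 1\<bar> powr \<beta> - 2 * (ht * (u s 0 * u s 1))) (at s within {0..T})"
proof -
  have "((\<lambda>t. inner (cls (u' t)) (cls (u t)) + lam / 2 * (norm (cls (u t)))\<^sup>2 + lam0 / 2 * (u t 0)\<^sup>2 + lam1 / 2 * (u t 1)\<^sup>2 + lamt * u t 0 * u t 1)
     has_real_derivative (norm (cls (u' s)))\<^sup>2 - (norm (H1_pair (u s)))\<^sup>2 + inner (force p (u s)) (cls (u s))
       - load0 s * u s 0 - load1 s * u s 1) (at s within {0..T})"
    by (rule virial_identity[where U = "\<lambda>t. cls (u t)" and U' = "\<lambda>t. cls (u' t)" and W = "\<lambda>t. H1_pair (u t)"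
          and N = "\<lambda>t. force p (u t)" and ?k0.0 = load0 and ?k1.0 = load1, OF s u_deriv[OF s] u'_continuous integral_derivs(1,2)[OF s] trace0 trace1 integral_derivs(3,4)[OF s]])
      (use increment_equation[OF u_H1[OF s] s] in blast)
  moreover have "- load0 s * u s 0 - load1 s * u s 1 = \<bar>u s 0\<bar> powr \<alpha> + \<bar>u s 1\<bar> powr \<beta> - 2 * (ht * (u s 0 * u s 1))"
    unfolding load0_def load1_def power_force_mult[symmetric] by (simp add: algebra_simps)
  ultimately show ?thesis by (simp add: algebra_simps)
qed

end

section \<open>Finite lifespan\<close>

lemma norm_add_scaleR_square:
  fixes x y :: "'a::real_inner"
  shows "(norm (x + \<theta> *\<^sub>R y))\<^sup>2 = (norm x)\<^sup>2 + 2 * \<theta> * inner y x + \<theta>\<^sup>2 * (norm y)\<^sup>2"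
  unfolding power2_norm_eq_inner
  by (simp add: inner_add_left inner_add_right inner_commute power2_eq_square algebra_simps)

text \<open>With k = |lamt| / sqrt (lam0 lam1) < 1, the arithmetic-geometric mean inequality bounds
  the mixed term by k times the diagonal part. The fraction 1 - k of the diagonal survives.\<close>

lemma damping_coercive:
  fixes lam0 lam1 lamt :: real
  assumes "lam0 > 0" "lam1 > 0" "\<bar>lamt\<bar> < sqrt (lam0 * lam1)"
  shows "\<exists>c>0. \<forall>x y. c * (x\<^sup>2 + y\<^sup>2) \<le> lam0 * x\<^sup>2 + lam1 * y\<^sup>2 + 2 * lamt * (x * y)"
proof -
  define a where "a = sqrt lam0"
  define b where "b = sqrt lam1"
  have ab: "a > 0" "b > 0" "lam0 = a\<^sup>2" "lam1 = b\<^sup>2" using assms by (auto simp: a_def b_def)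
  have lt: "\<bar>lamt\<bar> < a * b" using assms by (simp add: a_def b_def real_sqrt_mult)
  define k where "k = \<bar>lamt\<bar> / (a * b)"
  have k: "0 \<le> k" "k < 1" "\<bar>lamt\<bar> = k * (a * b)" using ab lt by (auto simp: k_def)
  define c where "c = (1 - k) * min lam0 lam1"
  have "c * (x\<^sup>2 + y\<^sup>2) \<le> lam0 * x\<^sup>2 + lam1 * y\<^sup>2 + 2 * lamt * (x * y)" for x y
  proof -
    have "min lam0 lam1 * x\<^sup>2 \<le> lam0 * x\<^sup>2" "min lam0 lam1 * y\<^sup>2 \<le> lam1 * y\<^sup>2" by (auto intro: mult_right_mono)
    then have "(1 - k) * (min lam0 lam1 * x\<^sup>2 + min lam0 lam1 * y\<^sup>2) \<le> (1 - k) * (lam0 * x\<^sup>2 + lam1 * y\<^sup>2)"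
      using k by (intro mult_left_mono add_mono) auto
    then have 1: "c * (x\<^sup>2 + y\<^sup>2) \<le> (1 - k) * (lam0 * x\<^sup>2 + lam1 * y\<^sup>2)" by (simp add: c_def algebra_simps)
    have "0 \<le> (a * \<bar>x\<bar> - b * \<bar>y\<bar>)\<^sup>2" by simp
    then have "2 * ((a * b) * (\<bar>x\<bar> * \<bar>y\<bar>)) \<le> lam0 * x\<^sup>2 + lam1 * y\<^sup>2"
      unfolding ab(3,4) power2_diff by (simp add: power_mult_distrib algebra_simps)
    then have "k * (2 * ((a * b) * (\<bar>x\<bar> * \<bar>y\<bar>))) \<le> k * (lam0 * x\<^sup>2 + lam1 * y\<^sup>2)" using k(1) by (rule mult_left_mono)
    moreover have "k * (2 * ((a * b) * (\<bar>x\<bar> * \<bar>y\<bar>))) = \<bar>2 * lamt * (x * y)\<bar>"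
      unfolding abs_mult k(3) by simp
    ultimately have "- (k * (lam0 * x\<^sup>2 + lam1 * y\<^sup>2)) \<le> 2 * lamt * (x * y)" by linarith
    then show ?thesis using 1 by (simp add: algebra_simps)
  qed
  moreover have "c > 0" unfolding c_def using k assms by simp
  ultimately show ?thesis by blast
qed

lemma damping_nonneg:
  fixes lam0 lam1 lamt :: real
  assumes "lam0 > 0" "lam1 > 0" "\<bar>lamt\<bar> < sqrt (lam0 * lam1)"
  shows "0 \<le> lam0 * x\<^sup>2 + lam1 * y\<^sup>2 + 2 * lamt * (x * y)"
proof -
  obtain c where "c > 0" "c * (x\<^sup>2 + y\<^sup>2) \<le> lam0 * x\<^sup>2 + lam1 * y\<^sup>2 + 2 * lamt * (x * y)"
    using damping_coercive[OF assms] by blast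
  moreover have "0 \<le> c * (x\<^sup>2 + y\<^sup>2)" using \<open>c > 0\<close> by simp
  ultimately show ?thesis by linarith
qed

lemma DERIV_within_Icc_at:
  assumes "(f has_real_derivative D) (at x within {a..b})" "a < x" "x < b"
  shows "(f has_real_derivative D) (at x)"
  using assms by (simp add: at_within_Icc_at)

text \<open>The hypothesis says that \<open>\<Psi>\<close> to the power -\<gamma> is concave. In
  terms of \<Psi>/\<Psi>', whose derivative is 1 - \<Psi> \<Psi>''/\<Psi>'^2 \<le> -\<gamma>, this
  becomes a monotonicity without powers: \<Psi>/\<Psi>' + \<gamma> t does not increase, and
  \<Psi>/\<Psi>' is still positive at T.\<close>

lemma concavity_time_bound:
  fixes \<Psi> \<Psi>' \<Psi>'' :: "real \<Rightarrow> real"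
  assumes T: "0 < T" and "0 < \<gamma>"
    and d1: "\<And>t. t \<in> {0..T} \<Longrightarrow> (\<Psi> has_real_derivative \<Psi>' t) (at t within {0..T})"
    and d2: "\<And>t. t \<in> {0..T} \<Longrightarrow> (\<Psi>' has_real_derivative \<Psi>'' t) (at t within {0..T})"
    and pos: "\<And>t. t \<in> {0..T} \<Longrightarrow> 0 < \<Psi> t" and init: "0 < \<Psi>' 0"
    and conc: "\<And>t. t \<in> {0..T} \<Longrightarrow> (1 + \<gamma>) * (\<Psi>' t)\<^sup>2 \<le> \<Psi> t * \<Psi>'' t"
  shows "\<gamma> * T * \<Psi>' 0 < \<Psi> 0"
proof -
  have c1: "continuous_on {0..T} \<Psi>" and c2: "continuous_on {0..T} \<Psi>'"
    by (rule DERIV_continuous_on[OF d1], simp, rule DERIV_continuous_on[OF d2], simp)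
  have nn: "0 \<le> \<Psi>'' t" if "t \<in> {0..T}" for t
  proof -
    have "0 \<le> (1 + \<gamma>) * (\<Psi>' t)\<^sup>2" using \<open>0 < \<gamma>\<close> by simp
    then show ?thesis using conc[OF that] pos[OF that] by (smt (verit) mult_pos_neg)
  qed
  have inc: "0 < \<Psi>' t" if "t \<in> {0..T}" for t
  proof (cases "t = 0")
    case False
    have "\<Psi>' 0 \<le> \<Psi>' t"
    proof (rule DERIV_nonneg_imp_increasing_open[of 0 t \<Psi>'])
      fix x assume "0 < x" "x < t"
      then show "\<exists>y. (\<Psi>' has_real_derivative y) (at x) \<and> 0 \<le> y"
        using that d2[of x] nn[of x] by (intro exI[of _ "\<Psi>'' x"] conjI DERIV_within_Icc_at[of _ _ _ 0 T]) auto
    qed (use that in \<open>auto intro: continuous_on_subset[OF c2]\<close>)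
    then show ?thesis using init by simp
  qed (use init in simp)
  define Z where "Z t = \<Psi> t / \<Psi>' t + \<gamma> * t" for t
  have "Z T \<le> Z 0"
  proof (rule DERIV_nonpos_imp_decreasing_open[of 0 T Z])
    show "continuous_on {0..T} Z"
      unfolding Z_def using inc by (intro continuous_intros c1 c2) (auto simp: less_le)
    fix x assume x: "0 < x" "x < T"
    have "(Z has_real_derivative (\<Psi>' x * \<Psi>' x - \<Psi> x * \<Psi>'' x) / (\<Psi>' x * \<Psi>' x) + \<gamma>) (at x)"
      unfolding Z_def using x inc[of x] DERIV_within_Icc_at[OF d1] DERIV_within_Icc_at[OF d2]
      by (auto intro!: derivative_eq_intros)
    moreover have "(\<Psi>' x * \<Psi>' x - \<Psi> x * \<Psi>'' x) / (\<Psi>' x * \<Psi>' x) + \<gamma> \<le> 0"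
      using conc[of x] inc[of x] x by (simp add: divide_simps power2_eq_square algebra_simps)
    ultimately show "\<exists>y. (Z has_real_derivative y) (at x) \<and> y \<le> 0" by blast
  qed (use T in simp)
  moreover have "0 < \<Psi> T / \<Psi>' T" using pos[of T] inc[of T] T by simp
  ultimately have "\<gamma> * T < \<Psi> 0 / \<Psi>' 0" by (simp add: Z_def)
  then show ?thesis using init by (simp add: field_simps)
qed

context wave_solution
begin

definition damping_form where
  "damping_form t = lam * (norm (cls (u t)))\<^sup>2 + lam0 * (u t 0)\<^sup>2 + lam1 * (u t 1)\<^sup>2 + 2 * lamt * (u t 0 * u t 1)"

definition dissipated where
  "dissipated t = lam * integral {0..t} (\<lambda>s. (norm (cls (u' s)))\<^sup>2) + integral {0..t} dissipation"

text \<open>Twice the polar form of the damping at displacement and velocity, with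
  \<open>d0\<close>, \<open>d1\<close> as boundary velocities; it is the middle coefficient when the
  damping form is expanded at u + \<theta> u'.\<close>

definition damping_density where
  "damping_density t = 2 * (lam * inner (cls (u' t)) (cls (u t))) + (lam0 * (2 * (u t 0 * d0 t)) + (lam1 * (2 * (u t 1 * d1 t))
     + 2 * lamt * (u t 1 * d0 t + u t 0 * d1 t)))"

lemma damping_form_primitive: "L2_primitive 0 T damping_form damping_density"
proof -
  have "L2_primitive 0 T (\<lambda>t. inner (cls (u t)) (cls (u t))) (\<lambda>t. inner (cls (u t)) (cls (u' t)) + inner (cls (u' t)) (cls (u t)))"
    by (intro L2_primitive_C1 bounded_bilinear.has_vector_derivative[OF bounded_bilinear_inner] u_deriv continuous_intros u_continuous u'_continuous)
  then have "L2_primitive 0 T (\<lambda>t. lam * inner (cls (u t)) (cls (u t)) + (lam0 * (u t 0)\<^sup>2 + (lam1 * (u t 1)\<^sup>2 + 2 * lamt * (u t 0 * u t 1))))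
      (\<lambda>t. lam * (inner (cls (u t)) (cls (u' t)) + inner (cls (u' t)) (cls (u t))) + (lam0 * (2 * (u t 0 * d0 t)) + (lam1 * (2 * (u t 1 * d1 t))
     + 2 * lamt * (u t 1 * d0 t + u t 0 * d1 t))))"
    by (intro L2_primitive_add L2_primitive_scale L2_primitive_square L2_primitive_mult trace0 trace1)
  then show ?thesis
    by (rule L2_primitive_cong) (simp_all add: damping_form_def damping_density_def power2_norm_eq_inner inner_commute)
qed

lemma damping_form_continuous: "continuous_on {0..T} damping_form"
  by (rule L2_primitive_continuous[OF damping_form_primitive])

end

locale damped_wave_solution = wave_solution +
  assumes lam: "lam > 0" and lam0: "lam0 > 0" and lam1: "lam1 > 0" and lamt: "\<bar>lamt\<bar> < sqrt (lam0 * lam1)"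
begin

lemma damping_form_nonneg: "0 \<le> damping_form t"
proof -
  have "0 \<le> lam * (norm (cls (u t)))\<^sup>2" using lam by simp
  then show ?thesis
    using damping_nonneg[OF lam0 lam1 lamt, of "u t 0" "u t 1"] unfolding damping_form_def by linarith
qed

text \<open>The integrand is the damping form at u + \<theta> u', nonnegative for every \<theta>.
  The inequality is left as a quadratic in \<theta> so that it can be added to others before a
  discriminant is taken.\<close>

lemma dissipated_quadratic:
  assumes t: "t \<in> {0..T}"
  shows "0 \<le> integral {0..t} damping_form + \<theta> * (damping_form t - damping_form 0) + \<theta>\<^sup>2 * dissipated t"
proof -
  have t': "0 \<le> t" "t \<le> T" using t by auto
  have sub: "{0..t} \<subseteq> {0..T}" using t by auto
  have i1: "(damping_form has_integral integral {0..t} damping_form) {0..t}"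
    by (intro integrable_integral integrable_continuous_real continuous_on_subset[OF damping_form_continuous sub])
  have i2: "(damping_density has_integral (damping_form t - damping_form 0)) {0..t}"
    unfolding L2_primitiveD(2)[OF damping_form_primitive order_refl t']
    by (intro integrable_integral L2_integrable_sub[OF L2_primitiveD(1)[OF damping_form_primitive]] t') simp
  have i3: "((\<lambda>s. lam * (norm (cls (u' s)))\<^sup>2 + dissipation s) has_integral dissipated t) {0..t}"
    unfolding dissipated_def
    by (intro has_integral_add has_integral_mult_right integrable_integral integrable_continuous_real
        continuous_on_subset[OF speed_square_continuous sub] dissipation_integrable t') simp
  have "((\<lambda>s. damping_form s + \<theta> * damping_density s + \<theta>\<^sup>2 * (lam * (norm (cls (u' s)))\<^sup>2 + dissipation s)) has_integral
      (integral {0..t} damping_form + \<theta> * (damping_form t - damping_form 0) + \<theta>\<^sup>2 * dissipated t)) {0..t}"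
    by (intro has_integral_add has_integral_mult_right i1 i2 i3)
  then show ?thesis
  proof (rule has_integral_nonneg)
    fix s
    have "damping_form s + \<theta> * damping_density s + \<theta>\<^sup>2 * (lam * (norm (cls (u' s)))\<^sup>2 + dissipation s)
        = lam * (norm (cls (u s) + \<theta> *\<^sub>R cls (u' s)))\<^sup>2
        + (lam0 * (u s 0 + \<theta> * d0 s)\<^sup>2 + lam1 * (u s 1 + \<theta> * d1 s)\<^sup>2 + 2 * lamt * ((u s 0 + \<theta> * d0 s) * (u s 1 + \<theta> * d1 s)))"
      unfolding damping_form_def damping_density_def dissipation_def norm_add_scaleR_square
      by (simp add: power2_sum power_mult_distrib algebra_simps) (simp add: power2_eq_square)
    also have "\<dots> \<ge> 0"
      by (intro add_nonneg_nonneg damping_nonneg lam0 lam1 lamt mult_nonneg_nonneg) (use lam in auto)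
    finally show "0 \<le> damping_form s + \<theta> * damping_density s + \<theta>\<^sup>2 * (lam * (norm (cls (u' s)))\<^sup>2 + dissipation s)" .
  qed
qed

lemma dissipated_nonneg: "t \<in> {0..T} \<Longrightarrow> 0 \<le> dissipated t"
  unfolding dissipated_def
  by (intro add_nonneg_nonneg mult_nonneg_nonneg integral_nonneg integrable_continuous_real dissipation_integrable
      continuous_on_subset[OF speed_square_continuous])
    (use lam damping_nonneg[OF lam0 lam1 lamt] in \<open>auto simp: dissipation_def\<close>)

text \<open>After subtraction of q times the energy, the sources keep nonnegative coefficients 1 -
  q/p and so on, and there remains (q - 2) (w/2 + ht u(0) u(1)) with w the squared H^1 norm. The
  trace bound gives |u(0) u(1)| \<le> 2 w, so |ht| \<le> 1/4 makes this nonnegative.\<close>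

lemma virial_lower_bound:
  assumes q: "2 < q" "q \<le> p" "q \<le> \<alpha>" "q \<le> \<beta>" and ht: "\<bar>ht\<bar> \<le> 1/4" and t: "t \<in> {0..T}"
  shows "(1 + q/2) * (norm (cls (u' t)))\<^sup>2 + q * energy t
    \<le> (norm (cls (u' t)))\<^sup>2 - (norm (H1_pair (u t)))\<^sup>2 + inner (force p (u t)) (cls (u t))
       + \<bar>u t 0\<bar> powr \<alpha> + \<bar>u t 1\<bar> powr \<beta> - 2 * (ht * (u t 0 * u t 1))"
proof -
  have scale: "q * (x / r) \<le> x" if "0 \<le> x" "q \<le> r" for x r :: real
  proof -
    have "q / r * x \<le> 1 * x" using that q(1) by (intro mult_right_mono) auto
    then show ?thesis by simp
  qed
  have F: "0 \<le> inner (force p (u t)) (cls (u t))"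
    unfolding force_potential[OF p u_H1[OF t]] by (intro Bochner_Integration.integral_nonneg) simp
  define w where "w = (norm (H1_pair (u t)))\<^sup>2"
  have b: "(u t 0)\<^sup>2 \<le> 2 * w" "(u t 1)\<^sup>2 \<le> 2 * w"
    using H1_sup_bound[OF u_H1[OF t], of 0] H1_sup_bound[OF u_H1[OF t], of 1] by (simp_all add: w_def norm_H1_pair u_H1[OF t])
  have "2 * \<bar>u t 0 * u t 1\<bar> \<le> (u t 0)\<^sup>2 + (u t 1)\<^sup>2"
    using zero_le_power2[of "\<bar>u t 0\<bar> - \<bar>u t 1\<bar>"] by (simp add: power2_diff abs_mult)
  then have "\<bar>u t 0 * u t 1\<bar> \<le> 2 * w" using b by linarith
  then have "\<bar>ht\<bar> * \<bar>u t 0 * u t 1\<bar> \<le> 1/4 * (2 * w)" using ht by (intro mult_mono) auto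
  then have "- (w / 2) \<le> ht * (u t 0 * u t 1)" unfolding abs_mult[symmetric] by linarith
  then have "(q - 2) * (- (w / 2)) \<le> (q - 2) * (ht * (u t 0 * u t 1))" using q by (intro mult_left_mono) auto
  moreover have "q * (inner (force p (u t)) (cls (u t)) / p) \<le> inner (force p (u t)) (cls (u t))"
    "q * (\<bar>u t 0\<bar> powr \<alpha> / \<alpha>) \<le> \<bar>u t 0\<bar> powr \<alpha>" "q * (\<bar>u t 1\<bar> powr \<beta> / \<beta>) \<le> \<bar>u t 1\<bar> powr \<beta>"
    by (intro scale F q powr_ge_zero)+
  moreover have "(q - 2) * (- (w / 2)) = w - q / 2 * w" "(q - 2) * (ht * (u t 0 * u t 1)) = q * (ht * (u t 0 * u t 1)) - 2 * (ht * (u t 0 * u t 1))"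
    "(1 + q/2) * (norm (cls (u' t)))\<^sup>2 = (norm (cls (u' t)))\<^sup>2 + q/2 * (norm (cls (u' t)))\<^sup>2"
    by (simp_all add: field_simps)
  moreover have "q * energy t = - (q/2 * (norm (cls (u' t)))\<^sup>2) - q/2 * w + q * (inner (force p (u t)) (cls (u t)) / p)
      + q * (\<bar>u t 0\<bar> powr \<alpha> / \<alpha>) + q * (\<bar>u t 1\<bar> powr \<beta> / \<beta>) - q * (ht * (u t 0 * u t 1))"
    unfolding energy_def w_def by (simp add: algebra_simps)
  ultimately show ?thesis unfolding w_def[symmetric] by linarith
qed

text \<open>Levine's concavity argument: with \<open>\<Psi>\<close> below, \<open>\<Psi> / \<Psi>'\<close> decreases at least at rate \<open>(q - 2) / 4\<close>.
  The term \<open>(T - t) * damping_form 0\<close> cancels the constant that the damping contributes to \<open>\<Psi>'\<close>.\<close>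

lemma lifespan_bound:
  assumes q: "2 < q" "q \<le> p" "q \<le> \<alpha>" "q \<le> \<beta>" and ht: "\<bar>ht\<bar> \<le> 1/4" and H0: "0 < energy 0"
    and b: "0 < b" "b \<le> 2 * energy 0" and \<tau>: "0 < \<tau>" "0 < inner (cls (u' 0)) (cls (u 0)) + b * \<tau>"
  shows "(q - 2) / 4 * T * (2 * (inner (cls (u' 0)) (cls (u 0)) + b * \<tau>))
    < (norm (cls (u 0)))\<^sup>2 + T * damping_form 0 + b * \<tau>\<^sup>2"
proof -
  define \<Phi> where "\<Phi> t = inner (cls (u' t)) (cls (u t)) + lam / 2 * (norm (cls (u t)))\<^sup>2 + lam0 / 2 * (u t 0)\<^sup>2 + lam1 / 2 * (u t 1)\<^sup>2 + lamt * u t 0 * u t 1" for t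
  define D\<Phi> where "D\<Phi> s = (norm (cls (u' s)))\<^sup>2 - (norm (H1_pair (u s)))\<^sup>2 + inner (force p (u s)) (cls (u s))
       + \<bar>u s 0\<bar> powr \<alpha> + \<bar>u s 1\<bar> powr \<beta> - 2 * (ht * (u s 0 * u s 1))" for s
  have \<Phi>: "\<Phi> t = inner (cls (u' t)) (cls (u t)) + damping_form t / 2" for t
    by (simp add: \<Phi>_def damping_form_def)
  define \<Psi> where "\<Psi> t = (norm (cls (u t)))\<^sup>2 + integral {0..t} damping_form + (T - t) * damping_form 0 + b * (t + \<tau>)\<^sup>2" for t
  define \<Psi>' where "\<Psi>' t = 2 * \<Phi> t - damping_form 0 + 2 * b * (t + \<tau>)" for t
  have "(q - 2) / 4 * T * \<Psi>' 0 < \<Psi> 0"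
  proof (rule concavity_time_bound[OF T_pos, where \<Psi>'' = "\<lambda>t. 2 * D\<Phi> t + 2 * b"])
    show "0 < (q - 2) / 4" using q by simp
    show "0 < \<Psi>' 0" using \<tau> by (simp add: \<Psi>'_def \<Phi>)
    fix t assume t: "t \<in> {0..T}"
    have "((\<lambda>t. inner (cls (u t)) (cls (u t))) has_real_derivative inner (cls (u t)) (cls (u' t)) + inner (cls (u' t)) (cls (u t))) (at t within {0..T})"
      unfolding has_real_derivative_iff_has_vector_derivative
      by (intro bounded_bilinear.has_vector_derivative[OF bounded_bilinear_inner] u_deriv t)
    moreover have "((\<lambda>t. integral {0..t} damping_form) has_real_derivative damping_form t) (at t within {0..T})"
      by (intro integral_has_real_derivative damping_form_continuous t)
    ultimately have "(\<Psi> has_real_derivative (inner (cls (u t)) (cls (u' t)) + inner (cls (u' t)) (cls (u t))) + damping_form t + (0 - 1) * damping_form 0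
        + b * (2 * (t + \<tau>))) (at t within {0..T})"
      unfolding \<Psi>_def power2_norm_eq_inner by (auto intro!: derivative_eq_intros)
    moreover have "(inner (cls (u t)) (cls (u' t)) + inner (cls (u' t)) (cls (u t))) + damping_form t + (0 - 1) * damping_form 0
        + b * (2 * (t + \<tau>)) = \<Psi>' t"
      by (simp add: \<Psi>'_def \<Phi> inner_commute algebra_simps)
    ultimately show "(\<Psi> has_real_derivative \<Psi>' t) (at t within {0..T})" by (simp only:)
    have "(\<Phi> has_real_derivative D\<Phi> t) (at t within {0..T})"
      using virial[OF t] unfolding \<Phi>_def[symmetric] D\<Phi>_def[symmetric] .
    then show "(\<Psi>' has_real_derivative 2 * D\<Phi> t + 2 * b) (at t within {0..T})"
      unfolding \<Psi>'_def by (auto intro!: derivative_eq_intros)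
    have iS: "0 \<le> integral {0..t} damping_form"
      by (intro integral_nonneg integrable_continuous_real continuous_on_subset[OF damping_form_continuous] damping_form_nonneg) (use t in auto)
    have TS: "0 \<le> (T - t) * damping_form 0" using t damping_form_nonneg by simp
    show "0 < \<Psi> t" unfolding \<Psi>_def using iS TS b \<tau> t by (intro add_nonneg_pos add_nonneg_nonneg) auto
    \<comment> \<open>The quantities \<Psi>, \<Psi>'/2 and \<open>R\<close> are the three
      coefficients of a single nonnegative quadratic in \<theta>.\<close>
    define R where "R = (norm (cls (u' t)))\<^sup>2 + dissipated t + b"
    have "(\<Psi>' t / 2)\<^sup>2 \<le> \<Psi> t * R"
    proof (rule quadratic_nonneg_discriminant)
      show "0 \<le> R" unfolding R_def using b dissipated_nonneg[OF t] by simp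
      fix \<theta>
      \<comment> \<open>Each summand of \<Psi> is perturbed in its own direction: u along u', the
        damping along the velocities, t + \<tau> along 1. The correction with T - t carries no
        \<theta>.\<close>
      have "0 \<le> (norm (cls (u t) + \<theta> *\<^sub>R cls (u' t)))\<^sup>2 + (integral {0..t} damping_form + \<theta> * (damping_form t - damping_form 0) + \<theta>\<^sup>2 * dissipated t)
          + (T - t) * damping_form 0 + b * (t + \<tau> + \<theta>)\<^sup>2"
        by (intro add_nonneg_nonneg[OF add_nonneg_nonneg[OF add_nonneg_nonneg[OF _ dissipated_quadratic[OF t]] TS]]) (use b in auto)
      also have "\<dots> = \<Psi> t + 2 * (\<Psi>' t / 2) * \<theta> + R * \<theta>\<^sup>2"
      proof -
        have half: "2 * (\<Psi>' t / 2) = 2 * inner (cls (u' t)) (cls (u t)) + damping_form t - damping_form 0 + 2 * b * (t + \<tau>)"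
          by (simp add: \<Psi>'_def \<Phi>)
        show ?thesis unfolding \<Psi>_def half R_def norm_add_scaleR_square
          by (simp add: power2_sum algebra_simps)
      qed
      finally show "0 \<le> \<Psi> t + 2 * (\<Psi>' t / 2) * \<theta> + R * \<theta>\<^sup>2" .
    qed
    then have "(1 + (q - 2) / 4) * (\<Psi>' t)\<^sup>2 \<le> (2 + q) * (\<Psi> t * R)"
    proof -
      assume a: "(\<Psi>' t / 2)\<^sup>2 \<le> \<Psi> t * R"
      have "(1 + (q - 2) / 4) * (\<Psi>' t)\<^sup>2 = (2 + q) * (\<Psi>' t / 2)\<^sup>2" by (simp add: power_divide field_simps)
      also have "\<dots> \<le> (2 + q) * (\<Psi> t * R)" using a q by (intro mult_left_mono) auto
      finally show ?thesis .
    qed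
    also have "\<dots> = \<Psi> t * ((2 + q) * R)" by simp
    also have "\<dots> \<le> \<Psi> t * (2 * D\<Phi> t + 2 * b)"
    proof (rule mult_left_mono)
      \<comment> \<open>Twice the virial bound contains 2 q (energy 0 + dissipated t). Here 2 q
        \<ge> q + 2 covers the dissipated part of (2 + q) R, and b \<le> 2 energy 0 covers the
        excess q b left after the 2 b supplied by the parabola.\<close>
      have "(1 + q/2) * (norm (cls (u' t)))\<^sup>2 + q * energy t \<le> D\<Phi> t"
        unfolding D\<Phi>_def by (rule virial_lower_bound[OF q ht t])
      moreover have "energy t = energy 0 + dissipated t" using energy_balance[OF t] by (simp add: dissipated_def)
      moreover have "q * b \<le> q * (2 * energy 0)" using b q by (intro mult_left_mono) auto
      moreover have "2 * dissipated t \<le> q * dissipated t" using q dissipated_nonneg[OF t] by (intro mult_right_mono) auto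
      ultimately show "(2 + q) * R \<le> 2 * D\<Phi> t + 2 * b" unfolding R_def by (simp add: algebra_simps)
    qed (use \<open>0 < \<Psi> t\<close> in simp)
    finally show "(1 + (q - 2) / 4) * (\<Psi>' t)\<^sup>2 \<le> \<Psi> t * (2 * D\<Phi> t + 2 * b)" .
  qed
  then show ?thesis by (simp add: \<Psi>_def \<Psi>'_def \<Phi> mult.assoc)
qed

end


lemma H1_pair_cong:
  assumes u: "u \<in> H1 0 1" and eq: "\<And>x. x \<in> {0..1} \<Longrightarrow> u x = v x"
  shows "v \<in> H1 0 1" "H1_pair v = H1_pair u"
proof -
  have p: "L2_primitive 0 1 v (weak_deriv 0 1 u)"
    by (rule L2_primitive_cong[OF weak_deriv_primitive[OF u]]) (use eq in auto)
  show v: "v \<in> H1 0 1" by (rule L2_primitive_imp_H1[OF p])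
  have "cls v = cls u"
    by (subst cls_eq_iff) (auto intro!: AE_I2 simp: H1_L2 u v eq)
  then show "H1_pair v = H1_pair u" by (simp only: H1_pair_AE[OF p]) (simp add: H1_pair_def)
qed

lemma (in wave_solution) energy_initial:
  assumes u0: "u0 \<in> H1 0 1" and u1: "u1 \<in> L2 0 1"
    and init0: "\<forall>x\<in>{0..1}. u 0 x = u0 x" and init1: "AE x in lebesgue_on {0<..<1}. u' 0 x = u1 x"
  shows "energy 0 = H_initial p \<alpha> \<beta> ht u0 u1"
proof -
  have 0: "0 \<in> {0..T}" using T_pos by simp
  have "cls (u' 0) = cls u1" by (simp add: cls_eq_iff u'_L2[OF 0] u1 init1)
  then have V: "norm (cls (u' 0)) = L2_norm 0 1 u1" by (simp add: norm_cls u1)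
  have "H1_pair u0 = H1_pair (u 0)" by (rule H1_pair_cong[OF u_H1[OF 0]]) (use init0 in auto)
  then have W: "norm (H1_pair (u 0)) = H1_norm 0 1 u0" using norm_H1_pair[OF u0] by simp
  have P: "inner (force p (u 0)) (cls (u 0)) = (LINT x|lebesgue_on {0<..<1}. \<bar>u0 x\<bar> powr p)"
    unfolding force_potential[OF p u_H1[OF 0]] by (intro Bochner_Integration.integral_cong) (use init0 in auto)
  show ?thesis unfolding energy_def V W P H_initial_def using init0 by simp
qed

text \<open>Both sides of the lifespan bound are affine in T. A large \<tau> makes the slope on the
  left exceed the slope \<open>S\<close> on the right by at least 1, and then the bound fails for
  large T.\<close>

lemma no_global_weak_solution:
  fixes p \<alpha> \<beta> lam lam0 lam1 lamt ht q :: real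
  assumes "p > 2" "\<alpha> > 2" "\<beta> > 2" and "lam > 0" "lam0 > 0" "lam1 > 0" "\<bar>lamt\<bar> < sqrt (lam0 * lam1)"
    and q: "q = min p (min \<alpha> \<beta>)" and ht: "\<bar>ht\<bar> \<le> 1/4"
    and u0: "u0 \<in> H1 0 1" and u1: "u1 \<in> L2 0 1" and H: "H_initial p \<alpha> \<beta> ht u0 u1 > 0"
    and weak: "\<And>T. 0 < T \<Longrightarrow> weak_solution p \<alpha> \<beta> lam lam0 lam1 lamt ht u0 u1 T u u'"
  shows False
proof -
  have q': "2 < q" "q \<le> p" "q \<le> \<alpha>" "q \<le> \<beta>" using q assms(1-3) by auto
  define A where "A = (norm (cls (u 0)))\<^sup>2"
  define S where "S = lam * (norm (cls (u 0)))\<^sup>2 + lam0 * (u 0 0)\<^sup>2 + lam1 * (u 0 1)\<^sup>2 + 2 * lamt * (u 0 0 * u 0 1)"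
  define c where "c = inner (cls (u' 0)) (cls (u 0))"
  define b where "b = H_initial p \<alpha> \<beta> ht u0 u1"
  define \<gamma> where "\<gamma> = (q - 2) / 4"
  \<comment> \<open>Chosen so that c + b \<tau> \<ge> (S + 1) / (2 \<gamma>) whatever the sign of
    \<open>c\<close>; the left side of the lifespan bound is then at least T (S + 1).\<close>
  define \<tau> where "\<tau> = (\<bar>c\<bar> + (S + 1) / (2 * \<gamma>)) / b + 1"
  \<comment> \<open>Larger than the constant part of the right side, which contradicts T (S + 1) < A
    + T S + b \<tau>^2.\<close>
  define T where "T = A + b * \<tau>\<^sup>2 + 1"
  have \<gamma>: "0 < \<gamma>" using q' by (simp add: \<gamma>_def)
  have b: "0 < b" using H by (simp add: b_def)
  have S: "0 \<le> S"
    unfolding S_def using damping_nonneg[OF assms(5-7), of "u 0 0" "u 0 1"] mult_nonneg_nonneg[of lam "(norm (cls (u 0)))\<^sup>2"] \<open>lam > 0\<close>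
    by (smt (verit) zero_le_power2)
  have \<tau>: "0 < \<tau>" unfolding \<tau>_def using \<gamma> b S by (intro add_nonneg_pos) auto
  have c\<tau>: "(S + 1) / (2 * \<gamma>) \<le> c + b * \<tau>"
  proof -
    have "b * (x / b) = x" for x using b by simp
    then have "b * \<tau> = \<bar>c\<bar> + (S + 1) / (2 * \<gamma>) + b" unfolding \<tau>_def distrib_left[of b] by simp
    then show ?thesis using b by linarith
  qed
  have T: "0 < T" unfolding T_def using b by (simp add: A_def add_nonneg_pos)
  obtain d0 d1 where sol: "wave_solution T u u' d0 d1 p \<alpha> \<beta> lam lam0 lam1 lamt ht"
    using weak_solution_imp_wave_solution[OF assms(1-3) weak[OF T]] by blast
  interpret wave_solution T u u' d0 d1 p \<alpha> \<beta> lam lam0 lam1 lamt ht by (rule sol)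
  interpret damped_wave_solution T u u' d0 d1 p \<alpha> \<beta> lam lam0 lam1 lamt ht
    by unfold_locales (use assms in auto)
  have e: "energy 0 = b"
    unfolding b_def using weak[OF T] by (intro energy_initial u0 u1) (auto simp: weak_solution_def)
  have "0 < (S + 1) / (2 * \<gamma>)" using S \<gamma> by simp
  then have "\<gamma> * T * (2 * (c + b * \<tau>)) < A + T * S + b * \<tau>\<^sup>2"
    using lifespan_bound[OF q' ht _ b _ \<tau>] b c\<tau> unfolding e A_def S_def c_def \<gamma>_def damping_form_def by simp
  moreover have "T * (S + 1) \<le> \<gamma> * T * (2 * (c + b * \<tau>))"
  proof -
    have "S + 1 = 2 * \<gamma> * ((S + 1) / (2 * \<gamma>))" using \<gamma> by simp
    also have "\<dots> \<le> 2 * \<gamma> * (c + b * \<tau>)" using c\<tau> \<gamma> by (intro mult_left_mono) auto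
    finally have "T * (S + 1) \<le> T * (2 * \<gamma> * (c + b * \<tau>))" using T by (intro mult_left_mono) auto
    then show ?thesis by (simp add: mult_ac)
  qed
  ultimately show False unfolding T_def by (simp add: algebra_simps)
qed

section \<open>Extension of bounded solutions\<close>

lemma L2_shift:
  assumes f: "f \<in> L2 a b"
  shows "(\<lambda>x. f (x + \<delta>)) \<in> L2 (a - \<delta>) (b - \<delta>)"
proof -
  let ?S = "{a - \<delta><..<b - \<delta>}"
  have image: "(\<lambda>x. x + \<delta>) ` ?S = {a<..<b}"
    by (auto simp: image_iff intro!: bexI[of _ "x - \<delta>" for x])
  have shift: "integrable (lebesgue_on ?S) (\<lambda>x. h (x + \<delta>))" if "integrable (lebesgue_on {a<..<b}) h" for h :: "real \<Rightarrow> real"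
  proof -
    have "h absolutely_integrable_on (\<lambda>x. x + \<delta>) ` ?S"
      using that unfolding image by (simp add: set_integrable_def integrable_restrict_space)
    then have "(\<lambda>x. \<bar>1\<bar> *\<^sub>R h (x + \<delta>)) absolutely_integrable_on ?S"
      by (subst absolutely_integrable_change_of_variables_real[symmetric, where h = "\<lambda>_. 1"])
        (auto intro!: derivative_eq_intros simp: inj_on_def)
    then show ?thesis by (simp add: set_integrable_def integrable_restrict_space)
  qed
  \<comment> \<open>Measurability of the translate comes with its integrability, since an L^2
    function on a bounded interval is itself integrable.\<close>
  show ?thesis unfolding L2_def
    using shift[OF L2_integrable[OF f]] shift[OF L2_square_integrable[OF f]] by auto
qed

lemma L2_primitive_shift:
  assumes "L2_primitive 0 T b d" "0 \<le> \<delta>"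
  shows "L2_primitive 0 (T - \<delta>) (\<lambda>t. b (t + \<delta>)) (\<lambda>t. d (t + \<delta>))"
  unfolding L2_primitive_def
proof (intro conjI allI impI)
  show "(\<lambda>t. d (t + \<delta>)) \<in> L2 0 (T - \<delta>)"
    by (rule L2_subinterval[OF L2_shift[OF L2_primitiveD(1)[OF assms(1)]]]) (use assms in auto)
  fix s t assume "0 \<le> s \<and> s \<le> t \<and> t \<le> T - \<delta>"
  then show "b (t + \<delta>) - b (s + \<delta>) = integral {s..t} (\<lambda>t. d (t + \<delta>))"
    using L2_primitiveD(2)[OF assms(1), of "s + \<delta>" "t + \<delta>"] assms(2) integral_shift_real_ivl[of "s + \<delta>" \<delta> "t + \<delta>" d] by simp
qed

text \<open>The function exp(-\<kappa> t) (A + \<kappa> J(t)), with J the integral of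
  \<open>E\<close>, has nonpositive derivative by the integral inequality.\<close>

lemma gronwall:
  fixes E :: "real \<Rightarrow> real"
  assumes cont: "continuous_on {0..T} E" and "0 \<le> \<kappa>"
    and le: "\<And>t. t \<in> {0..T} \<Longrightarrow> E t \<le> A + \<kappa> * integral {0..t} E" and t: "t \<in> {0..T}"
  shows "E t \<le> A * exp (\<kappa> * t)"
proof (cases "\<kappa> = 0")
  case True
  then show ?thesis using le[OF t] by simp
next
  case False
  define J where "J t = integral {0..t} E" for t
  define Z where "Z t = exp (- \<kappa> * t) * (A + \<kappa> * J t)" for t
  have J: "(J has_real_derivative E x) (at x within {0..T})" if "x \<in> {0..T}" for x
    unfolding J_def by (rule integral_has_real_derivative[OF cont that])
  have cJ: "continuous_on {0..T} J" by (rule DERIV_continuous_on[OF J]) simp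
  have "Z t \<le> Z 0"
  proof (rule DERIV_nonpos_imp_decreasing_open[of 0 t Z])
    show "continuous_on {0..t} Z"
      unfolding Z_def by (intro continuous_intros continuous_on_subset[OF cJ]) (use t in auto)
    fix x assume x: "0 < x" "x < t"
    then have "(Z has_real_derivative exp (- \<kappa> * x) * (- \<kappa>) * (A + \<kappa> * J x) + exp (- \<kappa> * x) * (\<kappa> * E x)) (at x)"
      unfolding Z_def using t DERIV_within_Icc_at[OF J[of x]] by (auto intro!: derivative_eq_intros)
    moreover have "exp (- \<kappa> * x) * (- \<kappa>) * (A + \<kappa> * J x) + exp (- \<kappa> * x) * (\<kappa> * E x) = exp (- \<kappa> * x) * \<kappa> * (E x - (A + \<kappa> * J x))"
      by (simp add: algebra_simps)
    moreover have "\<dots> \<le> 0"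
      using le[of x] x t \<open>0 \<le> \<kappa>\<close> by (intro mult_nonneg_nonpos) (auto simp: J_def)
    ultimately show "\<exists>y. (Z has_real_derivative y) (at x) \<and> y \<le> 0" by metis
  qed (use t in simp)
  then have "exp (- \<kappa> * t) * (A + \<kappa> * J t) \<le> A" by (simp add: Z_def J_def)
  then have "exp (\<kappa> * t) * (exp (- \<kappa> * t) * (A + \<kappa> * J t)) \<le> exp (\<kappa> * t) * A" by (intro mult_left_mono) auto
  then have "A + \<kappa> * J t \<le> A * exp (\<kappa> * t)" by (simp add: mult.assoc[symmetric] exp_add[symmetric] mult.commute)
  then show ?thesis using le[OF t] by (simp add: J_def)
qed

text \<open>Young's inequality by completing the square. With \<open>c\<close> the coercivity
  constant of the boundary damping, the loss c d^2 is absorbed by dissipation.\<close>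

lemma product_lower_bound:
  fixes k d c :: real
  assumes "0 < c" "k\<^sup>2 \<le> K"
  shows "- (K / (4 * c)) - c * d\<^sup>2 \<le> k * d"
proof -
  have "0 \<le> (2 * c * d + k)\<^sup>2" by simp
  also have "\<dots> = 4 * c * (c * d\<^sup>2 + k * d) + k\<^sup>2" by (simp add: power2_eq_square algebra_simps)
  finally have "0 \<le> 4 * c * (c * d\<^sup>2 + k * d) + K" using assms(2) by linarith
  then have "- (K / (4 * c)) \<le> c * d\<^sup>2 + k * d" using assms(1) by (simp add: field_simps)
  then show ?thesis by linarith
qed

section \<open>Stability of time translates\<close>

context wave_solution
begin

text \<open>The equation is autonomous, so the integrated equation at shifted times can be
  subtracted from the original one.\<close>

lemma shift_equation:
  assumes \<delta>: "0 \<le> \<delta>" and s: "s \<in> {0..T-\<delta>}" and t: "t \<in> {0..T-\<delta>}" and v: "v \<in> H1 0 1"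
  defines "\<Delta> \<equiv> \<lambda>f :: real \<Rightarrow> real. (f (t + \<delta>) - f t) - (f (s + \<delta>) - f s)"
  shows "inner ((cls (u' (t+\<delta>)) - cls (u' t)) - (cls (u' (s+\<delta>)) - cls (u' s))) (cls v)
      + inner ((pair_integral (t+\<delta>) - pair_integral t) - (pair_integral (s+\<delta>) - pair_integral s)) (H1_pair v)
      + inner ((lam *\<^sub>R (cls (u (t+\<delta>)) - cls (u t)) - (force_integral (t+\<delta>) - force_integral t))
             - (lam *\<^sub>R (cls (u (s+\<delta>)) - cls (u s)) - (force_integral (s+\<delta>) - force_integral s))) (cls v)
      + (lam0 * \<Delta> (\<lambda>t. u t 0) + lamt * \<Delta> (\<lambda>t. u t 1) + \<Delta> load0_integral) * v 0
      + (lam1 * \<Delta> (\<lambda>t. u t 1) + lamt * \<Delta> (\<lambda>t. u t 0) + \<Delta> load1_integral) * v 1 = 0"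
proof -
  have r: "s + \<delta> \<in> {0..T}" "t + \<delta> \<in> {0..T}" "s \<in> {0..T}" "t \<in> {0..T}" using s t \<delta> by auto
  show ?thesis unfolding \<Delta>_def
    using increment_equation[OF v r(1,2)] increment_equation[OF v r(3,4)]
    by (simp add: inner_diff_left algebra_simps)
qed

end

context damped_wave_solution
begin

text \<open>In the energy identity for u(t + \<delta>) - u(t) the differences of the boundary loads
  multiply boundary velocities, which the energy does not control. The coercive boundary dissipation
  absorbs the velocities and leaves squared load differences, bounded by the H^1 norm through the
  trace estimate. The constant \<open>\<kappa>\<close> depends on M, not on \<delta> or T.\<close>

lemma difference_energy_inequality:
  assumes c: "0 < c" and coercive: "\<And>x y. c * (x\<^sup>2 + y\<^sup>2) \<le> lam0 * x\<^sup>2 + lam1 * y\<^sup>2 + 2 * lamt * (x * y)"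
    and M: "\<And>t. t \<in> {0..T} \<Longrightarrow> norm (H1_pair (u t)) \<le> M"
    and \<delta>: "0 < \<delta>" "\<delta> < T"
    and E: "\<And>t. E t = (norm (cls (u' (t + \<delta>)) - cls (u' t)))\<^sup>2 + (norm (H1_pair (u (t + \<delta>)) - H1_pair (u t)))\<^sup>2"
    and \<kappa>: "\<kappa> = (force_Lipschitz p (2 * M))\<^sup>2 + 1
      + 2 * (\<bar>ht\<bar> + force_Lipschitz \<alpha> (2 * M))\<^sup>2 / c + 2 * (\<bar>ht\<bar> + force_Lipschitz \<beta> (2 * M))\<^sup>2 / c"
    and t: "t \<in> {0..T-\<delta>}"
  shows "E t \<le> E 0 + \<kappa> * integral {0..t} E"
proof (cases "t = 0")
  case True
  then show ?thesis by simp
next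
  case False
  with t \<delta> have t0: "0 < t" "t \<le> T - \<delta>" by auto
  let ?V = "\<lambda>t. cls (u' (t + \<delta>)) - cls (u' t)" and ?U = "\<lambda>t. cls (u (t + \<delta>)) - cls (u t)"
    and ?W = "\<lambda>t. H1_pair (u (t + \<delta>)) - H1_pair (u t)" and ?N = "\<lambda>t. force p (u (t + \<delta>)) - force p (u t)"
  let ?b0 = "\<lambda>t. u (t + \<delta>) 0 - u t 0" and ?b1 = "\<lambda>t. u (t + \<delta>) 1 - u t 1"
    and ?d0 = "\<lambda>t. d0 (t + \<delta>) - d0 t" and ?d1 = "\<lambda>t. d1 (t + \<delta>) - d1 t"
    and ?k0 = "\<lambda>t. load0 (t + \<delta>) - load0 t" and ?k1 = "\<lambda>t. load1 (t + \<delta>) - load1 t"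
  let ?g0 = "\<lambda>t. lam0 * ?d0 t + (lamt * ?d1 t + ?k0 t)" and ?g1 = "\<lambda>t. lam1 * ?d1 t + (lamt * ?d0 t + ?k1 t)"
  have sub: "{0..t} \<subseteq> {0..T-\<delta>}" using t0 by auto
  have cont: "continuous_on {0..t} (\<lambda>t. f (t + \<delta>) - f t)" if "continuous_on {0..T} f" for f :: "real \<Rightarrow> 'k::real_normed_vector"
    by (intro continuous_intros continuous_on_compose2[OF that] continuous_on_subset[OF that]) (use t0 \<delta> in auto)
  have der: "((\<lambda>t. f (t + \<delta>) - f t) has_vector_derivative f' (r + \<delta>) - f' r) (at r within {0..t})"
    if "\<And>t. t \<in> {0..T} \<Longrightarrow> (f has_vector_derivative f' t) (at t within {0..T})" "r \<in> {0..t}" for f f' :: "real \<Rightarrow> 'k::real_normed_vector" and r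
    by (rule has_vector_derivative_within_subset[OF shift_diff_derivative[OF that(1) \<delta>] sub]) (use that(2) t0 in auto)
  have prim: "L2_primitive 0 t (\<lambda>t. f (t + \<delta>) - f t) (\<lambda>t. f' (t + \<delta>) - f' t)" if "L2_primitive 0 T f f'" for f f'
    by (intro L2_primitive_diff L2_primitive_sub[OF L2_primitive_shift[OF that]] L2_primitive_sub[OF that]) (use t0 \<delta> in auto)
  have g0: "L2_primitive 0 t (\<lambda>t. lam0 * ?b0 t + (lamt * ?b1 t + (load0_integral (t + \<delta>) - load0_integral t))) ?g0"
    and g1: "L2_primitive 0 t (\<lambda>t. lam1 * ?b1 t + (lamt * ?b0 t + (load1_integral (t + \<delta>) - load1_integral t))) ?g1"
    by (intro L2_primitive_add L2_primitive_scale prim trace0 trace1 load_primitive)+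
  note d = L2_primitiveD(1)[OF prim[OF trace0]] L2_primitiveD(1)[OF prim[OF trace1]]
  have Vc: "continuous_on {0..t} ?V" and Wc: "continuous_on {0..t} ?W" and Nc: "continuous_on {0..t} ?N"
    by (intro cont u'_continuous pair_continuous force_continuous p)+
  have id: "(norm (?V t))\<^sup>2 / 2 + (norm (?W t))\<^sup>2 / 2 + integral {0..t} (\<lambda>t. inner (lam *\<^sub>R ?V t - ?N t) (?V t))
      + integral {0..t} (\<lambda>t. ?g0 t * ?d0 t) + integral {0..t} (\<lambda>t. ?g1 t * ?d1 t)
      = (norm (?V 0))\<^sup>2 / 2 + (norm (?W 0))\<^sup>2 / 2"
  proof (rule energy_identity[OF t0(1) _ Vc _ Wc _ _ prim[OF trace0] prim[OF trace1] g0 g1])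
    fix r assume r: "r \<in> {0..t}"
    show "(?U has_vector_derivative ?V r) (at r within {0..t})"
      by (rule der[OF u_deriv r])
    show "((\<lambda>t. pair_integral (t + \<delta>) - pair_integral t) has_vector_derivative ?W r) (at r within {0..t})"
      by (rule der[OF integral_derivs(1) r])
    show "((\<lambda>t. lam *\<^sub>R ?U t - (force_integral (t + \<delta>) - force_integral t)) has_vector_derivative lam *\<^sub>R ?V r - ?N r) (at r within {0..t})"
      by (intro has_vector_derivative_diff[OF _ der[OF integral_derivs(2) r]] bounded_linear.has_vector_derivative[OF bounded_linear_scaleR_right] der[OF u_deriv r])
  next
    show "continuous_on {0..t} (\<lambda>r. lam *\<^sub>R ?V r - ?N r)"
      by (rule continuous_on_diff[OF continuous_on_scaleR[OF continuous_on_const Vc] Nc])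
    fix r1 r2 assume r: "0 \<le> r1" "r1 \<le> r2" "r2 \<le> t"
    then have r': "r1 \<in> {0..T-\<delta>}" "r2 \<in> {0..T-\<delta>}" using t0 by auto
    have H: "u r1 \<in> H1 0 1" "u r2 \<in> H1 0 1" "u (r1 + \<delta>) \<in> H1 0 1" "u (r2 + \<delta>) \<in> H1 0 1"
      using r' \<delta> by (auto intro!: u_H1)
    note H' = H1_diff[OF H(4) H(2)] H1_diff[OF H(3) H(1)]
    note clsd = cls_diff[OF H'[THEN H1_L2]] cls_diff[OF H(4)[THEN H1_L2] H(2)[THEN H1_L2]] cls_diff[OF H(3)[THEN H1_L2] H(1)[THEN H1_L2]]
    note paird = H1_pair_diff[OF H'] H1_pair_diff[OF H(4) H(2)] H1_pair_diff[OF H(3) H(1)]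
    show "inner (?V r2 - ?V r1) (?U r2 - ?U r1)
       + inner (pair_integral (r2 + \<delta>) - pair_integral r2 - (pair_integral (r1 + \<delta>) - pair_integral r1)) (?W r2 - ?W r1)
       + inner (lam *\<^sub>R ?U r2 - (force_integral (r2 + \<delta>) - force_integral r2) - (lam *\<^sub>R ?U r1 - (force_integral (r1 + \<delta>) - force_integral r1))) (?U r2 - ?U r1)
       + ((lam0 * ?b0 r2 + (lamt * ?b1 r2 + (load0_integral (r2 + \<delta>) - load0_integral r2)))
          - (lam0 * ?b0 r1 + (lamt * ?b1 r1 + (load0_integral (r1 + \<delta>) - load0_integral r1)))) * (?b0 r2 - ?b0 r1)
       + ((lam1 * ?b1 r2 + (lamt * ?b0 r2 + (load1_integral (r2 + \<delta>) - load1_integral r2)))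
          - (lam1 * ?b1 r1 + (lamt * ?b0 r1 + (load1_integral (r1 + \<delta>) - load1_integral r1)))) * (?b1 r2 - ?b1 r1) = 0"
      using shift_equation[OF less_imp_le[OF \<delta>(1)] r' H1_diff[OF H']]
      unfolding clsd paird by (simp add: algebra_simps)
  qed
  have Ec: "continuous_on {0..t} E" unfolding E by (intro continuous_intros Vc Wc)
  have lower: "- (\<kappa> / 2) * E r \<le> inner (lam *\<^sub>R ?V r - ?N r) (?V r) + (?g0 r * ?d0 r + ?g1 r * ?d1 r)" if r: "r \<in> {0..t}" for r
  proof -
    have r': "r \<in> {0..T}" "r + \<delta> \<in> {0..T}" using r t0 \<delta> by auto
    define w where "w = norm (?W r)"
    have Ew: "E r = (norm (?V r))\<^sup>2 + w\<^sup>2" by (simp add: E w_def)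
    have "norm (fst (?W r)) \<le> w" unfolding w_def using norm_fst_le[of "fst (?W r)" "snd (?W r)"] by (simp only: prod.collapse)
    then have Uw: "norm (?U r) \<le> w" by (simp add: H1_pair_def)
    define L where "L = force_Lipschitz p (2 * M)"
    have "norm (?N r) \<le> L * norm (?U r)"
      unfolding L_def by (intro force_Lipschitz_H1 p u_H1 M r')
    also have "\<dots> \<le> L * w" using Uw p by (intro mult_left_mono) (auto simp: L_def force_Lipschitz_nonneg)
    finally have N: "norm (?N r) \<le> L * w" .
    have "inner (?N r) (?V r) \<le> norm (?N r) * norm (?V r)" by (rule norm_cauchy_schwarz)
    also have "\<dots> \<le> (L * w) * norm (?V r)" by (intro mult_right_mono N) simp
    also have "\<dots> \<le> L\<^sup>2 / 2 * w\<^sup>2 + (norm (?V r))\<^sup>2 / 2"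
      using zero_le_power2[of "L * w - norm (?V r)"] by (simp add: power2_diff power_mult_distrib)
    finally have 1: "inner (?N r) (?V r) \<le> L\<^sup>2 / 2 * w\<^sup>2 + (norm (?V r))\<^sup>2 / 2" .
    \<comment> \<open>The factor 4 is the square of the constant in the sup bound; it cancels the 4
      in Young's inequality, which explains the form of \<open>\<kappa>\<close>.\<close>
    have load_bound: "(ht * (a - a') - (power_force \<rho> x - power_force \<rho> x'))\<^sup>2 \<le> 4 * (\<bar>ht\<bar> + force_Lipschitz \<rho> (2 * M))\<^sup>2 * w\<^sup>2"
      if "\<bar>a - a'\<bar> \<le> 2 * w" "\<bar>x - x'\<bar> \<le> 2 * w" "\<bar>x\<bar> \<le> 2 * M" "\<bar>x'\<bar> \<le> 2 * M" "\<rho> > 2" for a a' x x' \<rho>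
    proof -
      have "\<bar>power_force \<rho> x - power_force \<rho> x'\<bar> \<le> force_Lipschitz \<rho> (2 * M) * \<bar>x - x'\<bar>"
        by (intro power_force_Lipschitz that)
      also have "\<dots> \<le> force_Lipschitz \<rho> (2 * M) * (2 * w)" using that by (intro mult_left_mono force_Lipschitz_nonneg) auto
      finally have P: "\<bar>power_force \<rho> x - power_force \<rho> x'\<bar> \<le> force_Lipschitz \<rho> (2 * M) * (2 * w)" .
      have "\<bar>ht * (a - a')\<bar> \<le> \<bar>ht\<bar> * (2 * w)" unfolding abs_mult by (intro mult_left_mono that) simp
      with P have "\<bar>ht * (a - a') - (power_force \<rho> x - power_force \<rho> x')\<bar> \<le> \<bar>ht\<bar> * (2 * w) + force_Lipschitz \<rho> (2 * M) * (2 * w)" by linarith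
      then have "\<bar>ht * (a - a') - (power_force \<rho> x - power_force \<rho> x')\<bar>\<^sup>2 \<le> (\<bar>ht\<bar> * (2 * w) + force_Lipschitz \<rho> (2 * M) * (2 * w))\<^sup>2"
        by (intro power_mono) auto
      also have "\<bar>ht\<bar> * (2 * w) + force_Lipschitz \<rho> (2 * M) * (2 * w) = 2 * ((\<bar>ht\<bar> + force_Lipschitz \<rho> (2 * M)) * w)" by (simp add: algebra_simps)
      finally show ?thesis by (simp add: power_mult_distrib)
    qed
    have sup: "\<bar>u (r + \<delta>) x - u r x\<bar> \<le> 2 * w" "\<bar>u (r + \<delta>) x\<bar> \<le> 2 * M" "\<bar>u r x\<bar> \<le> 2 * M" if "x \<in> {0..1}" for x
      using H1_sup_diff[OF u_H1[OF r'(2)] u_H1[OF r'(1)] that] H1_sup_norm[OF u_H1[OF r'(1)] that] H1_sup_norm[OF u_H1[OF r'(2)] that]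
        M[OF r'(1)] M[OF r'(2)] by (auto simp: w_def)
    have eq0: "?k0 r = ht * (u (r + \<delta>) 1 - u r 1) - (power_force \<alpha> (u (r + \<delta>) 0) - power_force \<alpha> (u r 0))"
      and eq1: "?k1 r = ht * (u (r + \<delta>) 0 - u r 0) - (power_force \<beta> (u (r + \<delta>) 1) - power_force \<beta> (u r 1))"
      by (simp_all add: load0_def load1_def algebra_simps)
    have k0: "(?k0 r)\<^sup>2 \<le> 4 * (\<bar>ht\<bar> + force_Lipschitz \<alpha> (2 * M))\<^sup>2 * w\<^sup>2"
      unfolding eq0 by (rule load_bound) (use \<alpha> in \<open>auto intro!: sup\<close>)
    have k1: "(?k1 r)\<^sup>2 \<le> 4 * (\<bar>ht\<bar> + force_Lipschitz \<beta> (2 * M))\<^sup>2 * w\<^sup>2"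
      unfolding eq1 by (rule load_bound) (use \<beta> in \<open>auto intro!: sup\<close>)
    have K0: "- ((\<bar>ht\<bar> + force_Lipschitz \<alpha> (2 * M))\<^sup>2 / c * w\<^sup>2) - c * (?d0 r)\<^sup>2 \<le> ?k0 r * ?d0 r"
      using product_lower_bound[OF c k0, of "?d0 r"] by simp
    have K1: "- ((\<bar>ht\<bar> + force_Lipschitz \<beta> (2 * M))\<^sup>2 / c * w\<^sup>2) - c * (?d1 r)\<^sup>2 \<le> ?k1 r * ?d1 r"
      using product_lower_bound[OF c k1, of "?d1 r"] by simp
    have "?g0 r * ?d0 r + ?g1 r * ?d1 r = (lam0 * (?d0 r)\<^sup>2 + lam1 * (?d1 r)\<^sup>2 + 2 * lamt * (?d0 r * ?d1 r)) + ?k0 r * ?d0 r + ?k1 r * ?d1 r"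
      by (simp add: power2_eq_square algebra_simps)
    moreover have "c * (?d0 r)\<^sup>2 + c * (?d1 r)\<^sup>2 \<le> lam0 * (?d0 r)\<^sup>2 + lam1 * (?d1 r)\<^sup>2 + 2 * lamt * (?d0 r * ?d1 r)"
      using coercive[of "?d0 r" "?d1 r"] by (simp add: distrib_left)
    ultimately have 2: "- ((\<bar>ht\<bar> + force_Lipschitz \<alpha> (2 * M))\<^sup>2 / c * w\<^sup>2) - ((\<bar>ht\<bar> + force_Lipschitz \<beta> (2 * M))\<^sup>2 / c * w\<^sup>2)
       \<le> ?g0 r * ?d0 r + ?g1 r * ?d1 r" using K0 K1 by linarith
    have 3: "inner (lam *\<^sub>R ?V r - ?N r) (?V r) = lam * (norm (?V r))\<^sup>2 - inner (?N r) (?V r)"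
      by (simp add: inner_diff_left power2_norm_eq_inner)
    have 4: "0 \<le> lam * (norm (?V r))\<^sup>2" using lam by simp
    define C where "C = 2 * (\<bar>ht\<bar> + force_Lipschitz \<alpha> (2 * M))\<^sup>2 / c + 2 * (\<bar>ht\<bar> + force_Lipschitz \<beta> (2 * M))\<^sup>2 / c"
    have C0: "0 \<le> C" using c by (simp add: C_def)
    have "\<kappa> / 2 * E r = L\<^sup>2 / 2 * (norm (?V r))\<^sup>2 + (norm (?V r))\<^sup>2 / 2 + C / 2 * (norm (?V r))\<^sup>2 + L\<^sup>2 / 2 * w\<^sup>2 + w\<^sup>2 / 2 + C / 2 * w\<^sup>2"
      unfolding \<kappa> Ew L_def[symmetric] add.assoc[of _ "2 * (\<bar>ht\<bar> + force_Lipschitz \<alpha> (2 * M))\<^sup>2 / c"] C_def[symmetric] by (simp add: field_simps)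
    moreover have "C / 2 * w\<^sup>2 = (\<bar>ht\<bar> + force_Lipschitz \<alpha> (2 * M))\<^sup>2 / c * w\<^sup>2 + (\<bar>ht\<bar> + force_Lipschitz \<beta> (2 * M))\<^sup>2 / c * w\<^sup>2"
      unfolding C_def by (simp add: add_divide_distrib distrib_right)
    moreover have "0 \<le> L\<^sup>2 / 2 * (norm (?V r))\<^sup>2" "0 \<le> C / 2 * (norm (?V r))\<^sup>2" "0 \<le> w\<^sup>2 / 2" using C0 by auto
    ultimately show ?thesis using 1 2 3 4 by linarith
  qed
  note i = integrable_integral[OF integrable_continuous_real] integrable_integral[OF L2_mult_integrable_on]
  have I: "((\<lambda>t. inner (lam *\<^sub>R ?V t - ?N t) (?V t) + (?g0 t * ?d0 t + ?g1 t * ?d1 t)) has_integral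
     (integral {0..t} (\<lambda>t. inner (lam *\<^sub>R ?V t - ?N t) (?V t)) + (integral {0..t} (\<lambda>t. ?g0 t * ?d0 t) + integral {0..t} (\<lambda>t. ?g1 t * ?d1 t)))) {0..t}"
    by (intro has_integral_add i(1) i(2) L2_primitiveD(1)[OF g0] L2_primitiveD(1)[OF g1] d continuous_on_inner continuous_on_diff continuous_on_scaleR continuous_on_const Vc Nc)
  have "((\<lambda>r. - (\<kappa> / 2) * E r) has_integral - (\<kappa> / 2) * integral {0..t} E) {0..t}"
    by (intro has_integral_mult_right i(1) Ec)
  from has_integral_le[OF this I lower] id
  have "E t / 2 \<le> E 0 / 2 + \<kappa> / 2 * integral {0..t} E" unfolding E by (simp add: add_divide_distrib)
  then show ?thesis by simp
qed

text \<open>The right side involves the solution only at the times 0 and \<delta>: continuity at the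
  initial time controls the modulus of continuity at all later times.\<close>

lemma difference_bound:
  assumes c: "0 < c" and coercive: "\<And>x y. c * (x\<^sup>2 + y\<^sup>2) \<le> lam0 * x\<^sup>2 + lam1 * y\<^sup>2 + 2 * lamt * (x * y)"
    and M: "\<And>t. t \<in> {0..T} \<Longrightarrow> norm (H1_pair (u t)) \<le> M"
    and \<delta>: "0 < \<delta>" "\<delta> < T" and t: "t \<in> {0..T-\<delta>}"
    and \<kappa>: "\<kappa> = (force_Lipschitz p (2 * M))\<^sup>2 + 1
      + 2 * (\<bar>ht\<bar> + force_Lipschitz \<alpha> (2 * M))\<^sup>2 / c + 2 * (\<bar>ht\<bar> + force_Lipschitz \<beta> (2 * M))\<^sup>2 / c"
  shows "(norm (cls (u' (t + \<delta>)) - cls (u' t)))\<^sup>2 + (norm (H1_pair (u (t + \<delta>)) - H1_pair (u t)))\<^sup>2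
    \<le> ((norm (cls (u' \<delta>) - cls (u' 0)))\<^sup>2 + (norm (H1_pair (u \<delta>) - H1_pair (u 0)))\<^sup>2) * exp (\<kappa> * t)"
proof -
  define E where "E t = (norm (cls (u' (t + \<delta>)) - cls (u' t)))\<^sup>2 + (norm (H1_pair (u (t + \<delta>)) - H1_pair (u t)))\<^sup>2" for t
  have shift: "continuous_on {0..T-\<delta>} (\<lambda>t. f (t + \<delta>) - f t)" if "continuous_on {0..T} f" for f :: "real \<Rightarrow> 'k::real_normed_vector"
    by (intro continuous_intros continuous_on_compose2[OF that] continuous_on_subset[OF that]) (use \<delta> in auto)
  have "continuous_on {0..T-\<delta>} E" unfolding E_def
    by (intro continuous_on_add continuous_on_power continuous_on_norm shift u'_continuous pair_continuous)
  moreover have "0 \<le> \<kappa>" unfolding \<kappa> using c by (intro add_nonneg_nonneg) auto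
  ultimately have "E t \<le> E 0 * exp (\<kappa> * t)"
    using difference_energy_inequality[OF c coercive M \<delta> E_def \<kappa>] t by (intro gronwall[of "T - \<delta>"])
  then show ?thesis by (simp add: E_def)
qed

text \<open>By the energy balance the boundary dissipation is at most the gain in
  \<open>energy\<close>, whose final value is bounded above in terms of M. The bound does not depend
  on T, so the trace derivatives stay square integrable up to a finite maximal time.\<close>

lemma trace_dissipation_bound:
  assumes c: "0 < c" and coercive: "\<And>x y. c * (x\<^sup>2 + y\<^sup>2) \<le> lam0 * x\<^sup>2 + lam1 * y\<^sup>2 + 2 * lamt * (x * y)"
    and M: "\<And>t. t \<in> {0..T} \<Longrightarrow> norm (H1_pair (u t)) \<le> M"
  shows "c * (integral {0..T} (\<lambda>t. (d0 t)\<^sup>2) + integral {0..T} (\<lambda>t. (d1 t)\<^sup>2))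
    \<le> force_Lipschitz p (2 * M) * M\<^sup>2 / p + (2 * M) powr \<alpha> / \<alpha> + (2 * M) powr \<beta> / \<beta> + \<bar>ht\<bar> * (2 * M)\<^sup>2 - energy 0"
proof -
  have T: "T \<in> {0..T}" using T_pos by simp
  have M0: "0 \<le> M" using order_trans[OF norm_ge_zero M[OF T]] .
  note d = L2_primitiveD(1)[OF trace0] L2_primitiveD(1)[OF trace1]
  have sq: "(\<lambda>t. (d0 t)\<^sup>2) integrable_on {0..T}" "(\<lambda>t. (d1 t)\<^sup>2) integrable_on {0..T}"
    using L2_mult_integrable_on[OF d(1) d(1)] L2_mult_integrable_on[OF d(2) d(2)] by (simp_all add: power2_eq_square)
  have "c * (integral {0..T} (\<lambda>t. (d0 t)\<^sup>2) + integral {0..T} (\<lambda>t. (d1 t)\<^sup>2)) = integral {0..T} (\<lambda>t. c * ((d0 t)\<^sup>2 + (d1 t)\<^sup>2))"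
    by (simp add: hk_integral_add sq)
  also have "\<dots> \<le> integral {0..T} dissipation"
    by (intro integral_le integrable_on_mult_right hk_integrable_add sq dissipation_integrable)
      (auto simp: dissipation_def coercive)
  also have "\<dots> \<le> energy T - energy 0"
  proof -
    have "0 \<le> lam * integral {0..T} (\<lambda>s. (norm (cls (u' s)))\<^sup>2)"
      using lam by (intro mult_nonneg_nonneg integral_nonneg integrable_continuous_real speed_square_continuous) auto
    then show ?thesis using energy_balance[OF T] by simp
  qed
  also have "energy T \<le> force_Lipschitz p (2 * M) * M\<^sup>2 / p + (2 * M) powr \<alpha> / \<alpha> + (2 * M) powr \<beta> / \<beta> + \<bar>ht\<bar> * (2 * M)\<^sup>2"
  proof -
    have sup: "\<bar>u T x\<bar> \<le> 2 * M" if "x \<in> {0..1}" for x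
      using H1_sup_norm[OF u_H1[OF T] that] M[OF T] by linarith
    \<comment> \<open>The force vanishes at the zero function, so its Lipschitz estimate against
      zero bounds its norm.\<close>
    have z: "(\<lambda>x. 0) \<in> H1 0 1" "H1_pair (\<lambda>x. 0) = 0"
      using H1_diff[OF u_H1[OF T] u_H1[OF T]] H1_pair_diff[OF u_H1[OF T] u_H1[OF T]] by simp_all
    then have cz: "cls (\<lambda>x. 0) = 0" by (simp add: H1_pair_def prod_eq_iff)
    have fz: "force p (\<lambda>x. 0) = 0" by (simp add: force_def power_force_def cz)
    have U: "norm (cls (u T)) \<le> M" using norm_fst_le[of "fst (H1_pair (u T))" "snd (H1_pair (u T))"] M[OF T] by (simp add: H1_pair_def)
    have "norm (force p (u T)) \<le> force_Lipschitz p (2 * M) * norm (cls (u T))"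
      using force_Lipschitz_H1[OF p u_H1[OF T] M[OF T] z(1)] M0 by (simp add: z(2) cz fz)
    then have "norm (force p (u T)) * norm (cls (u T)) \<le> (force_Lipschitz p (2 * M) * norm (cls (u T))) * norm (cls (u T))"
      by (intro mult_right_mono) auto
    also have "\<dots> = force_Lipschitz p (2 * M) * (norm (cls (u T)))\<^sup>2" by (simp add: power2_eq_square)
    also have "\<dots> \<le> force_Lipschitz p (2 * M) * M\<^sup>2"
      using U p by (intro mult_left_mono power_mono force_Lipschitz_nonneg) auto
    finally have "inner (force p (u T)) (cls (u T)) \<le> force_Lipschitz p (2 * M) * M\<^sup>2"
      using norm_cauchy_schwarz[of "force p (u T)" "cls (u T)"] by linarith
    then have 1: "inner (force p (u T)) (cls (u T)) / p \<le> force_Lipschitz p (2 * M) * M\<^sup>2 / p" using p by (intro divide_right_mono) auto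
    have 2: "\<bar>u T 0\<bar> powr \<alpha> / \<alpha> \<le> (2 * M) powr \<alpha> / \<alpha>" "\<bar>u T 1\<bar> powr \<beta> / \<beta> \<le> (2 * M) powr \<beta> / \<beta>"
      using \<alpha> \<beta> by (auto intro!: divide_right_mono powr_mono2 sup)
    have "\<bar>ht * (u T 0 * u T 1)\<bar> \<le> \<bar>ht\<bar> * ((2 * M) * (2 * M))"
      unfolding abs_mult using M0 by (intro mult_left_mono mult_mono sup) auto
    then have 3: "- (ht * (u T 0 * u T 1)) \<le> \<bar>ht\<bar> * (2 * M)\<^sup>2" by (simp add: power2_eq_square)
    have "0 \<le> (norm (cls (u' T)))\<^sup>2 / 2" "0 \<le> (norm (H1_pair (u T)))\<^sup>2 / 2" by auto
    then show ?thesis unfolding energy_def using 1 2 3 by linarith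
  qed
  finally show ?thesis by simp
qed

end

section \<open>Passage to the closed time interval\<close>

lemma L2_primitive_closure:
  assumes T: "0 < T" and f: "continuous_on {0..T} f" and g: "g \<in> L2 0 T"
    and prim: "\<And>S. 0 < S \<Longrightarrow> S < T \<Longrightarrow> L2_primitive 0 S f g"
  shows "L2_primitive 0 T f g"
proof -
  define h where "h t = f t - integral {0..t} g" for t
  have "continuous_on {0..T} h"
    unfolding h_def by (intro continuous_intros f indefinite_integral_continuous_1 L2_integrable_on g)
  then have "continuous_on (closure {0<..<T}) h" using T by simp
  moreover have "h x = h 0" if "x \<in> {0<..<T}" for x
    using L2_primitiveD(2)[OF prim[of x], of 0 x] that by (simp add: h_def)
  ultimately have const: "h x = h 0" if "x \<in> {0..T}" for x
    using continuous_constant_on_closure[of "{0<..<T}" h "h 0" x] that T by simp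
  show ?thesis unfolding L2_primitive_def
  proof (intro conjI allI impI g)
    fix s t assume st: "0 \<le> s \<and> s \<le> t \<and> t \<le> T"
    then have "h t = h s" using const[of t] const[of s] by simp
    then show "f t - f s = integral {s..t} g"
      using integral_sub_diff[OF L2_integrable_on[OF g], of s t] st by (simp add: h_def)
  qed
qed

lemma L2_extend_zero:
  assumes f: "f \<in> L2 a c" and "c \<le> b"
  shows "(\<lambda>x. if x \<in> {a<..<c} then f x else 0) \<in> L2 a b"
proof -
  let ?F = "\<lambda>x. if x \<in> {a<..<c} then f x else 0"
  have m: "?F \<in> borel_measurable (lebesgue_on {a<..<b})"
    by (rule borel_measurable_if_lebesgue_on[THEN iffD2, OF _ _ _ L2_measurable[OF f]]) (use assms in auto)
  have "integrable lebesgue (\<lambda>x. if x \<in> {a<..<c} then (f x)\<^sup>2 else 0)"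
    by (rule Lebesgue_Measure.integrable_restrict_UNIV[THEN iffD2, OF _ L2_square_integrable[OF f]]) simp
  then have "integrable lebesgue (\<lambda>x. (?F x)\<^sup>2)"
    by (rule Bochner_Integration.integrable_cong[THEN iffD1, rotated 2]) auto
  then have "integrable (lebesgue_on {a<..<b}) (\<lambda>x. (?F x)\<^sup>2)"
    by (intro integrable_restrict_space[THEN iffD2] integrable_mult_indicator) auto
  with m show ?thesis by (simp add: L2_def)
qed

lemma bounded_increasing_Cauchy:
  fixes K :: "nat \<Rightarrow> real"
  assumes "incseq K" "\<And>n. K n \<le> B" "0 < e"
  shows "\<exists>N. \<forall>m\<ge>N. \<forall>n\<ge>N. \<bar>K m - K n\<bar> < e"
proof -
  have "bdd_above (range K)" using assms(2) by (intro bdd_aboveI[of _ B]) auto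
  then have "K \<longlonglongrightarrow> (SUP i. K i)" by (rule LIMSEQ_incseq_SUP[OF _ assms(1)])
  from CauchyD[OF LIMSEQ_imp_Cauchy[OF this] \<open>0 < e\<close>] show ?thesis by simp
qed

lemma exhausting_sequence:
  assumes "0 < (T::real)"
  obtains S :: "nat \<Rightarrow> real" where "\<And>n. 0 < S n" "\<And>n. S n < T" "incseq S" "S \<longlonglongrightarrow> T"
proof
  \<comment> \<open>The shift by 2 makes the first member T/2 and not 0.\<close>
  define S where "S n = T * (1 - 1 / real (n + 2))" for n
  have lt: "1 / real (n + 2) < 1" for n by simp
  show "0 < S n" "S n < T" for n
    using assms lt[of n] by (auto simp: S_def intro!: mult_pos_pos)
  show "incseq S"
    using assms by (intro incseq_SucI) (auto simp: S_def intro!: mult_left_mono divide_left_mono)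
  have "(\<lambda>n. 1 / real (n + 2)) \<longlonglongrightarrow> 0" by (rule LIMSEQ_ignore_initial_segment[OF lim_1_over_n])
  then have "(\<lambda>n. T * (1 - 1 / real (n + 2))) \<longlonglongrightarrow> T * (1 - 0)" by (intro tendsto_intros)
  then show "S \<longlonglongrightarrow> T" by (simp add: S_def[abs_def])
qed

text \<open>The densities given on different subintervals are unrelated choices, but uniqueness
  makes them agree almost everywhere on common parts. Extended by zero they are orthogonal
  increments of one function: the squared distance of two of them is the difference of their squared
  norms, which are increasing and bounded by \<open>B\<close>.\<close>

lemma L2_primitive_extend:
  assumes T: "0 < T" and b: "continuous_on {0..T} b"
    and ex: "\<And>S. 0 < S \<Longrightarrow> S < T \<Longrightarrow> \<exists>d. L2_primitive 0 S b d \<and> integral {0..S} (\<lambda>t. (d t)\<^sup>2) \<le> B"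
  shows "\<exists>d. L2_primitive 0 T b d"
proof -
  obtain S :: "nat \<Rightarrow> real" where S: "\<And>n. 0 < S n" "\<And>n. S n < T" "incseq S" "S \<longlonglongrightarrow> T"
    using exhausting_sequence[OF T] by blast
  have "\<forall>n. \<exists>d. L2_primitive 0 (S n) b d \<and> integral {0..S n} (\<lambda>t. (d t)\<^sup>2) \<le> B" using ex S by blast
  then obtain d where d: "\<And>n. L2_primitive 0 (S n) b (d n)" "\<And>n. integral {0..S n} (\<lambda>t. (d n t)\<^sup>2) \<le> B"
    using choice[of "\<lambda>n d. L2_primitive 0 (S n) b d \<and> integral {0..S n} (\<lambda>t. (d t)\<^sup>2) \<le> B"] by blast
  note dL2 = L2_primitiveD(1)[OF d(1)]
  define D where "D n x = (if x \<in> {0<..<S n} then d n x else 0)" for n x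
  have DL2: "D n \<in> L2 0 T" for n
    unfolding D_def by (rule L2_extend_zero[OF dL2]) (use S in \<open>auto intro: less_imp_le\<close>)
  have Dint: "integral {s..t} (D n) = b t - b s" if "0 \<le> s" "s \<le> t" "t \<le> S n" for s t n
  proof -
    have "integral {s..t} (D n) = integral {s..t} (d n)"
      by (rule integral_spike[of "{0, S n}"]) (use that in \<open>auto simp: D_def\<close>)
    then show ?thesis using L2_primitiveD(2)[OF d(1) that] by simp
  qed
  define K where "K n = L2_inner 0 T (D n) (D n)" for n
  have cross: "L2_inner 0 T (D n) (D m) = K m" if "m \<le> n" for m n
  proof -
    have Smn: "S m \<le> S n" using S(3) that by (auto dest: incseqD)
    have "AE x in lebesgue_on {0<..<S m}. d n x = d m x"
      by (rule L2_primitive_unique[OF S(1) L2_primitive_sub[OF d(1)] d(1)]) (use Smn in auto)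
    then have "AE x in lebesgue. x \<in> {0<..<S m} \<longrightarrow> d n x = d m x" by (simp add: AE_restrict_space_iff)
    then have "AE x in lebesgue_on {0<..<T}. x \<in> {0<..<S m} \<longrightarrow> d n x = d m x"
      by (simp add: AE_restrict_space_iff) (erule AE_mp, simp)
    then have "AE x in lebesgue_on {0<..<T}. D n x * D m x = D m x * D m x"
      using Smn by (auto simp: D_def elim!: eventually_mono)
    then show ?thesis unfolding K_def L2_inner_def
      by (intro integral_cong_AE borel_measurable_times L2_measurable DL2)
  qed
  have diff: "(L2_norm 0 T (\<lambda>x. D n x - D m x))\<^sup>2 = K n - K m" if "m \<le> n" for m n
  proof -
    note dd = L2_diff[OF DL2[of n] DL2[of m]]
    have "L2_inner 0 T (\<lambda>x. D n x - D m x) (\<lambda>x. D n x - D m x)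
        = L2_inner 0 T (D n) (D n) - L2_inner 0 T (D n) (D m) - (L2_inner 0 T (D n) (D m) - L2_inner 0 T (D m) (D m))"
      using L2_inner_diff_left[OF DL2[of n] DL2[of m] dd] L2_inner_diff_left[OF DL2[of n] DL2[of m] DL2[of n]]
        L2_inner_diff_left[OF DL2[of n] DL2[of m] DL2[of m]]
        L2_inner_commute[of 0 T "D n" "\<lambda>x. D n x - D m x"] L2_inner_commute[of 0 T "D m" "\<lambda>x. D n x - D m x"]
        L2_inner_commute[of 0 T "D m" "D n"]
      by linarith
    then show ?thesis using cross[OF that] by (simp add: L2_norm_square K_def)
  qed
  have inc: "incseq K" unfolding incseq_def using diff zero_le_power2 by (metis diff_ge_0_iff_ge)
  have bd: "K n \<le> B" for n
  proof -
    have "K n = integral {0..T} (\<lambda>x. D n x * D n x)" by (simp add: K_def L2_inner_integral DL2)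
    also have "\<dots> = integral {0..T} (\<lambda>x. if x \<in> {0<..<S n} then d n x * d n x else 0)"
      by (rule hk_integral_cong) (simp add: D_def)
    also have "\<dots> = integral {0<..<S n} (\<lambda>x. d n x * d n x)"
      using S(1,2)[of n] by (subst hk_integral_restrict_Int) (auto intro: arg_cong2[where f = integral])
    also have "\<dots> = integral {0..S n} (\<lambda>x. (d n x)\<^sup>2)" by (simp add: integral_open_interval_real power2_eq_square)
    finally show ?thesis using d(2) by simp
  qed
  have "\<exists>g\<in>L2 0 T. (\<lambda>n. L2_norm 0 T (\<lambda>x. D n x - g x)) \<longlonglongrightarrow> 0"
  proof (rule L2_complete[OF DL2])
    fix e :: real assume "0 < e"
    then obtain N where N: "\<And>m n. m \<ge> N \<Longrightarrow> n \<ge> N \<Longrightarrow> \<bar>K m - K n\<bar> < e\<^sup>2"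
      using bounded_increasing_Cauchy[OF inc bd, of "e\<^sup>2"] by auto
    have "L2_norm 0 T (\<lambda>x. D m x - D n x) < e" if "m \<ge> N" "n \<ge> N" for m n
    proof (rule power2_less_imp_less)
      have "(L2_norm 0 T (\<lambda>x. D m x - D n x))\<^sup>2 = \<bar>K m - K n\<bar>"
        using diff[of m n] diff[of n m] L2_norm_minus_commute[of 0 T "D m" "D n"] inc
        by (cases "m \<le> n") (auto simp: incseq_def)
      then show "(L2_norm 0 T (\<lambda>x. D m x - D n x))\<^sup>2 < e\<^sup>2" using N[OF that] by simp
    qed (use \<open>0 < e\<close> in simp)
    then show "\<exists>N. \<forall>m\<ge>N. \<forall>n\<ge>N. L2_norm 0 T (\<lambda>x. D m x - D n x) < e" by blast
  qed
  then obtain g where g: "g \<in> L2 0 T" "(\<lambda>n. L2_norm 0 T (\<lambda>x. D n x - g x)) \<longlonglongrightarrow> 0" by blast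
  have lim: "(\<lambda>n. integral {s..t} (D n)) \<longlonglongrightarrow> integral {s..t} g" if "0 \<le> s" "t \<le> T" for s t
  proof -
    have le: "\<bar>integral {s..t} (D n) - integral {s..t} g\<bar> \<le> L2_norm 0 T (\<lambda>x. D n x - g x) * L2_norm 0 T (indicator {s..t})" for n
      using L2_Cauchy_Schwarz[OF L2_diff[OF DL2[of n] g(1)] L2_indicator[of s t]] L2_inner_diff_left[OF DL2[of n] g(1) L2_indicator[of s t]]
      by (simp only: L2_inner_indicator[OF DL2 that] L2_inner_indicator[OF g(1) that])
    have zero: "(\<lambda>n. L2_norm 0 T (\<lambda>x. D n x - g x) * L2_norm 0 T (indicator {s..t})) \<longlonglongrightarrow> 0"
      by (rule tendsto_mult_left_zero[OF g(2)])
    have "(\<lambda>n. integral {s..t} (D n) - integral {s..t} g) \<longlonglongrightarrow> 0"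
      by (rule Lim_null_comparison[OF always_eventually zero]) (simp only: real_norm_def le simp_thms)
    then show ?thesis by (rule Lim_null[THEN iffD2])
  qed
  have "L2_primitive 0 T b g"
  proof (rule L2_primitive_closure[OF T b g(1)])
    fix R assume R: "0 < R" "R < T"
    show "L2_primitive 0 R b g" unfolding L2_primitive_def
    proof (intro conjI allI impI)
      show "g \<in> L2 0 R" by (rule L2_subinterval[OF g(1)]) (use R in auto)
      fix s t assume st: "0 \<le> s \<and> s \<le> t \<and> t \<le> R"
      have "\<forall>\<^sub>F n in sequentially. t < S n" using order_tendstoD(1)[OF S(4)] st R by simp
      then have "\<forall>\<^sub>F n in sequentially. integral {s..t} (D n) = b t - b s"
        by eventually_elim (use st Dint in auto)
      then have "(\<lambda>n. integral {s..t} (D n)) \<longlonglongrightarrow> b t - b s" by (rule tendsto_eventually)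
      from LIMSEQ_unique[OF this lim[of s t]] st R show "b t - b s = integral {s..t} g" by simp
    qed
  qed
  then show ?thesis by blast
qed

text \<open>U(t) minus the integral of V over [0, t] is constant on the open interval, hence by
  continuity on the closed one; the integral is differentiable up to the end point.\<close>

lemma C1_extend:
  fixes U V :: "real \<Rightarrow> 'a::banach"
  assumes T: "0 < T" and U: "continuous_on {0..T} U" and V: "continuous_on {0..T} V"
    and der: "\<And>S t. 0 < S \<Longrightarrow> S < T \<Longrightarrow> t \<in> {0..S} \<Longrightarrow> (U has_vector_derivative V t) (at t within {0..S})"
    and t: "t \<in> {0..T}"
  shows "(U has_vector_derivative V t) (at t within {0..T})"
proof -
  define h where "h t = U t - integral {0..t} V" for t
  have "continuous_on {0..T} h"
    unfolding h_def by (intro continuous_intros U indefinite_integral_continuous_1 integrable_continuous_real V)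
  then have "continuous_on (closure {0<..<T}) h" using T by simp
  moreover have "h x = h 0" if "x \<in> {0<..<T}" for x
    using integral_unique[OF fundamental_theorem_of_calculus[OF _ der[of x]]] that by (simp add: h_def)
  ultimately have const: "h x = h 0" if "x \<in> {0..T}" for x
    using continuous_constant_on_closure[of "{0<..<T}" h "h 0" x] that T by simp
  have der': "((\<lambda>t. h 0 + integral {0..t} V) has_vector_derivative 0 + V t) (at t within {0..T})"
    by (intro has_vector_derivative_add has_vector_derivative_const integral_has_vector_derivative V t)
  have "U x = h 0 + integral {0..x} V" if "x \<in> {0..T}" for x
    unfolding const[OF that, symmetric] by (simp add: h_def)
  from has_vector_derivative_transform[OF t this der'] show ?thesis by simp
qed

text \<open>The energy space is complete, so uniform continuity of the pair (u', u) on [0, T) yields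
  a final state. It then remains to carry over to [0, T] the differentiability in L^2, the
  regularity of the traces and the equation, each known on every shorter interval.\<close>

lemma bounded_weak_solution_extends:
  fixes p \<alpha> \<beta> lam lam0 lam1 lamt ht T M :: real
  assumes p: "p > 2" and \<alpha>: "\<alpha> > 2" and \<beta>: "\<beta> > 2" and lam: "lam > 0" and lam0: "lam0 > 0" and lam1: "lam1 > 0"
    and lamt: "\<bar>lamt\<bar> < sqrt (lam0 * lam1)" and T: "0 < T"
    and weak: "\<And>S. 0 < S \<Longrightarrow> S < T \<Longrightarrow> weak_solution p \<alpha> \<beta> lam lam0 lam1 lamt ht u0 u1 S u u'"
    and bound: "\<And>t. 0 \<le> t \<Longrightarrow> t < T \<Longrightarrow> L2_norm 0 1 (u' t) + H1_norm 0 1 (u t) \<le> M"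
  shows "\<exists>v v'. weak_solution p \<alpha> \<beta> lam lam0 lam1 lamt ht u0 u1 T v v' \<and> (\<forall>t. 0 \<le> t \<and> t < T \<longrightarrow> v t = u t)"
proof -
  have sol: "\<exists>d0 d1. damped_wave_solution S u u' d0 d1 p \<alpha> \<beta> lam lam0 lam1 lamt ht" if S: "0 < S" "S < T" for S
  proof -
    obtain d0 d1 where "wave_solution S u u' d0 d1 p \<alpha> \<beta> lam lam0 lam1 lamt ht"
      using weak_solution_imp_wave_solution[OF p \<alpha> \<beta> weak[OF S]] by blast
    then show ?thesis using lam lam0 lam1 lamt
      by (intro exI) (simp add: damped_wave_solution_def damped_wave_solution_axioms_def)
  qed
  have path: "\<exists>d0 d1. wave_path S u u' d0 d1" if S: "0 < S" "S < T" for S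
    using sol[OF S] by (auto simp: damped_wave_solution_def wave_solution_def)
  have mid: "0 < (t + T) / 2" "(t + T) / 2 < T" "t \<in> {0..(t + T) / 2}" if "0 \<le> t" "t < T" for t
    using that T by auto
  have uH: "u t \<in> H1 0 1" and u'L: "u' t \<in> L2 0 1" if t: "0 \<le> t" "t < T" for t
    using path[OF mid(1,2)[OF t]] wave_path.u_H1 wave_path.u'_L2 mid(3)[OF t] by blast+
  have M: "norm (H1_pair (u t)) \<le> M" if "0 \<le> t" "t < T" for t
    using bound[OF that] L2_norm_nonneg[of 0 1 "u' t"] by (simp add: norm_H1_pair uH that)
  obtain c where c: "0 < c" and coercive: "\<And>x y. c * (x\<^sup>2 + y\<^sup>2) \<le> lam0 * x\<^sup>2 + lam1 * y\<^sup>2 + 2 * lamt * (x * y)"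
    using damping_coercive[OF lam0 lam1 lamt] by blast
  define X where "X t = (cls (u' t), H1_pair (u t))" for t
  define \<kappa> where "\<kappa> = (force_Lipschitz p (2 * M))\<^sup>2 + 1
      + 2 * (\<bar>ht\<bar> + force_Lipschitz \<alpha> (2 * M))\<^sup>2 / c + 2 * (\<bar>ht\<bar> + force_Lipschitz \<beta> (2 * M))\<^sup>2 / c"
  have \<kappa>: "0 \<le> \<kappa>" unfolding \<kappa>_def using c by (intro add_nonneg_nonneg) auto
  have Xn: "(norm (X t - X s))\<^sup>2 = (norm (cls (u' t) - cls (u' s)))\<^sup>2 + (norm (H1_pair (u t) - H1_pair (u s)))\<^sup>2" for s t
    by (simp add: X_def norm_Pair)
  have Xdiff: "(norm (X t - X s))\<^sup>2 \<le> (norm (X (t - s) - X 0))\<^sup>2 * exp (\<kappa> * T)" if st: "0 \<le> s" "s < t" "t < T" for s t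
  \<comment> \<open>The estimate for translates is used on the interval [0, t] with shift t - s,
    which must be strictly smaller than t; for s = 0 the claim is immediate because the exponential
    is at least 1.\<close>
  proof (cases "s = 0")
    case True
    have "1 \<le> exp (\<kappa> * T)" using \<kappa> T by simp
    then have "(norm (X t - X 0))\<^sup>2 * 1 \<le> (norm (X t - X 0))\<^sup>2 * exp (\<kappa> * T)" by (intro mult_left_mono) auto
    then show ?thesis using True by simp
  next
    case False
    obtain d0 d1 where s: "damped_wave_solution t u u' d0 d1 p \<alpha> \<beta> lam lam0 lam1 lamt ht" using sol[of t] st by auto
    interpret damped_wave_solution t u u' d0 d1 p \<alpha> \<beta> lam lam0 lam1 lamt ht by (rule s)
    have "(norm (X t - X s))\<^sup>2 \<le> (norm (X (t - s) - X 0))\<^sup>2 * exp (\<kappa> * s)"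
      using difference_bound[OF c coercive, of M "t - s" s \<kappa>] M False st unfolding Xn by (simp add: \<kappa>_def)
    also have "\<dots> \<le> (norm (X (t - s) - X 0))\<^sup>2 * exp (\<kappa> * T)"
      using \<kappa> st by (intro mult_left_mono) (auto intro: mult_left_mono)
    finally show ?thesis .
  qed
  have Xc: "continuous_on {0..S} X" if S: "0 < S" "S < T" for S
    using path[OF S] unfolding X_def by (auto intro!: continuous_on_Pair wave_path.u'_continuous wave_path.pair_continuous)
  have uc: "uniformly_continuous_on {0..<T} X"
    unfolding uniformly_continuous_on_def
  proof (intro allI impI)
    fix e :: real assume "0 < e"
    \<comment> \<open>The squared estimate loses only one factor of the exponential; as this factor
      is at least 1, dividing \<open>e\<close> by the whole of it is enough.\<close>
    define e' where "e' = e / exp (\<kappa> * T)"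
    have e': "0 < e'" using \<open>0 < e\<close> by (simp add: e'_def)
    \<comment> \<open>Only the continuity near time 0 enters: the pair is compared at the times t -
      s and 0, both in [0, T/2].\<close>
    obtain \<delta> where \<delta>: "0 < \<delta>" "\<And>s t. s \<in> {0..T/2} \<Longrightarrow> t \<in> {0..T/2} \<Longrightarrow> \<bar>t - s\<bar> < \<delta> \<Longrightarrow> norm (X t - X s) < e'"
      using uniform_modulus[OF Xc[of "T/2"] e'] T by auto
    have *: "dist (X t) (X s) < e" if st: "0 \<le> s" "s < t" "t < T" "t - s < min \<delta> (T/2)" for s t
    proof -
      have "norm (X (t - s) - X 0) < e'" using \<delta>(2)[of 0 "t - s"] st by auto
      then have "(norm (X (t - s) - X 0))\<^sup>2 < e'\<^sup>2" by (intro power_strict_mono) auto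
      then have "(norm (X (t - s) - X 0))\<^sup>2 * exp (\<kappa> * T) < e'\<^sup>2 * exp (\<kappa> * T)" by simp
      with Xdiff[OF st(1-3)] have "(norm (X t - X s))\<^sup>2 < e'\<^sup>2 * exp (\<kappa> * T)" by linarith
      also have "\<dots> \<le> e'\<^sup>2 * (exp (\<kappa> * T))\<^sup>2"
        using \<kappa> T by (intro mult_left_mono) (auto simp: power2_eq_square)
      also have "\<dots> = e\<^sup>2" by (simp add: e'_def power_divide)
      finally have "norm (X t - X s) < e" by (rule power2_less_imp_less) (use \<open>0 < e\<close> in simp)
      then show ?thesis by (simp add: dist_norm)
    qed
    have "dist (X t) (X s) < e" if "s \<in> {0..<T}" "t \<in> {0..<T}" "dist t s < min \<delta> (T/2)" for s t
      using *[of s t] *[of t s] that \<open>0 < e\<close> by (cases s t rule: linorder_cases) (auto simp: dist_real_def dist_commute)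
    then show "\<exists>d>0. \<forall>x\<in>{0..<T}. \<forall>x'\<in>{0..<T}. dist x' x < d \<longrightarrow> dist (X x') (X x) < e"
      using \<delta>(1) T by (intro exI[of _ "min \<delta> (T/2)"]) auto
  qed
  obtain Y where Yu: "uniformly_continuous_on (closure {0..<T}) Y" and Y: "\<And>x. x \<in> {0..<T} \<Longrightarrow> X x = Y x"
    using uniformly_continuous_on_extension_on_closure[OF uc] by metis
  have Yc: "continuous_on {0..T} Y" using uniformly_continuous_imp_continuous[OF Yu] T by simp
  obtain S :: "nat \<Rightarrow> real" where S: "\<And>n. 0 < S n" "\<And>n. S n < T" "incseq S" "S \<longlonglongrightarrow> T"
    using exhausting_sequence[OF T] by blast
  have YS: "(\<lambda>n. Y (S n)) \<longlonglongrightarrow> Y T"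
    by (rule continuous_on_tendsto_compose[OF Yc S(4)]) (use T S in \<open>auto intro!: always_eventually less_imp_le\<close>)
  have "(\<lambda>n. H1_pair (u (S n))) \<longlonglongrightarrow> snd (Y T)"
    using tendsto_snd[OF YS] Y[of "S n" for n] S by (simp add: X_def less_imp_le flip: Y)
  \<comment> \<open>The limit exists as a pair of classes; closedness of the space of H^1 pairs
    supplies an actual function, with values at both end points.\<close>
  then obtain w where w: "w \<in> H1 0 1" "H1_pair w = snd (Y T)" using H1_complete[of "\<lambda>n. u (S n)"] uH S by (metis less_imp_le)
  obtain w' where w': "w' \<in> L2 0 1" "fst (Y T) = cls w'" using cls_surj by blast
  define v where "v t = (if t < T then u t else w)" for t
  define v' where "v' t = (if t < T then u' t else w')" for t
  have Yv: "Y t = (cls (v' t), H1_pair (v t))" if "t \<in> {0..T}" for t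
    using that Y[of t] w w' by (cases "t < T") (auto simp: v_def v'_def X_def prod_eq_iff)
  have vH: "v t \<in> H1 0 1" and v'L: "v' t \<in> L2 0 1" if "t \<in> {0..T}" for t
    using that uH[of t] u'L[of t] w w' by (auto simp: v_def v'_def)
  have "continuous_on {0..T} (\<lambda>t. snd (Y t))" "continuous_on {0..T} (\<lambda>t. fst (Y t))"
    by (intro continuous_intros Yc)+
  then have vW: "continuous_on {0..T} (\<lambda>t. H1_pair (v t))" and vV: "continuous_on {0..T} (\<lambda>t. cls (v' t))"
    using Yv by (auto elim!: continuous_on_eq)
  have "continuous_on {0..T} (\<lambda>t. fst (H1_pair (v t)))" by (intro continuous_intros vW)
  then have vU: "continuous_on {0..T} (\<lambda>t. cls (v t))" by (simp add: H1_pair_def)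
  have eqv: "v t = u t" "v' t = u' t" if "t < T" for t using that by (auto simp: v_def v'_def)
  have vder: "((\<lambda>t. cls (v t)) has_vector_derivative cls (v' t)) (at t within {0..T})" if "t \<in> {0..T}" for t
  proof (rule C1_extend[OF T vU vV _ that])
    fix R t assume R: "0 < R" "R < T" and t: "t \<in> {0..R}"
    obtain d0 d1 where "wave_path R u u' d0 d1" using path[OF R] by blast
    then interpret wave_path R u u' d0 d1 .
    have "((\<lambda>t. cls (v t)) has_vector_derivative cls (u' t)) (at t within {0..R})"
      by (rule has_vector_derivative_transform[OF t _ u_deriv[OF t]]) (use R in \<open>simp add: eqv\<close>)
    then show "((\<lambda>t. cls (v t)) has_vector_derivative cls (v' t)) (at t within {0..R})"
      using t R by (simp add: eqv)
  qed
  have vx: "continuous_on {0..T} (\<lambda>t. v t x)" if x: "x \<in> {0..1}" for x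
    unfolding continuous_on_def
  proof (intro ballI)
    fix t assume t: "t \<in> {0..T}"
    have "((\<lambda>s. 2 * norm (H1_pair (v s) - H1_pair (v t))) \<longlongrightarrow> 2 * norm (H1_pair (v t) - H1_pair (v t))) (at t within {0..T})"
      by (intro tendsto_intros) (use vW t in \<open>auto simp: continuous_on_def\<close>)
    then have "((\<lambda>s. 2 * norm (H1_pair (v s) - H1_pair (v t))) \<longlongrightarrow> 0) (at t within {0..T})" by simp
    moreover have "\<forall>\<^sub>F s in at t within {0..T}. norm (v s x - v t x) \<le> 2 * norm (H1_pair (v s) - H1_pair (v t))"
      using H1_sup_diff[OF vH vH[OF t] x] by (simp add: eventually_at_filter)
    ultimately have "((\<lambda>s. v s x - v t x) \<longlongrightarrow> 0) (at t within {0..T})" by (rule Lim_null_comparison[rotated])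
    then show "((\<lambda>t. v t x) \<longlongrightarrow> v t x) (at t within {0..T})" by (rule Lim_null[THEN iffD2])
  qed
  \<comment> \<open>The initial value of \<open>energy\<close> written out, so that the bound
    \<open>B\<close> is fixed before any interval [0, R] and its densities are chosen.\<close>
  define e0 where "e0 = - (norm (cls (u' 0)))\<^sup>2 / 2 - (norm (H1_pair (u 0)))\<^sup>2 / 2 + inner (force p (u 0)) (cls (u 0)) / p
     + \<bar>u 0 0\<bar> powr \<alpha> / \<alpha> + \<bar>u 0 1\<bar> powr \<beta> / \<beta> - ht * (u 0 0 * u 0 1)"
  define B where "B = (force_Lipschitz p (2 * M) * M\<^sup>2 / p + (2 * M) powr \<alpha> / \<alpha> + (2 * M) powr \<beta> / \<beta> + \<bar>ht\<bar> * (2 * M)\<^sup>2 - e0) / c"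
  have traces: "\<exists>d0 d1. L2_primitive 0 R (\<lambda>t. v t 0) d0 \<and> integral {0..R} (\<lambda>t. (d0 t)\<^sup>2) \<le> B
      \<and> L2_primitive 0 R (\<lambda>t. v t 1) d1 \<and> integral {0..R} (\<lambda>t. (d1 t)\<^sup>2) \<le> B" if R: "0 < R" "R < T" for R
  proof -
    obtain d0 d1 where s: "damped_wave_solution R u u' d0 d1 p \<alpha> \<beta> lam lam0 lam1 lamt ht" using sol[OF R] by blast
    interpret damped_wave_solution R u u' d0 d1 p \<alpha> \<beta> lam lam0 lam1 lamt ht by (rule s)
    have "c * (integral {0..R} (\<lambda>t. (d0 t)\<^sup>2) + integral {0..R} (\<lambda>t. (d1 t)\<^sup>2)) \<le> B * c"
      using trace_dissipation_bound[OF c coercive, of M] M R c by (simp add: B_def e0_def energy_def)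
    then have le: "integral {0..R} (\<lambda>t. (d0 t)\<^sup>2) + integral {0..R} (\<lambda>t. (d1 t)\<^sup>2) \<le> B"
      using c by (simp add: mult.commute)
    have nn: "0 \<le> integral {0..R} (\<lambda>t. (d t)\<^sup>2)" if "d \<in> L2 0 R" for d
      by (rule integral_nonneg) (use L2_mult_integrable_on[OF that that] in \<open>auto simp: power2_eq_square\<close>)
    have "L2_primitive 0 R (\<lambda>t. v t 0) d0" "L2_primitive 0 R (\<lambda>t. v t 1) d1"
      by (rule L2_primitive_cong[OF trace0] L2_primitive_cong[OF trace1]; use R in \<open>simp add: eqv\<close>)+
    then show ?thesis using le nn[OF L2_primitiveD(1)[OF trace0]] nn[OF L2_primitiveD(1)[OF trace1]]
      by (intro exI[of _ d0] exI[of _ d1]) auto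
  qed
  obtain d0 where d0: "L2_primitive 0 T (\<lambda>t. v t 0) d0" using L2_primitive_extend[OF T vx[of 0], of B] traces by (meson atLeastAtMost_iff order_refl zero_le_one)
  obtain d1 where d1: "L2_primitive 0 T (\<lambda>t. v t 1) d1" using L2_primitive_extend[OF T vx[of 1], of B] traces by (meson atLeastAtMost_iff order_refl zero_le_one)
  interpret v: wave_path T v v' d0 d1
    by unfold_locales (auto intro: T vH v'L vW vV vder d0 d1)
  interpret v: wave_solution T v v' d0 d1 p \<alpha> \<beta> lam lam0 lam1 lamt ht
  proof unfold_locales
    fix f assume f: "f \<in> H1 0 1"
    show "L2_primitive 0 T (\<lambda>t. inner (cls (v' t)) (cls f)) (\<lambda>t. - residual p \<alpha> \<beta> lam lam0 lam1 lamt ht v v' d0 d1 f t)"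
    proof (rule L2_primitive_closure[OF T])
      show "continuous_on {0..T} (\<lambda>t. inner (cls (v' t)) (cls f))" by (intro continuous_intros vV)
      show "(\<lambda>t. - residual p \<alpha> \<beta> lam lam0 lam1 lamt ht v v' d0 d1 f t) \<in> L2 0 T"
        by (rule L2_uminus[OF v.residual_L2[OF p \<alpha> \<beta>]])
      fix R assume R: "0 < R" "R < T"
      obtain e0 e1 where s: "damped_wave_solution R u u' e0 e1 p \<alpha> \<beta> lam lam0 lam1 lamt ht" using sol[OF R] by blast
      interpret damped_wave_solution R u u' e0 e1 p \<alpha> \<beta> lam lam0 lam1 lamt ht by (rule s)
      \<comment> \<open>The solution on [0, R] comes with its own densities; they are exchanged for
        the restrictions of \<open>d0\<close> and \<open>d1\<close>, so that the residual is one
        function for all R.\<close>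
      have "L2_primitive 0 R (\<lambda>t. u t 0) d0" "L2_primitive 0 R (\<lambda>t. u t 1) d1"
        by (rule L2_primitive_cong[OF L2_primitive_sub[OF d0 order_refl]] L2_primitive_cong[OF L2_primitive_sub[OF d1 order_refl]]; use R in \<open>simp add: eqv\<close>)+
      then interpret new: wave_solution R u u' d0 d1 p \<alpha> \<beta> lam lam0 lam1 lamt ht by (rule change_densities)
      show "L2_primitive 0 R (\<lambda>t. inner (cls (v' t)) (cls f)) (\<lambda>t. - residual p \<alpha> \<beta> lam lam0 lam1 lamt ht v v' d0 d1 f t)"
        by (rule L2_primitive_cong[OF new.equation[OF f]]) (use R in \<open>auto simp: eqv residual_def\<close>)
    qed
  qed (rule p \<alpha> \<beta>)+
  have init: "\<forall>x\<in>{0..1}. u 0 x = u0 x" "AE x in lebesgue_on {0<..<1}. u' 0 x = u1 x"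
  proof -
    have "weak_solution p \<alpha> \<beta> lam lam0 lam1 lamt ht u0 u1 (T/2) u u'" using T by (intro weak) auto
    then show "\<forall>x\<in>{0..1}. u 0 x = u0 x" "AE x in lebesgue_on {0<..<1}. u' 0 x = u1 x"
      unfolding weak_solution_def by blast+
  qed
  have "weak_solution p \<alpha> \<beta> lam lam0 lam1 lamt ht u0 u1 T v v'"
    by (rule v.weak_solution) (use init T in \<open>simp_all add: eqv\<close>)
  then show ?thesis using eqv(1) by blast
qed

theorem theorem3p1:
  fixes p \<alpha> \<beta> lam lam0 lam1 lamt ht q :: real
    and u0 u1 :: "real \<Rightarrow> real"
    and u u' :: "real \<Rightarrow> real \<Rightarrow> real"
    and Tmax :: ereal
  assumes "p > 2" and "\<alpha> > 2" and "\<beta> > 2"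
    and "lam > 0" and "lam0 > 0" and "lam1 > 0"
    and "\<bar>lamt\<bar> < sqrt (lam0 * lam1)"
    and "q = min p (min \<alpha> \<beta>)"
    and "\<bar>ht\<bar> < (q - 2) / (4 * (q + 2))"
    and "u0 \<in> H1 0 1" and "u1 \<in> L2 0 1"
    and "H_initial p \<alpha> \<beta> ht u0 u1 > 0"
    and "maximal_weak_solution p \<alpha> \<beta> lam lam0 lam1 lamt ht u0 u1 Tmax u u'"
  shows "blows_up_in_finite_time Tmax u u'"
proof -
  have q: "q > 2" using assms(1-3,8) by simp
  \<comment> \<open>The coupling enters the virial estimate and the lifespan bound through |ht|
    \<le> 1/4.\<close>
  have "(q - 2) / (4 * (q + 2)) \<le> 1 / 4" using q by (simp add: field_simps)
  then have ht: "\<bar>ht\<bar> \<le> 1 / 4" using assms(9) by linarith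
  have pos: "0 < Tmax"
    and weak: "\<And>T. 0 < T \<Longrightarrow> ereal T < Tmax \<Longrightarrow> weak_solution p \<alpha> \<beta> lam lam0 lam1 lamt ht u0 u1 T u u'"
    and maximal: "\<And>T v v'. Tmax \<le> ereal T \<Longrightarrow> weak_solution p \<alpha> \<beta> lam lam0 lam1 lamt ht u0 u1 T v v' \<Longrightarrow>
       \<not> (\<forall>t. 0 \<le> t \<and> ereal t < Tmax \<longrightarrow> (\<forall>x\<in>{0..1}. v t x = u t x))"
    using assms(13) unfolding maximal_weak_solution_def by blast+
  have fin: "Tmax < \<infinity>"
  proof (rule ccontr)
    assume "\<not> Tmax < \<infinity>"
    then have "Tmax = \<infinity>" by simp
    then have "\<And>T. 0 < T \<Longrightarrow> weak_solution p \<alpha> \<beta> lam lam0 lam1 lamt ht u0 u1 T u u'" using weak by simp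
    then show False
      by (rule no_global_weak_solution[OF assms(1-8) ht assms(10-12)])
  qed
  with pos obtain T where T: "Tmax = ereal T" "0 < T" by (cases Tmax) auto
  have "\<not> bdd_above ((\<lambda>t. L2_norm 0 1 (u' t) + H1_norm 0 1 (u t)) ` {t. 0 \<le> t \<and> ereal t < Tmax})"
  proof
    assume "bdd_above ((\<lambda>t. L2_norm 0 1 (u' t) + H1_norm 0 1 (u t)) ` {t. 0 \<le> t \<and> ereal t < Tmax})"
    then obtain M where M: "\<And>t. 0 \<le> t \<Longrightarrow> t < T \<Longrightarrow> L2_norm 0 1 (u' t) + H1_norm 0 1 (u t) \<le> M"
      unfolding bdd_above_def T by auto
    \<comment> \<open>Maximality excludes extensions to [0, T] already for T equal to the maximal
      time, so reaching the closed interval is a contradiction.\<close>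
    obtain v v' where v: "weak_solution p \<alpha> \<beta> lam lam0 lam1 lamt ht u0 u1 T v v'" "\<forall>t. 0 \<le> t \<and> t < T \<longrightarrow> v t = u t"
      using bounded_weak_solution_extends[OF assms(1-7) T(2), of ht u0 u1 u u' M] weak M by (auto simp: T)
    then show False using maximal[of T v v'] T by simp
  qed
  with fin show ?thesis unfolding blows_up_in_finite_time_def by blast
qed

end
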